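(* Let $(E,\mathbf T)\in\mathcal L(\mathcal X,\mathcal Y)\times\mathcal L(\mathcal X)^d$ be an output stable pair, $\mathbf x\in\mathcal X$ a vector and $S_0\in\mathcal S_{\mathrm{nc},d}(\mathcal U,\mathcal Y)$ a Schur-class multiplier. Let $N\in\mathcal L(\mathcal X,\mathcal U)$ be defined by $N^*=\mathcal O_{E,\mathbf T}^*M_{S_0}|_{\mathcal U}$ and assume that $P:=\mathcal O_{E,\mathbf T}^*\mathcal O_{E,\mathbf T}-\mathcal O_{N,\mathbf T}^*\mathcal O_{N,\mathbf T}$ is strictly positive definite. Put $C=\begin{bmatrix}E\\ N\end{bmatrix}$, let $\mathcal F$ be a Hilbert space and $\begin{bmatrix}B\\ D\end{bmatrix}:\mathcal F\oplus\mathcal U\to\begin{bmatrix}\mathcal X^d\\ \mathcal Y\oplus\mathcal U\end{bmatrix}$ an injective bounded operator satisfying $$\begin{bmatrix}B\\ D\end{bmatrix}J_{\mathcal F,\mathcal U}\begin{bmatrix}B^*&D^*\end{bmatrix}=\begin{bmatrix}P^{-1}\otimes I_d&0\\ 0&J_{\mathcal Y,\mathcal U}\end{bmatrix}-\begin{bmatrix}T\\ C\end{bmatrix}P^{-1}\begin{bmatrix}T^*&C^*\end{bmatrix},$$ and let $\mathfrak A(z)=\begin{bmatrix}\mathfrak A_{11}(z)&\mathfrak A_{12}(z)\\ \mathfrak A_{21}(z)&\mathfrak A_{22}(z)\end{bmatrix}=D+C(I-Z(z)T)^{-1}Z(z)B$. Then there exists $\mathcal E_0\in\mathcal S_{\mathrm{nc},d}(\mathcal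 U,\mathcal F)$ such that $$S_0=(\mathfrak A_{11}\mathcal E_0+\mathfrak A_{12})(\mathfrak A_{21}\mathcal E_0+\mathfrak A_{22})^{-1}.$$ Furthermore, for such $\mathcal E_0$ let $$u(z)=\mathfrak A_{11}(z)-S_0(z)\mathfrak A_{21}(z),\qquad \mathcal M=\mathcal H(\mathcal E_0)\ominus\operatorname{Ker}M_u,$$ where $M_u:\mathcal H(\mathcal E_0)\to\mathcal H(S_0)$ is the operator $\sigma\mapsto u\sigma$. Then $f\in\mathcal Y\langle\langle z\rangle\rangle$ is a solution of the interpolation problem ($f\in\mathcal H(S_0)$ and $\mathcal O_{E,\mathbf T}^*f=\mathbf x$) if and only if $f$ is of the form $$f(z)=f_0(z)+u(z)\sigma(z),\qquad\sigma\in\mathcal M,$$ where $f_0(z)=(E-S_0(z)N)(I_{\mathcal X}-Z(z)T)^{-1}P^{-1}\mathbf x$ and $\sigma$ is a free parameter from $\mathcal M$. Furthermore, for $f$ of this form, $$\|f\|^2_{\mathcal H(S_0)}=\|f_0\|^2_{\mathcal H(S_0)}+\|u\sigma\|^2_{\mathcal H(S_0)}=\|P^{-1/2}\mathbf x\|^2_{\mathcal X}+\|\sigma\|^2_{\mathcal H(\mathcal E_0)}.$$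
   Context: All Hilbert spaces are complex and separable; $\mathcal L(\mathcal U,\mathcal Y)$ denotes bounded operators. $\mathcal X,\mathcal Y,\mathcal U$ are Hilbert spaces and $d\ge1$ an integer. $\mathbb F_d^+$ is the free monoid on letters $\{1,\dots,d\}$ with empty word $\emptyset$. $z=(z_1,\dots,z_d)$ are noncommuting formal indeterminates, $z^\alpha=z_{i_N}\cdots z_{i_1}$ for $\alpha=i_N\cdots i_1$, and for a tuple $\mathbf T=(T_1,\dots,T_d)\in\mathcal L(\mathcal X)^d$, $\mathbf T^\alpha=T_{i_N}\cdots T_{i_1}$. $\mathcal Y\langle\langle z\rangle\rangle$ and $\mathcal L(\mathcal U,\mathcal Y)\langle\langle z\rangle\rangle$ denote formal power series $\sum_\alpha f_\alpha z^\alpha$ with coefficients in the indicated space, multiplied by $(\sum S_\alpha z^\alpha)(\sum u_\alpha z^\alpha)=\sum_\alpha(\sum_{\beta\gamma=\alpha}S_\beta u_\gamma)z^\alpha$. A formal power series is invertible iff its coefficient at $\emptyset$ is boundedly invertible. The Fock space is $H^2_{\mathcal Y}(\mathbb F_d^+)=\{\sum f_\alpha z^\alpha:\ \sum\|f_\alpha\|^2<\infty\}$. $\mathcal S_{\mathrm{nc},d}(\mathcal U,\mathcal Y)$ is the set of $S\in\mathcal L(\mathcal U,\mathcal Y)\langle\langle z\rangle\rangle$ such that $M_S:u\mapsto Su$ is a contraction from $H^2_{\mathcal U}(\mathbb F_d^+)$ to $H^2_{\mathcal Y}(\mathbb F_d^+)$. For such $S$, $\mathcal H(S)=\operatorname{Ran}(I-M_SM_S^*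 )^{1/2}$ with norm $\|(I-M_SM_S^* )^{1/2}g\|_{\mathcal H(S)}=\|(I-\pi)g\|_{H^2_{\mathcal Y}(\mathbb F_d^+)}$, $\pi$ the orthogonal projection onto $\operatorname{Ker}(I-M_SM_S^* )^{1/2}$. $Z(z)=[z_1\ \cdots\ z_d]\otimes I_{\mathcal X}$ (row) and $T=\begin{bmatrix}T_1\\ \vdots\\ T_d\end{bmatrix}:\mathcal X\to\mathcal X^d$. The observability operator is $\mathcal O_{E,\mathbf T}x=\sum_\alpha(E\mathbf T^\alpha x)z^\alpha=E(I-Z(z)T)^{-1}x$; $(E,\mathbf T)$ is output stable if $\mathcal O_{E,\mathbf T}$ is bounded from $\mathcal X$ to $H^2_{\mathcal Y}(\mathbb F_d^+)$. $\mathcal U$ in $M_{S_0}|_{\mathcal U}$ is identified with the constant series. The pair $(N,\mathbf T)$ is then also output stable. $J_{\mathcal Y,\mathcal U}=\begin{bmatrix}I_{\mathcal Y}&0\\ 0&-I_{\mathcal U}\end{bmatrix}$ and likewise $J_{\mathcal F,\mathcal U}$. Blocks of $\mathfrak A$ are with respect to $\mathcal F\oplus\mathcal U\to\mathcal Y\oplus\mathcal U$. Strictly positive definite means positive semidefinite and boundedly invertible. *)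

theory Defs
  imports "HOL-Analysis.Analysis" "HOL-Library.Function_Algebras"
begin

section \<open>Complex Hilbert spaces\<close>

text \<open>The real inner product, norm and topology are those of the library; they are the ones
  induced by the complex inner product, which is linear in its first argument.  Separability is
  not part of the class: it is imposed by the additional sort
  \<^class>\<open>second_countable_topology\<close>, which for metric spaces means separability.\<close>

class chilbert_space = real_inner + complete_space +
  fixes scaleC :: "complex \<Rightarrow> 'a \<Rightarrow> 'a"  (infixr "*\<^sub>C" 75)
    and cinner :: "'a \<Rightarrow> 'a \<Rightarrow> complex"
  assumes scaleC_add_right: "c *\<^sub>C (x + y) = c *\<^sub>C x + c *\<^sub>C y"
    and scaleC_add_left: "(b + c) *\<^sub>C x = b *\<^sub>C x + c *\<^sub>C x"
    and scaleC_scaleC: "b *\<^sub>C c *\<^sub>C x = (b * c) *\<^sub>C x"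
    and scaleC_of_real: "complex_of_real r *\<^sub>C x = r *\<^sub>R x"
    and cinner_commute: "cinner x y = cnj (cinner y x)"
    and cinner_add_left: "cinner (x + y) z = cinner x z + cinner y z"
    and cinner_scaleC_left: "cinner (c *\<^sub>C x) y = c * cinner x y"
    and Re_cinner: "Re (cinner x y) = inner x y"
begin

lemma cinner_add_right: "cinner z (x + y) = cinner z x + cinner z y"
  unfolding cinner_commute[of z] by (simp add: cinner_add_left)

lemma cinner_scaleC_right: "cinner y (c *\<^sub>C x) = cnj c * cinner y x"
  unfolding cinner_commute[of y] by (simp add: cinner_scaleC_left)

lemma cinner_self: "cinner x x = complex_of_real ((norm x)\<^sup>2)"
proof -
  have "Im (cinner x x) = 0"
    using arg_cong[OF cinner_commute[of x x], of Im] by simp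
  moreover have "Re (cinner x x) = (norm x)\<^sup>2"
    by (simp add: Re_cinner norm_eq_sqrt_inner)
  ultimately show ?thesis by (simp add: complex_eq_iff)
qed

lemma norm_scaleC: "norm (c *\<^sub>C x) = cmod c * norm x"
proof -
  have "complex_of_real ((norm (c *\<^sub>C x))\<^sup>2) = c * cnj c * complex_of_real ((norm x)\<^sup>2)"
    by (simp only: cinner_self[symmetric] cinner_scaleC_left cinner_scaleC_right mult_ac)
  also have "\<dots> = complex_of_real ((cmod c * norm x)\<^sup>2)"
    by (simp only: complex_norm_square[symmetric] power_mult_distrib of_real_mult of_real_power)
  finally have "(norm (c *\<^sub>C x))\<^sup>2 = (cmod c * norm x)\<^sup>2"
    by (simp only: of_real_eq_iff)
  moreover have "0 \<le> norm (c *\<^sub>C x)" "0 \<le> norm x"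
    by (simp_all add: norm_eq_sqrt_inner)
  ultimately show ?thesis
    by (simp add: power2_eq_iff_nonneg)
qed

end

lemma norm_cinner_le:
  fixes x y :: "'a::chilbert_space"
  shows "cmod (cinner x y) \<le> norm x * norm y"
proof (cases "cinner x y = 0")
  case False
  define c where "c = cnj (cinner x y) / cmod (cinner x y)"
  have c1: "cmod c = 1" using False by (simp add: c_def norm_divide)
  have "c * cinner x y = complex_of_real (cmod (cinner x y))"
    using False complex_norm_square[of "cinner x y"] unfolding c_def
    by (simp add: mult.commute divide_simps power2_eq_square)
  hence "cmod (cinner x y) = inner (c *\<^sub>C x) y"
    by (metis Re_cinner Re_complex_of_real cinner_scaleC_left)
  also have "\<dots> \<le> norm (c *\<^sub>C x) * norm y" by (rule norm_cauchy_schwarz)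
  also have "\<dots> = norm x * norm y" by (simp add: norm_scaleC c1)
  finally show ?thesis .
qed simp

instantiation complex :: chilbert_space
begin
definition "scaleC_complex = ((*) :: complex \<Rightarrow> complex \<Rightarrow> complex)"
definition "cinner_complex x y = x * cnj (y :: complex)"
instance
  by standard (auto simp: scaleC_complex_def cinner_complex_def algebra_simps
      inner_complex_def scaleR_conv_of_real)
end

instantiation prod :: (chilbert_space, chilbert_space) chilbert_space
begin
definition "scaleC_prod c (x :: 'a \<times> 'b) = (c *\<^sub>C fst x, c *\<^sub>C snd x)"
definition "cinner_prod (x :: 'a \<times> 'b) y = cinner (fst x) (fst y) + cinner (snd x) (snd y)"
instance
proof
  fix x y :: "'a \<times> 'b"
  show "cinner x y = cnj (cinner y x)"
    unfolding cinner_prod_def complex_cnj_add cinner_commute[symmetric] ..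
qed (auto simp: scaleC_prod_def cinner_prod_def prod_eq_iff scaleC_add_right scaleC_add_left
      scaleC_scaleC scaleC_of_real cinner_add_left cinner_scaleC_left algebra_simps
      Re_cinner inner_prod_def)
end

instantiation vec :: (chilbert_space, finite) chilbert_space
begin
definition "scaleC_vec c (x :: 'a ^ 'b) = (\<chi> i. c *\<^sub>C x $ i)"
definition "cinner_vec (x :: 'a ^ 'b) y = (\<Sum>i\<in>UNIV. cinner (x $ i) (y $ i))"
instance
proof
  fix x y :: "'a ^ 'b"
  show "cinner x y = cnj (cinner y x)"
    unfolding cinner_vec_def cnj_sum cinner_commute[symmetric] ..
qed (auto simp: scaleC_vec_def cinner_vec_def vec_eq_iff scaleC_add_right scaleC_add_left
      scaleC_scaleC scaleC_of_real cinner_add_left cinner_scaleC_left sum.distrib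
      Re_cinner inner_vec_def sum_distrib_left)
end

section \<open>Bounded operators\<close>

text \<open>Library type \<^typ>\<open>'a \<Rightarrow>\<^sub>L 'b\<close> consists of the bounded real-linear maps; the elements
  of \<open>\<L>(\<U>,\<Y>)\<close> are those satisfying the following predicate.\<close>

definition is_clinear :: "('a::chilbert_space \<Rightarrow>\<^sub>L 'b::chilbert_space) \<Rightarrow> bool" where
  "is_clinear A \<longleftrightarrow> (\<forall>c x. A (c *\<^sub>C x) = c *\<^sub>C A x)"

definition op_adj :: "('a::chilbert_space \<Rightarrow>\<^sub>L 'b::chilbert_space) \<Rightarrow> 'b \<Rightarrow>\<^sub>L 'a" where
  "op_adj A = (THE B :: 'b \<Rightarrow>\<^sub>L 'a. \<forall>x y. cinner (A x) y = cinner x (B y))"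

definition op_inverse_of ::
    "('a::chilbert_space \<Rightarrow>\<^sub>L 'b::chilbert_space) \<Rightarrow> ('b \<Rightarrow>\<^sub>L 'a) \<Rightarrow> bool" where
  "op_inverse_of A B \<longleftrightarrow> is_clinear B \<and> A o\<^sub>L B = id_blinfun \<and> B o\<^sub>L A = id_blinfun"

definition op_inv :: "('a::chilbert_space \<Rightarrow>\<^sub>L 'b::chilbert_space) \<Rightarrow> 'b \<Rightarrow>\<^sub>L 'a" where
  "op_inv A = (THE B. op_inverse_of A B)"

definition op_pos :: "('a::chilbert_space \<Rightarrow>\<^sub>L 'a) \<Rightarrow> bool" where
  "op_pos A \<longleftrightarrow> is_clinear A \<and> (\<forall>x. cinner (A x) x \<in> \<real>\<^sub>\<ge>\<^sub>0)"

definition op_strictly_pos :: "('a::chilbert_space \<Rightarrow>\<^sub>L 'a) \<Rightarrow> bool" where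
  "op_strictly_pos A \<longleftrightarrow> op_pos A \<and> (\<exists>B. op_inverse_of A B)"

definition op_sqrt :: "('a::chilbert_space \<Rightarrow>\<^sub>L 'a) \<Rightarrow> 'a \<Rightarrow>\<^sub>L 'a" where
  "op_sqrt A = (THE R. op_pos R \<and> R o\<^sub>L R = A)"

definition op_ker :: "('a::chilbert_space \<Rightarrow>\<^sub>L 'b::chilbert_space) \<Rightarrow> 'a set" where
  "op_ker A = {x. A x = 0}"

definition orth_proj :: "'a::chilbert_space set \<Rightarrow> 'a \<Rightarrow> 'a" where
  "orth_proj M x = (THE y. y \<in> M \<and> (\<forall>m\<in>M. cinner (x - y) m = 0))"

text \<open>Block operators: a column with two entries, a diagonal with two entries, a column indexed
  by \<open>'d\<close>, and \<open>A \<otimes> I\<^sub>d\<close>.\<close>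

definition col2 :: "('a::chilbert_space \<Rightarrow>\<^sub>L 'b::chilbert_space) \<Rightarrow>
    ('a \<Rightarrow>\<^sub>L 'c::chilbert_space) \<Rightarrow> 'a \<Rightarrow>\<^sub>L ('b \<times> 'c)" where
  "col2 A B = Blinfun (\<lambda>x. (A x, B x))"

lemma col2_apply [simp]: "blinfun_apply (col2 A B) x = (A x, B x)"
  unfolding col2_def
  by (subst bounded_linear_Blinfun_apply)
    (intro bounded_linear_Pair blinfun.bounded_linear_right, rule refl)

definition diag2 :: "('a::chilbert_space \<Rightarrow>\<^sub>L 'b::chilbert_space) \<Rightarrow>
    ('c::chilbert_space \<Rightarrow>\<^sub>L 'e::chilbert_space) \<Rightarrow> ('a \<times> 'c) \<Rightarrow>\<^sub>L ('b \<times> 'e)" where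
  "diag2 A B = Blinfun (\<lambda>x. (A (fst x), B (snd x)))"

lemma diag2_apply [simp]: "blinfun_apply (diag2 A B) x = (A (fst x), B (snd x))"
  unfolding diag2_def
  by (subst bounded_linear_Blinfun_apply)
    (intro bounded_linear_Pair bounded_linear_compose[OF blinfun.bounded_linear_right bounded_linear_fst]
      bounded_linear_compose[OF blinfun.bounded_linear_right bounded_linear_snd], rule refl)

lemma bounded_linear_vec_lambda:
  fixes f :: "'d::finite \<Rightarrow> 'a::real_normed_vector \<Rightarrow> 'b::real_normed_vector"
  assumes "\<And>i. bounded_linear (f i)"
  shows "bounded_linear (\<lambda>x. \<chi> i. f i x)"
proof -
  interpret f: bounded_linear "f i" for i by fact
  obtain K where K: "\<And>i x. norm (f i x) \<le> norm x * K i"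
    using f.bounded by metis
  show ?thesis
  proof (rule bounded_linear_intro)
    fix x
    have "norm (\<chi> i. f i x) \<le> (\<Sum>i\<in>UNIV. norm (f i x))"
      unfolding norm_vec_def by (simp add: L2_set_le_sum)
    also have "\<dots> \<le> (\<Sum>i\<in>UNIV. norm x * K i)" by (intro sum_mono K)
    finally show "norm (\<chi> i. f i x) \<le> norm x * (\<Sum>i\<in>UNIV. K i)"
      by (simp add: sum_distrib_left)
  qed (simp_all add: vec_eq_iff f.add f.scaleR)
qed

definition col :: "('d::finite \<Rightarrow> 'a::chilbert_space \<Rightarrow>\<^sub>L 'b::chilbert_space) \<Rightarrow>
    'a \<Rightarrow>\<^sub>L ('b ^ 'd)" where
  "col T = Blinfun (\<lambda>x. \<chi> i. T i x)"

lemma col_apply [simp]: "blinfun_apply (col T) x = (\<chi> i. T i x)"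
  unfolding col_def
  by (subst bounded_linear_Blinfun_apply)
    (intro bounded_linear_vec_lambda blinfun.bounded_linear_right, rule refl)

definition tensor_id :: "('a::chilbert_space \<Rightarrow>\<^sub>L 'b::chilbert_space) \<Rightarrow>
    ('a ^ 'd::finite) \<Rightarrow>\<^sub>L ('b ^ 'd)" where
  "tensor_id A = Blinfun (\<lambda>v. \<chi> i. A (v $ i))"

lemma tensor_id_apply [simp]: "blinfun_apply (tensor_id A) v = (\<chi> i. A (v $ i))"
  unfolding tensor_id_def
  by (subst bounded_linear_Blinfun_apply)
    (intro bounded_linear_vec_lambda
      bounded_linear_compose[OF blinfun.bounded_linear_right bounded_linear_vec_nth], rule refl)

definition vec_proj :: "'d::finite \<Rightarrow> ('a::chilbert_space ^ 'd) \<Rightarrow>\<^sub>L 'a" where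
  "vec_proj i = Blinfun (\<lambda>v. v $ i)"

lemma vec_proj_apply [simp]: "blinfun_apply (vec_proj i) v = v $ i"
  unfolding vec_proj_def
  by (subst bounded_linear_Blinfun_apply)
    (intro bounded_linear_vec_nth, rule refl)

definition inl_op :: "'a::chilbert_space \<Rightarrow>\<^sub>L ('a \<times> 'b::chilbert_space)" where
  "inl_op = Blinfun (\<lambda>x. (x, 0))"

lemma inl_op_apply [simp]: "blinfun_apply inl_op x = (x, 0)"
  unfolding inl_op_def
  by (subst bounded_linear_Blinfun_apply)
    (intro bounded_linear_Pair bounded_linear_ident bounded_linear_zero, rule refl)

definition inr_op :: "'b::chilbert_space \<Rightarrow>\<^sub>L ('a::chilbert_space \<times> 'b)" where
  "inr_op = Blinfun (\<lambda>y. (0, y))"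

lemma inr_op_apply [simp]: "blinfun_apply inr_op y = (0, y)"
  unfolding inr_op_def
  by (subst bounded_linear_Blinfun_apply)
    (intro bounded_linear_Pair bounded_linear_ident bounded_linear_zero, rule refl)

definition J_op :: "('a::chilbert_space \<times> 'b::chilbert_space) \<Rightarrow>\<^sub>L ('a \<times> 'b)" where
  "J_op = diag2 id_blinfun (- id_blinfun)"

section \<open>The Fock space\<close>

text \<open>The word \<open>i\<^sub>N \<cdots> i\<^sub>1\<close> is the list \<open>[i\<^sub>N, \<dots>, i\<^sub>1]\<close> over a finite (hence nonempty) type of
  letters; concatenation of words is \<open>(@)\<close>.  A formal power series is the function
  \<open>\<alpha> \<mapsto> f\<^sub>\<alpha>\<close> of its coefficients.\<close>

typedef (overloaded) ('d, 'a::chilbert_space) fock =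
    "{f :: 'd list \<Rightarrow> 'a. (\<lambda>\<alpha>. (norm (f \<alpha>))\<^sup>2) summable_on UNIV}"
  morphisms fock_coeff Abs_fock
  by (rule exI[of _ "\<lambda>_. 0"]) simp

setup_lifting type_definition_fock

lemma summable_norm2_bound:
  fixes f :: "'i \<Rightarrow> 'a::real_normed_vector"
  assumes f: "(\<lambda>i. (norm (f i))\<^sup>2) summable_on UNIV"
    and g: "(\<lambda>i. (norm (g i))\<^sup>2) summable_on UNIV"
    and h: "\<And>i. norm (h i) \<le> 2 * (norm (f i))\<^sup>2 + 2 * (norm (g i :: 'a))\<^sup>2"
  shows "(\<lambda>i. h i :: 'c::banach) summable_on UNIV"
proof (rule abs_summable_summable, rule summable_on_comparison_test)
  show "(\<lambda>i. 2 * (norm (f i))\<^sup>2 + 2 * (norm (g i))\<^sup>2) summable_on UNIV"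
    by (intro summable_on_add summable_on_cmult_right f g)
qed (use h in auto)

lemma norm_add_sq_le:
  fixes x y :: "'a::real_normed_vector"
  shows "(norm (x + y))\<^sup>2 \<le> 2 * (norm x)\<^sup>2 + 2 * (norm y)\<^sup>2"
proof -
  have "(norm (x + y))\<^sup>2 \<le> (norm x + norm y)\<^sup>2"
    by (simp add: norm_triangle_ineq power_mono)
  also have "\<dots> \<le> 2 * (norm x)\<^sup>2 + 2 * (norm y)\<^sup>2"
    using sum_squares_bound[of "norm x" "norm y"] by (simp add: power2_sum)
  finally show ?thesis .
qed

lemma norm_cinner_le_sq:
  fixes x y :: "'a::chilbert_space"
  shows "cmod (cinner x y) \<le> 2 * (norm x)\<^sup>2 + 2 * (norm y)\<^sup>2"
proof -
  have "cmod (cinner x y) \<le> norm x * norm y" by (rule norm_cinner_le)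
  also have "\<dots> \<le> 2 * (norm x)\<^sup>2 + 2 * (norm y)\<^sup>2"
    using sum_squares_bound[of "norm x" "norm y"] zero_le_power2[of "norm x"]
      zero_le_power2[of "norm y"] by linarith
  finally show ?thesis .
qed

lemma abs_inner_le_sq:
  fixes x y :: "'a::chilbert_space"
  shows "\<bar>inner x y\<bar> \<le> 2 * (norm x)\<^sup>2 + 2 * (norm y)\<^sup>2"
  by (metis Re_cinner abs_Re_le_cmod norm_cinner_le_sq order_trans)

lemma fock_eq_iff: "f = g \<longleftrightarrow> (\<forall>\<alpha>. fock_coeff f \<alpha> = fock_coeff g \<alpha>)"
  by (simp add: fun_eq_iff flip: fock_coeff_inject)

lemma sq_summable_add:
  fixes f g :: "'i \<Rightarrow> 'a::real_normed_vector"
  assumes "(\<lambda>\<alpha>. (norm (f \<alpha>))\<^sup>2) summable_on UNIV" "(\<lambda>\<alpha>. (norm (g \<alpha>))\<^sup>2) summable_on UNIV"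
  shows "(\<lambda>\<alpha>. (norm (f \<alpha> + g \<alpha>))\<^sup>2) summable_on UNIV"
  by (rule summable_norm2_bound[OF assms]) (simp add: norm_add_sq_le)

lemma sq_summable_diff:
  fixes f g :: "'i \<Rightarrow> 'a::real_normed_vector"
  assumes "(\<lambda>\<alpha>. (norm (f \<alpha>))\<^sup>2) summable_on UNIV" "(\<lambda>\<alpha>. (norm (g \<alpha>))\<^sup>2) summable_on UNIV"
  shows "(\<lambda>\<alpha>. (norm (f \<alpha> - g \<alpha>))\<^sup>2) summable_on UNIV"
  using sq_summable_add[of f "\<lambda>\<alpha>. - g \<alpha>"] assms by simp

instantiation fock :: (type, chilbert_space) real_vector
begin
lift_definition zero_fock :: "('a, 'b) fock" is "\<lambda>_. 0" by simp
lift_definition plus_fock :: "('a, 'b) fock \<Rightarrow> ('a, 'b) fock \<Rightarrow> ('a, 'b) fock"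
  is "\<lambda>f g \<alpha>. f \<alpha> + g \<alpha>"
  by (rule sq_summable_add)
lift_definition minus_fock :: "('a, 'b) fock \<Rightarrow> ('a, 'b) fock \<Rightarrow> ('a, 'b) fock"
  is "\<lambda>f g \<alpha>. f \<alpha> - g \<alpha>"
  by (rule sq_summable_diff)
lift_definition uminus_fock :: "('a, 'b) fock \<Rightarrow> ('a, 'b) fock" is "\<lambda>f \<alpha>. - f \<alpha>" by simp
lift_definition scaleR_fock :: "real \<Rightarrow> ('a, 'b) fock \<Rightarrow> ('a, 'b) fock" is "\<lambda>r f \<alpha>. r *\<^sub>R f \<alpha>"
  by (simp add: power_mult_distrib) (intro summable_on_cmult_right)
instance
proof
  fix f g h :: "('a, 'b) fock" and r s :: real
  show "f + g + h = f + (g + h)"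
    by (simp add: fock_eq_iff plus_fock.rep_eq add.assoc)
  show "f + g = g + f"
    by (simp add: fock_eq_iff plus_fock.rep_eq add.commute)
  show "0 + f = f"
    by (simp add: fock_eq_iff plus_fock.rep_eq zero_fock.rep_eq)
  show "- f + f = 0"
    by (simp add: fock_eq_iff plus_fock.rep_eq zero_fock.rep_eq uminus_fock.rep_eq)
  show "f - g = f + - g"
    by (simp add: fock_eq_iff plus_fock.rep_eq minus_fock.rep_eq uminus_fock.rep_eq)
  show "r *\<^sub>R (f + g) = r *\<^sub>R f + r *\<^sub>R g"
    by (simp add: fock_eq_iff plus_fock.rep_eq scaleR_fock.rep_eq scaleR_add_right)
  show "(r + s) *\<^sub>R f = r *\<^sub>R f + s *\<^sub>R f"
    by (simp add: fock_eq_iff plus_fock.rep_eq scaleR_fock.rep_eq scaleR_add_left)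
  show "r *\<^sub>R s *\<^sub>R f = (r * s) *\<^sub>R f"
    by (simp add: fock_eq_iff scaleR_fock.rep_eq)
  show "1 *\<^sub>R f = f"
    by (simp add: fock_eq_iff scaleR_fock.rep_eq)
qed
end

lemma fock_summable_inner:
  "(\<lambda>\<alpha>. inner (fock_coeff f \<alpha>) (fock_coeff g \<alpha>)) summable_on UNIV"
  by (rule summable_norm2_bound[of "fock_coeff f" "fock_coeff g"])
    (use fock_coeff[of f] fock_coeff[of g] in \<open>simp_all add: abs_inner_le_sq\<close>)

lemma fock_summable_cinner:
  "(\<lambda>\<alpha>. cinner (fock_coeff f \<alpha>) (fock_coeff g \<alpha>)) summable_on UNIV"
  by (rule summable_norm2_bound[of "fock_coeff f" "fock_coeff g"])
    (use fock_coeff[of f] fock_coeff[of g] in \<open>simp_all add: norm_cinner_le_sq\<close>)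

instantiation fock :: (type, chilbert_space) real_inner
begin
definition "inner_fock (f :: ('a, 'b) fock) g =
  (\<Sum>\<^sub>\<infinity>\<alpha>. inner (fock_coeff f \<alpha>) (fock_coeff g \<alpha>))"
definition "norm_fock (f :: ('a, 'b) fock) = sqrt (inner f f)"
definition "sgn_fock (f :: ('a, 'b) fock) = f /\<^sub>R norm f"
definition "dist_fock (f :: ('a, 'b) fock) g = norm (f - g)"
definition "uniformity_fock =
  (INF e\<in>{0 <..}. principal {(x :: ('a, 'b) fock, y). dist x y < e})"
definition "open_fock (U :: ('a, 'b) fock set) =
  (\<forall>x\<in>U. eventually (\<lambda>(x', y). x' = x \<longrightarrow> y \<in> U) uniformity)"
instance
proof
  fix f g h :: "('a, 'b) fock" and r :: real
  show "inner f g = inner g f"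
    by (simp add: inner_fock_def inner_commute)
  show "inner (f + g) h = inner f h + inner g h"
    by (simp add: inner_fock_def plus_fock.rep_eq inner_add_left infsum_add fock_summable_inner)
  show "inner (r *\<^sub>R f) g = r * inner f g"
    by (simp add: inner_fock_def scaleR_fock.rep_eq infsum_cmult_right fock_summable_inner)
  show "0 \<le> inner f f"
    by (simp add: inner_fock_def infsum_nonneg)
  show "inner f f = 0 \<longleftrightarrow> f = 0"
  proof
    assume "inner f f = 0"
    hence "inner (fock_coeff f \<alpha>) (fock_coeff f \<alpha>) = 0" for \<alpha>
      by (intro nonneg_infsum_le_0D[of _ UNIV]) (auto simp: inner_fock_def fock_summable_inner)
    thus "f = 0" by (simp add: zero_fock.rep_eq fun_eq_iff flip: fock_coeff_inject)
  qed (simp add: inner_fock_def zero_fock.rep_eq)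
qed (rule norm_fock_def sgn_fock_def dist_fock_def uniformity_fock_def open_fock_def)+
end

lemma norm_fock_sq: "(norm f)\<^sup>2 = (\<Sum>\<^sub>\<infinity>\<alpha>. (norm (fock_coeff f \<alpha>))\<^sup>2)"
  by (simp add: power2_norm_eq_inner inner_fock_def)

lemma norm_fock_coeff_sum_le:
  assumes "finite F"
  shows "(\<Sum>\<alpha>\<in>F. (norm (fock_coeff f \<alpha>))\<^sup>2) \<le> (norm f)\<^sup>2"
  unfolding norm_fock_sq by (rule finite_sum_le_infsum) (use assms fock_coeff[of f] in auto)

lemma norm_fock_coeff_le: "norm (fock_coeff f \<alpha>) \<le> norm f"
  using norm_fock_coeff_sum_le[of "{\<alpha>}" f] by (simp add: power2_le_iff_abs_le)

instance fock :: (type, chilbert_space) complete_space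
proof
  fix X :: "nat \<Rightarrow> ('a, 'b) fock"
  assume C: "Cauchy X"
  have "Cauchy (\<lambda>n. fock_coeff (X n) \<alpha>)" for \<alpha>
  proof (rule CauchyI)
    fix e :: real assume "0 < e"
    then obtain M where "\<And>m n. m \<ge> M \<Longrightarrow> n \<ge> M \<Longrightarrow> norm (X m - X n) < e"
      using CauchyD[OF C] by blast
    moreover have "norm (fock_coeff (X m) \<alpha> - fock_coeff (X n) \<alpha>) \<le> norm (X m - X n)" for m n
      using norm_fock_coeff_le[of "X m - X n" \<alpha>] by (simp add: minus_fock.rep_eq)
    ultimately show "\<exists>M. \<forall>m\<ge>M. \<forall>n\<ge>M. norm (fock_coeff (X m) \<alpha> - fock_coeff (X n) \<alpha>) < e"
      using le_less_trans by blast
  qed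
  hence "\<forall>\<alpha>. \<exists>l. (\<lambda>n. fock_coeff (X n) \<alpha>) \<longlonglongrightarrow> l"
    using Cauchy_convergent convergent_def by blast
  then obtain g where g: "\<And>\<alpha>. (\<lambda>n. fock_coeff (X n) \<alpha>) \<longlonglongrightarrow> g \<alpha>"
    by metis
  have key: "(\<Sum>\<alpha>\<in>F. (norm (fock_coeff (X m) \<alpha> - g \<alpha>))\<^sup>2) \<le> e\<^sup>2"
    if M: "\<And>m n. m \<ge> M \<Longrightarrow> n \<ge> M \<Longrightarrow> norm (X m - X n) < e" and m: "m \<ge> M" and F: "finite F"
    for e M m F
  proof (rule LIMSEQ_le_const2)
    show "(\<lambda>n. \<Sum>\<alpha>\<in>F. (norm (fock_coeff (X m) \<alpha> - fock_coeff (X n) \<alpha>))\<^sup>2)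
      \<longlonglongrightarrow> (\<Sum>\<alpha>\<in>F. (norm (fock_coeff (X m) \<alpha> - g \<alpha>))\<^sup>2)"
      by (intro tendsto_intros g)
    have "(\<Sum>\<alpha>\<in>F. (norm (fock_coeff (X m) \<alpha> - fock_coeff (X n) \<alpha>))\<^sup>2) \<le> e\<^sup>2" if "n \<ge> M" for n
    proof -
      have "(\<Sum>\<alpha>\<in>F. (norm (fock_coeff (X m) \<alpha> - fock_coeff (X n) \<alpha>))\<^sup>2) \<le> (norm (X m - X n))\<^sup>2"
        using norm_fock_coeff_sum_le[OF F, of "X m - X n"] by (simp add: minus_fock.rep_eq)
      also have "\<dots> \<le> e\<^sup>2"
        using M[OF m that] by (intro power_mono) auto
      finally show ?thesis .
    qed
    thus "\<exists>N. \<forall>n\<ge>N. (\<Sum>\<alpha>\<in>F. (norm (fock_coeff (X m) \<alpha> - fock_coeff (X n) \<alpha>))\<^sup>2) \<le> e\<^sup>2"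
      by blast
  qed
  have diff: "(\<lambda>\<alpha>. (norm (fock_coeff (X m) \<alpha> - g \<alpha>))\<^sup>2) summable_on UNIV"
    if M: "\<And>m n. m \<ge> M \<Longrightarrow> n \<ge> M \<Longrightarrow> norm (X m - X n) < e" and m: "m \<ge> M" for e M m
  proof (rule nonneg_bdd_above_summable_on)
    show "bdd_above (sum (\<lambda>\<alpha>. (norm (fock_coeff (X m) \<alpha> - g \<alpha>))\<^sup>2) ` {F. F \<subseteq> UNIV \<and> finite F})"
    proof (rule bdd_aboveI2)
      fix F :: "'a list set"
      assume "F \<in> {F. F \<subseteq> UNIV \<and> finite F}"
      hence F: "finite F" by simp
      show "sum (\<lambda>\<alpha>. (norm (fock_coeff (X m) \<alpha> - g \<alpha>))\<^sup>2) F \<le> e\<^sup>2"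
        by (rule key[OF _ m F]) (fact M)
    qed
  qed simp
  obtain M1 where M1: "\<And>m n. m \<ge> M1 \<Longrightarrow> n \<ge> M1 \<Longrightarrow> norm (X m - X n) < 1"
    using CauchyD[OF C, of 1] by auto
  have gs: "(\<lambda>\<alpha>. (norm (g \<alpha>))\<^sup>2) summable_on UNIV"
  proof (rule summable_norm2_bound)
    show "(\<lambda>\<alpha>. (norm (fock_coeff (X M1) \<alpha>))\<^sup>2) summable_on UNIV"
      using fock_coeff[of "X M1"] by simp
    show "(\<lambda>\<alpha>. (norm (fock_coeff (X M1) \<alpha> - g \<alpha>))\<^sup>2) summable_on UNIV"
      by (rule diff[OF M1]) auto
    show "norm ((norm (g \<alpha>))\<^sup>2) \<le> 2 * (norm (fock_coeff (X M1) \<alpha>))\<^sup>2 +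
        2 * (norm (fock_coeff (X M1) \<alpha> - g \<alpha>))\<^sup>2" for \<alpha>
      using norm_add_sq_le[of "fock_coeff (X M1) \<alpha>" "g \<alpha> - fock_coeff (X M1) \<alpha>"]
      by (simp add: norm_minus_commute)
  qed
  define G where "G = Abs_fock g"
  have G: "fock_coeff G = g" unfolding G_def using gs by (simp add: Abs_fock_inverse)
  have "X \<longlonglongrightarrow> G"
  proof (rule LIMSEQ_I)
    fix r :: real assume "0 < r"
    then obtain M where M: "\<And>m n. m \<ge> M \<Longrightarrow> n \<ge> M \<Longrightarrow> norm (X m - X n) < r / 2"
      using CauchyD[OF C, of "r / 2"] by auto
    have "norm (X m - G) < r" if "m \<ge> M" for m
    proof -
      have "(norm (X m - G))\<^sup>2 \<le> (r / 2)\<^sup>2"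
        unfolding norm_fock_sq minus_fock.rep_eq G
        by (rule infsum_le_finite_sums[OF diff[OF M that] key[OF M that]])
      hence "norm (X m - G) \<le> r / 2" using \<open>0 < r\<close> by (simp add: power2_le_iff_abs_le)
      thus ?thesis using \<open>0 < r\<close> by simp
    qed
    thus "\<exists>no. \<forall>n\<ge>no. norm (X n - G) < r" by blast
  qed
  thus "convergent X" by (auto simp: convergent_def)
qed

instantiation fock :: (type, chilbert_space) chilbert_space
begin
lift_definition scaleC_fock :: "complex \<Rightarrow> ('a, 'b) fock \<Rightarrow> ('a, 'b) fock" is "\<lambda>c f \<alpha>. c *\<^sub>C f \<alpha>"
  by (simp add: norm_scaleC power_mult_distrib) (intro summable_on_cmult_right)
definition "cinner_fock (f :: ('a, 'b) fock) g =
  (\<Sum>\<^sub>\<infinity>\<alpha>. cinner (fock_coeff f \<alpha>) (fock_coeff g \<alpha>))"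
instance
proof
  fix f g h :: "('a, 'b) fock" and b c :: complex and r :: real
  show "c *\<^sub>C (f + g) = c *\<^sub>C f + c *\<^sub>C g"
    by (simp add: fock_eq_iff plus_fock.rep_eq scaleC_fock.rep_eq scaleC_add_right)
  show "(b + c) *\<^sub>C f = b *\<^sub>C f + c *\<^sub>C f"
    by (simp add: fock_eq_iff plus_fock.rep_eq scaleC_fock.rep_eq scaleC_add_left)
  show "b *\<^sub>C c *\<^sub>C f = (b * c) *\<^sub>C f"
    by (simp add: fock_eq_iff scaleC_fock.rep_eq scaleC_scaleC)
  show "complex_of_real r *\<^sub>C f = r *\<^sub>R f"
    by (simp add: fock_eq_iff scaleC_fock.rep_eq scaleR_fock.rep_eq scaleC_of_real)
  show "cinner f g = cnj (cinner g f)"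
    unfolding cinner_fock_def infsum_cnj[symmetric] cinner_commute[symmetric] ..
  show "cinner (f + g) h = cinner f h + cinner g h"
    by (simp add: cinner_fock_def plus_fock.rep_eq cinner_add_left infsum_add fock_summable_cinner)
  show "cinner (c *\<^sub>C f) g = c * cinner f g"
    by (simp add: cinner_fock_def scaleC_fock.rep_eq cinner_scaleC_left infsum_cmult_right
        fock_summable_cinner)
  show "Re (cinner f g) = inner f g"
    by (simp add: cinner_fock_def inner_fock_def Re_cinner fock_summable_cinner flip: infsum_Re)
qed
end

lemma fock_coeff_Blinfun:
  fixes h :: "'a::real_normed_vector \<Rightarrow> 'd list \<Rightarrow> 'b::chilbert_space"
  assumes ex: "\<And>x. \<exists>v. fock_coeff v = h x \<and> norm v \<le> K * norm x"
    and add: "\<And>x y \<alpha>. h (x + y) \<alpha> = h x \<alpha> + h y \<alpha>"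
    and scale: "\<And>r x \<alpha>. h (r *\<^sub>R x) \<alpha> = r *\<^sub>R h x \<alpha>"
  shows "fock_coeff (blinfun_apply (Blinfun (\<lambda>x. Abs_fock (h x))) x) = h x"
proof -
  have h: "fock_coeff (Abs_fock (h x)) = h x" "norm (Abs_fock (h x)) \<le> norm x * K" for x
    using ex[of x] by (metis fock_coeff_inverse, metis fock_coeff_inverse mult.commute)
  have "bounded_linear (\<lambda>x. Abs_fock (h x))"
  proof (rule bounded_linear_intro)
    show "Abs_fock (h (x + y)) = Abs_fock (h x) + Abs_fock (h y)" for x y
      by (simp add: fock_eq_iff plus_fock.rep_eq h add)
    show "Abs_fock (h (r *\<^sub>R x)) = r *\<^sub>R Abs_fock (h x)" for r x
      by (simp add: fock_eq_iff scaleR_fock.rep_eq h scale)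
  qed (rule h)
  thus ?thesis by (simp add: bounded_linear_Blinfun_apply h)
qed

text \<open>The constant series, as an embedding of the coefficient space.\<close>

lemma const_series_has_sum:
  "((\<lambda>\<alpha>. (norm (if \<alpha> = [] then x else 0))\<^sup>2) has_sum (norm x)\<^sup>2) UNIV"
proof -
  have "((\<lambda>\<alpha>. (norm x)\<^sup>2) has_sum (norm x)\<^sup>2) {[]}"
    by (simp add: has_sum_finiteI)
  thus ?thesis
    by (rule has_sum_cong_neutral[THEN iffD1, rotated -1]) auto
qed

lift_definition fock_const :: "'a::chilbert_space \<Rightarrow> ('d, 'a) fock"
  is "\<lambda>x \<alpha>. if \<alpha> = [] then x else 0"
  using const_series_has_sum by (auto simp: summable_on_def)

lemma bounded_linear_fock_const:
  "bounded_linear (fock_const :: 'a::chilbert_space \<Rightarrow> ('d, 'a) fock)"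
proof (rule bounded_linear_intro)
  fix x y :: 'a and r :: real
  show "(fock_const (x + y) :: ('d, 'a) fock) = fock_const x + fock_const y"
    by (simp add: fock_eq_iff plus_fock.rep_eq fock_const.rep_eq)
  show "(fock_const (r *\<^sub>R x) :: ('d, 'a) fock) = r *\<^sub>R fock_const x"
    by (simp add: fock_eq_iff scaleR_fock.rep_eq fock_const.rep_eq)
  have "(norm (fock_const x :: ('d, 'a) fock))\<^sup>2 = (norm x)\<^sup>2"
    unfolding norm_fock_sq fock_const.rep_eq by (rule infsumI[OF const_series_has_sum])
  thus "norm (fock_const x :: ('d, 'a) fock) \<le> norm x * 1" by simp
qed

definition const_op :: "'a::chilbert_space \<Rightarrow>\<^sub>L ('d, 'a) fock" where
  "const_op = Blinfun fock_const"

lemma const_op_apply [simp]: "blinfun_apply const_op x = fock_const x"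
  by (simp add: const_op_def bounded_linear_Blinfun_apply bounded_linear_fock_const)

section \<open>Formal power series with operator coefficients\<close>

definition nc_series :: "('d list \<Rightarrow> 'a::chilbert_space \<Rightarrow>\<^sub>L 'b::chilbert_space) \<Rightarrow> bool" where
  "nc_series S \<longleftrightarrow> (\<forall>\<alpha>. is_clinear (S \<alpha>))"

definition splits :: "'d list \<Rightarrow> ('d list \<times> 'd list) set" where
  "splits \<alpha> = {(\<beta>, \<gamma>). \<beta> @ \<gamma> = \<alpha>}"

lemma finite_splits: "finite (splits \<alpha>)"
proof -
  have "splits \<alpha> \<subseteq> (\<lambda>k. (take k \<alpha>, drop k \<alpha>)) ` {..length \<alpha>}"
  proof
    fix p assume "p \<in> splits \<alpha>"
    then obtain \<beta> \<gamma> where "p = (\<beta>, \<gamma>)" "\<beta> @ \<gamma> = \<alpha>" by (auto simp: splits_def)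
    hence "p = (take (length \<beta>) \<alpha>, drop (length \<beta>) \<alpha>)" "length \<beta> \<le> length \<alpha>" by auto
    thus "p \<in> (\<lambda>k. (take k \<alpha>, drop k \<alpha>)) ` {..length \<alpha>}" by blast
  qed
  thus ?thesis by (rule finite_subset) simp
qed

definition nc_mult :: "('d list \<Rightarrow> 'b::chilbert_space \<Rightarrow>\<^sub>L 'c::chilbert_space) \<Rightarrow>
    ('d list \<Rightarrow> 'a::chilbert_space \<Rightarrow>\<^sub>L 'b) \<Rightarrow> 'd list \<Rightarrow> 'a \<Rightarrow>\<^sub>L 'c"  (infixl "\<odot>" 70) where
  "S \<odot> R = (\<lambda>\<alpha>. \<Sum>(\<beta>, \<gamma>)\<in>splits \<alpha>. S \<beta> o\<^sub>L R \<gamma>)"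

definition nc_apply :: "('d list \<Rightarrow> 'a::chilbert_space \<Rightarrow>\<^sub>L 'b::chilbert_space) \<Rightarrow>
    ('d list \<Rightarrow> 'a) \<Rightarrow> 'd list \<Rightarrow> 'b"  (infixr "\<odot>\<^sub>v" 70) where
  "S \<odot>\<^sub>v u = (\<lambda>\<alpha>. \<Sum>(\<beta>, \<gamma>)\<in>splits \<alpha>. S \<beta> (u \<gamma>))"

text \<open>Used both for constant operator series and for constant vector series.\<close>

definition nc_const :: "'b::zero \<Rightarrow> 'd list \<Rightarrow> 'b" where
  "nc_const A = (\<lambda>\<alpha>. if \<alpha> = [] then A else 0)"

definition nc_inverse_of :: "('d list \<Rightarrow> 'a::chilbert_space \<Rightarrow>\<^sub>L 'b::chilbert_space) \<Rightarrow>
    ('d list \<Rightarrow> 'b \<Rightarrow>\<^sub>L 'a) \<Rightarrow> bool" where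
  "nc_inverse_of S R \<longleftrightarrow>
     nc_series R \<and> S \<odot> R = nc_const id_blinfun \<and> R \<odot> S = nc_const id_blinfun"

definition nc_invertible :: "('d list \<Rightarrow> 'a::chilbert_space \<Rightarrow>\<^sub>L 'b::chilbert_space) \<Rightarrow> bool" where
  "nc_invertible S \<longleftrightarrow> (\<exists>R. nc_inverse_of S R)"

definition nc_inv :: "('d list \<Rightarrow> 'a::chilbert_space \<Rightarrow>\<^sub>L 'b::chilbert_space) \<Rightarrow>
    'd list \<Rightarrow> 'b \<Rightarrow>\<^sub>L 'a" where
  "nc_inv S = (THE R. nc_inverse_of S R)"

text \<open>\<open>Z(z) = [z\<^sub>1 \<cdots> z\<^sub>d] \<otimes> I\<close>: the coefficient at the one-letter word \<open>i\<close> is the \<open>i\<close>-th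
  coordinate projection.\<close>

definition nc_Z :: "'d::finite list \<Rightarrow> ('a::chilbert_space ^ 'd) \<Rightarrow>\<^sub>L 'a" where
  "nc_Z = (\<lambda>\<alpha>. case \<alpha> of [i] \<Rightarrow> vec_proj i | _ \<Rightarrow> 0)"

definition nc_resolvent :: "('d::finite \<Rightarrow> 'a::chilbert_space \<Rightarrow>\<^sub>L 'a) \<Rightarrow>
    'd list \<Rightarrow> 'a \<Rightarrow>\<^sub>L 'a" where
  "nc_resolvent T = nc_inv (nc_const id_blinfun - nc_Z \<odot> nc_const (col T))"

definition nc_transfer :: "('d::finite \<Rightarrow> 'a::chilbert_space \<Rightarrow>\<^sub>L 'a) \<Rightarrow>
    ('a \<Rightarrow>\<^sub>L 'c::chilbert_space) \<Rightarrow> ('b::chilbert_space \<Rightarrow>\<^sub>L ('a ^ 'd)) \<Rightarrow> ('b \<Rightarrow>\<^sub>L 'c) \<Rightarrow>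
    'd list \<Rightarrow> 'b \<Rightarrow>\<^sub>L 'c" where
  "nc_transfer T C B D =
     nc_const D + nc_const C \<odot> nc_resolvent T \<odot> nc_Z \<odot> nc_const B"

definition blk11 :: "('d list \<Rightarrow> ('f::chilbert_space \<times> 'u::chilbert_space) \<Rightarrow>\<^sub>L
    ('y::chilbert_space \<times> 'v::chilbert_space)) \<Rightarrow> 'd list \<Rightarrow> 'f \<Rightarrow>\<^sub>L 'y" where
  "blk11 A = (\<lambda>\<alpha>. fst_blinfun o\<^sub>L A \<alpha> o\<^sub>L inl_op)"

definition blk12 :: "('d list \<Rightarrow> ('f::chilbert_space \<times> 'u::chilbert_space) \<Rightarrow>\<^sub>L
    ('y::chilbert_space \<times> 'v::chilbert_space)) \<Rightarrow> 'd list \<Rightarrow> 'u \<Rightarrow>\<^sub>L 'y" where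
  "blk12 A = (\<lambda>\<alpha>. fst_blinfun o\<^sub>L A \<alpha> o\<^sub>L inr_op)"

definition blk21 :: "('d list \<Rightarrow> ('f::chilbert_space \<times> 'u::chilbert_space) \<Rightarrow>\<^sub>L
    ('y::chilbert_space \<times> 'v::chilbert_space)) \<Rightarrow> 'd list \<Rightarrow> 'f \<Rightarrow>\<^sub>L 'v" where
  "blk21 A = (\<lambda>\<alpha>. snd_blinfun o\<^sub>L A \<alpha> o\<^sub>L inl_op)"

definition blk22 :: "('d list \<Rightarrow> ('f::chilbert_space \<times> 'u::chilbert_space) \<Rightarrow>\<^sub>L
    ('y::chilbert_space \<times> 'v::chilbert_space)) \<Rightarrow> 'd list \<Rightarrow> 'u \<Rightarrow>\<^sub>L 'v" where
  "blk22 A = (\<lambda>\<alpha>. snd_blinfun o\<^sub>L A \<alpha> o\<^sub>L inr_op)"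

section \<open>Schur class and de Branges--Rovnyak spaces\<close>

definition schur_class ::
    "('d list \<Rightarrow> 'u::chilbert_space \<Rightarrow>\<^sub>L 'y::chilbert_space) \<Rightarrow> bool" where
  "schur_class S \<longleftrightarrow> nc_series S \<and>
     (\<forall>u :: ('d, 'u) fock. \<exists>v :: ('d, 'y) fock.
        fock_coeff v = S \<odot>\<^sub>v fock_coeff u \<and> norm v \<le> norm u)"

definition mult_op :: "('d list \<Rightarrow> 'u::chilbert_space \<Rightarrow>\<^sub>L 'y::chilbert_space) \<Rightarrow>
    ('d, 'u) fock \<Rightarrow>\<^sub>L ('d, 'y) fock" where
  "mult_op S = Blinfun (\<lambda>u. Abs_fock (S \<odot>\<^sub>v fock_coeff u))"

lemma fock_coeff_mult_op:
  assumes "schur_class S"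
  shows "fock_coeff (mult_op S u) = S \<odot>\<^sub>v fock_coeff u"
  unfolding mult_op_def
proof (rule fock_coeff_Blinfun[where h = "\<lambda>u. S \<odot>\<^sub>v fock_coeff u" and K = 1])
  show "\<exists>v. fock_coeff v = S \<odot>\<^sub>v fock_coeff x \<and> norm v \<le> 1 * norm x" for x
    using assms by (simp add: schur_class_def)
qed (simp_all add: nc_apply_def split_def plus_fock.rep_eq scaleR_fock.rep_eq blinfun.add_right
    blinfun.scaleR_right sum.distrib scaleR_sum_right)

definition dbr_op :: "('d list \<Rightarrow> 'u::chilbert_space \<Rightarrow>\<^sub>L 'y::chilbert_space) \<Rightarrow>
    ('d, 'y) fock \<Rightarrow>\<^sub>L ('d, 'y) fock" where
  "dbr_op S = op_sqrt (id_blinfun - (mult_op S o\<^sub>L op_adj (mult_op S)))"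

text \<open>The space \<open>\<H>(S)\<close>, as a set of formal power series.\<close>

definition dbr :: "('d list \<Rightarrow> 'u::chilbert_space \<Rightarrow>\<^sub>L 'y::chilbert_space) \<Rightarrow>
    ('d list \<Rightarrow> 'y) set" where
  "dbr S = range (\<lambda>g. fock_coeff (dbr_op S g))"

text \<open>\<open>(I - \<pi>)g\<close> for any \<open>g\<close> that \<open>(I - M\<^sub>S M\<^sub>S\<^sup>*)\<^sup>1\<^sup>/\<^sup>2\<close> sends to \<open>f\<close>; it does not depend on the
  choice of \<open>g\<close>.\<close>

definition dbr_lift :: "('d list \<Rightarrow> 'u::chilbert_space \<Rightarrow>\<^sub>L 'y::chilbert_space) \<Rightarrow>
    ('d list \<Rightarrow> 'y) \<Rightarrow> ('d, 'y) fock" where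
  "dbr_lift S f = (let g = (SOME g. fock_coeff (dbr_op S g) = f)
                   in g - orth_proj (op_ker (dbr_op S)) g)"

definition dbr_norm :: "('d list \<Rightarrow> 'u::chilbert_space \<Rightarrow>\<^sub>L 'y::chilbert_space) \<Rightarrow>
    ('d list \<Rightarrow> 'y) \<Rightarrow> real" where
  "dbr_norm S f = norm (dbr_lift S f)"

text \<open>The inner product that polarizes the lifted norm.\<close>

definition dbr_cinner :: "('d list \<Rightarrow> 'u::chilbert_space \<Rightarrow>\<^sub>L 'y::chilbert_space) \<Rightarrow>
    ('d list \<Rightarrow> 'y) \<Rightarrow> ('d list \<Rightarrow> 'y) \<Rightarrow> complex" where
  "dbr_cinner S f h = cinner (dbr_lift S f) (dbr_lift S h)"

text \<open>\<open>\<H>(S) \<ominus> Ker M\<^sub>u\<close> with \<open>M\<^sub>u : \<sigma> \<mapsto> u\<sigma>\<close> on \<open>\<H>(S)\<close>.\<close>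

definition dbr_ker :: "('d list \<Rightarrow> 'u::chilbert_space \<Rightarrow>\<^sub>L 'f::chilbert_space) \<Rightarrow>
    ('d list \<Rightarrow> 'f \<Rightarrow>\<^sub>L 'y::chilbert_space) \<Rightarrow> ('d list \<Rightarrow> 'f) set" where
  "dbr_ker S u = {\<sigma> \<in> dbr S. u \<odot>\<^sub>v \<sigma> = (\<lambda>_. 0)}"

definition dbr_ominus_ker :: "('d list \<Rightarrow> 'u::chilbert_space \<Rightarrow>\<^sub>L 'f::chilbert_space) \<Rightarrow>
    ('d list \<Rightarrow> 'f \<Rightarrow>\<^sub>L 'y::chilbert_space) \<Rightarrow> ('d list \<Rightarrow> 'f) set" where
  "dbr_ominus_ker S u = {\<sigma> \<in> dbr S. \<forall>\<kappa> \<in> dbr_ker S u. dbr_cinner S \<sigma> \<kappa> = 0}"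

section \<open>Observability operators\<close>

fun word_op :: "('d \<Rightarrow> 'a::chilbert_space \<Rightarrow>\<^sub>L 'a) \<Rightarrow> 'd list \<Rightarrow> 'a \<Rightarrow>\<^sub>L 'a" where
  "word_op T [] = id_blinfun"
| "word_op T (i # \<alpha>) = T i o\<^sub>L word_op T \<alpha>"

definition obs_series :: "('a::chilbert_space \<Rightarrow>\<^sub>L 'y::chilbert_space) \<Rightarrow>
    ('d \<Rightarrow> 'a \<Rightarrow>\<^sub>L 'a) \<Rightarrow> 'a \<Rightarrow> 'd list \<Rightarrow> 'y" where
  "obs_series E T x = (\<lambda>\<alpha>. E (word_op T \<alpha> x))"

definition output_stable :: "('a::chilbert_space \<Rightarrow>\<^sub>L 'y::chilbert_space) \<Rightarrow>
    ('d \<Rightarrow> 'a \<Rightarrow>\<^sub>L 'a) \<Rightarrow> bool" where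
  "output_stable E T \<longleftrightarrow>
     (\<exists>K. \<forall>x. \<exists>v :: ('d, 'y) fock. fock_coeff v = obs_series E T x \<and> norm v \<le> K * norm x)"

definition obs_op :: "('a::chilbert_space \<Rightarrow>\<^sub>L 'y::chilbert_space) \<Rightarrow>
    ('d \<Rightarrow> 'a \<Rightarrow>\<^sub>L 'a) \<Rightarrow> 'a \<Rightarrow>\<^sub>L ('d, 'y) fock" where
  "obs_op E T = Blinfun (\<lambda>x. Abs_fock (obs_series E T x))"

lemma fock_coeff_obs_op:
  assumes "output_stable E T"
  shows "fock_coeff (obs_op E T x) = obs_series E T x"
proof -
  obtain K where "\<And>x. \<exists>v. fock_coeff v = obs_series E T x \<and> norm v \<le> K * norm x"
    using assms unfolding output_stable_def by blast
  thus ?thesis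
    unfolding obs_op_def
    by (rule fock_coeff_Blinfun)
      (simp_all add: obs_series_def blinfun.add_right blinfun.scaleR_right)
qed

end

theory Submission
  imports Defs
begin

text \<open>
  Write \<open>M\<close> for multiplication by \<open>S\<^sub>0\<close>, \<open>\<O>\<close> for the observability operator of \<open>(E, T)\<close>,
  \<open>G = (I - M M\<^sup>*)\<^sup>1\<^sup>/\<^sup>2\<close>, so that \<open>\<H>(S\<^sub>0)\<close> is the range of \<open>G\<close>, and \<open>V = G \<O>\<close>.

  The equation \<open>N\<^sup>* = \<O>\<^sup>* M|\<U>\<close> says that \<open>N x\<close> is the constant coefficient of \<open>M\<^sup>* \<O> x\<close>;
  since the backward shifts commute with \<open>M\<^sup>*\<close> and turn \<open>\<O> x\<close> into \<open>\<O> T\<^sub>j x\<close>, the other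
  coefficients follow and \<open>M\<^sup>* \<O>\<close> is the observability operator of \<open>(N, T)\<close>.  Hence
  \<open>P = \<O>\<^sup>* (I - M M\<^sup>*) \<O> = V\<^sup>* V\<close>, and \<open>Q = I - V P\<^sup>-\<^sup>1 V\<^sup>*\<close> is the orthogonal projection onto
  the complement of the range of \<open>V\<close>.  For \<open>f = G h\<close> with \<open>h\<close> orthogonal to the kernel of \<open>G\<close>
  the interpolation condition \<open>\<O>\<^sup>* f = x\<close> reads \<open>V\<^sup>* h = x\<close>, that is,
  \<open>h = V P\<^sup>-\<^sup>1 x + Q h\<close> with orthogonal summands.  The first summand gives
  \<open>G V P\<^sup>-\<^sup>1 x = (\<O> - M M\<^sup>* \<O>) P\<^sup>-\<^sup>1 x = f\<^sub>0\<close>, of squared norm \<open>\<parallel>P\<^sup>-\<^sup>1\<^sup>/\<^sup>2 x\<parallel>\<^sup>2\<close>; it remains to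
  describe the series \<open>G h\<close> with such \<open>h\<close> satisfying \<open>Q h = h\<close> as \<open>u \<sigma>\<close>.

  The link with the chain matrix \<open>\<AA>\<close> is one identity.  Put \<open>v = S\<^sub>0 \<AA>\<^sub>2\<^sub>2 - \<AA>\<^sub>1\<^sub>2\<close>, so that
  \<open>[u, -v] = [I, -S\<^sub>0] \<AA>\<close>.  The series \<open>u\<close> and \<open>v\<close> need not be bounded multipliers, but the
  formal adjoint of any series maps polynomials to polynomials (\<open>series_adj\<close>), and for every
  polynomial \<open>f\<close>
    \<open>\<parallel>u\<^sup>* f\<parallel>\<^sup>2 - \<parallel>v\<^sup>* f\<parallel>\<^sup>2 = \<parallel>Q G f\<parallel>\<^sup>2\<close>   (lemma \<open>key_identity\<close>).
  It comes from the identity satisfied by \<open>[B; D]\<close>, telescoped along the degree of the polynomial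
  (lemma \<open>kernel_identity\<close>) and applied to \<open>[I, -S\<^sub>0]\<^sup>* f\<close>.

  Existence of \<open>\<E>\<^sub>0\<close>: the linear fractional equation for \<open>S\<^sub>0\<close> amounts to \<open>u \<E>\<^sub>0 = v\<close>, and the
  identity is exactly what Leech's theorem needs.  Lemma \<open>leech_factorization\<close> proves it with a
  lurking isometry, whose state space is here the Fock space itself.  The denominator
  \<open>\<AA>\<^sub>2\<^sub>1 \<E>\<^sub>0 + \<AA>\<^sub>2\<^sub>2\<close> is invertible for every Schur-class \<open>\<E>\<^sub>0\<close> because the colligation is
  \<open>J\<close>-unitary (lemma \<open>denominator_invertible\<close>).

  Parametrization: if \<open>u \<E>\<^sub>0 = v\<close> and \<open>G\<^sub>\<E>\<close> denotes the operator \<open>(I - M M\<^sup>*)\<^sup>1\<^sup>/\<^sup>2\<close> of \<open>\<E>\<^sub>0\<close>, the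
  identity becomes \<open>\<parallel>G\<^sub>\<E> u\<^sup>* f\<parallel> = \<parallel>Q G f\<parallel>\<close>.  The pairs \<open>(Q G f, G\<^sub>\<E> u\<^sup>* f)\<close> therefore form an
  isometric relation, and for \<open>(h, k)\<close> in its closure \<open>\<Gamma>\<close> duality gives \<open>u (G\<^sub>\<E> k) = G h\<close>.  The
  first components of \<open>\<Gamma>\<close> are exactly the homogeneous parts \<open>Q h\<close> above, the second components are
  exactly the lifts of the elements of \<open>\<M>\<close>, and \<open>\<parallel>h\<parallel> = \<parallel>k\<parallel>\<close> is the norm identity.
\<close>

section \<open>Complex Hilbert spaces\<close>

text \<open>This makes the space of bounded operators complete in the operator norm, where the square
  root of a positive operator is obtained as a limit.\<close>

instance chilbert_space \<subseteq> banach ..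

lemma Im_cinner: "Im (cinner x y) = - inner (\<i> *\<^sub>C x) y"
  by (simp add: cinner_scaleC_left flip: Re_cinner)

text \<open>The complex inner product is determined by the real one and multiplication by \<open>\<i>\<close>, so
  adjoints and orthogonality can be treated with the real inner product throughout.\<close>

lemma cinner_eq_inner: "cinner x y = Complex (inner x y) (- inner (\<i> *\<^sub>C x) y)"
  by (simp add: complex_eq_iff Im_cinner Re_cinner)

lemma inner_eqI_right:
  assumes "\<And>x. inner x y = inner x z"
  shows "y = z"
  using vector_eq_ldot[of y z] assms by (metis inner_commute)

lemma scaleC_zero [simp]: "c *\<^sub>C (0::'a::chilbert_space) = 0"
  using norm_scaleC[of c "0::'a"] by simp

lemma scaleC_minus: "c *\<^sub>C (- x) = - (c *\<^sub>C (x::'a::chilbert_space))"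
  by (metis add_eq_0_iff add.right_inverse scaleC_add_right scaleC_zero)

lemma scaleC_diff: "c *\<^sub>C (x - y) = c *\<^sub>C x - c *\<^sub>C (y::'a::chilbert_space)"
  using scaleC_add_right[of c x "- y"] by (simp add: scaleC_minus)

lemma scaleC_sum: "c *\<^sub>C (sum f A) = (\<Sum>i\<in>A. c *\<^sub>C (f i::'a::chilbert_space))"
  by (induction A rule: infinite_finite_induct) (auto simp: scaleC_add_right)

lemma bounded_linear_scaleC: "bounded_linear ((*\<^sub>C) c :: 'a::chilbert_space \<Rightarrow> 'a)"
proof (rule bounded_linear_intro)
  fix r and x :: 'a
  show "c *\<^sub>C r *\<^sub>R x = r *\<^sub>R c *\<^sub>C x"
    by (simp add: scaleC_scaleC mult.commute flip: scaleC_of_real)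
  show "norm (c *\<^sub>C x) \<le> norm x * cmod c" by (simp add: norm_scaleC)
qed (rule scaleC_add_right)

lemmas tendsto_scaleC = bounded_linear.tendsto[OF bounded_linear_scaleC]

definition csubspace :: "'a::chilbert_space set \<Rightarrow> bool" where
  "csubspace M \<longleftrightarrow> 0 \<in> M \<and> (\<forall>x\<in>M. \<forall>y\<in>M. x + y \<in> M) \<and> (\<forall>c. \<forall>x\<in>M. c *\<^sub>C x \<in> M)"

lemma csubspace_imp_subspace: "csubspace M \<Longrightarrow> subspace M"
  unfolding csubspace_def subspace_def by (metis scaleC_of_real)

lemma csubspace_closure:
  assumes "csubspace M"
  shows "csubspace (closure M)"
  unfolding csubspace_def
proof (intro conjI ballI allI)
  show "0 \<in> closure M" using assms closure_subset unfolding csubspace_def by blast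
  fix x c assume x: "x \<in> closure M"
  then obtain X where X: "\<And>n. X n \<in> M" "X \<longlonglongrightarrow> x" unfolding closure_sequential by auto
  show "c *\<^sub>C x \<in> closure M"
    unfolding closure_sequential using X assms tendsto_scaleC[OF X(2), of c]
    by (intro exI[of _ "\<lambda>n. c *\<^sub>C X n"]) (auto simp: csubspace_def)
  fix y assume "y \<in> closure M"
  then obtain Y where Y: "\<And>n. Y n \<in> M" "Y \<longlonglongrightarrow> y" unfolding closure_sequential by auto
  show "x + y \<in> closure M"
    unfolding closure_sequential using X Y assms tendsto_add[OF X(2) Y(2)]
    by (intro exI[of _ "\<lambda>n. X n + Y n"]) (auto simp: csubspace_def)
qed

text \<open>Real orthogonality to both \<open>m\<close> and \<open>\<i> m\<close>.\<close>

lemma orthogonal_cinner_eq_0: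
  assumes "csubspace M" "\<And>m. m \<in> M \<Longrightarrow> inner x m = 0" "m \<in> M"
  shows "cinner x m = 0"
proof -
  have "\<i> *\<^sub>C m \<in> M" using assms by (auto simp: csubspace_def)
  hence "Re (cinner x (\<i> *\<^sub>C m)) = 0" using assms by (simp add: Re_cinner)
  hence "Im (cinner x m) = 0" by (simp add: cinner_scaleC_right)
  thus ?thesis using assms by (simp add: complex_eq_iff Re_cinner)
qed

section \<open>Orthogonal projections and adjoints\<close>

text \<open>The first-variation argument for a minimizer: the linear term must vanish.\<close>

lemma quadratic_minimum_imp_zero:
  fixes a b :: real
  assumes "\<And>t. 0 \<le> t\<^sup>2 * b - 2 * t * a"
  shows "a = 0"
proof (rule ccontr)
  assume a: "a \<noteq> 0"
  have b: "b \<ge> 0" using assms[of 1] assms[of "-1"] by simp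
  \<comment> \<open>The minimizer is \<open>a / b\<close>; the shift by 1 covers \<open>b = 0\<close>.\<close>
  define t where "t = a / (b + 1)"
  have "a = t * (b + 1)" using b by (simp add: t_def)
  hence "t\<^sup>2 * b - 2 * t * a = t\<^sup>2 * b - 2 * t\<^sup>2 * (b + 1)"
    by (simp add: power2_eq_square)
  also have "\<dots> = - (t\<^sup>2 * (b + 2))" by (simp add: algebra_simps)
  also have "\<dots> < 0" using a b by (simp add: t_def zero_less_mult_iff)
  finally show False using assms[of t] by linarith
qed

text \<open>A minimizing sequence for the distance is Cauchy by the parallelogram law; at its limit
  the first variation vanishes.\<close>

lemma projection_exists:
  fixes M :: "'a::chilbert_space set"
  assumes M: "subspace M" "closed M"
  obtains y where "y \<in> M" "\<And>m. m \<in> M \<Longrightarrow> inner (x - y) m = 0"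
proof -
  define S where "S = (\<lambda>m. (norm (x - m))\<^sup>2) ` M"
  define \<delta> where "\<delta> = Inf S"
  have S: "S \<noteq> {}" "bdd_below S"
    using subspace_0[OF M(1)] by (auto simp: S_def intro!: bdd_belowI[of _ 0])
  have \<delta>: "\<delta> \<le> (norm (x - m))\<^sup>2" if "m \<in> M" for m
    unfolding \<delta>_def using that S by (intro cInf_lower) (auto simp: S_def)
  have "\<exists>m\<in>M. (norm (x - m))\<^sup>2 < \<delta> + inverse (Suc n)" for n
    using cInf_lessD[OF S(1), of "\<delta> + inverse (Suc n)"] by (auto simp: \<delta>_def S_def)
  then obtain y where y: "\<And>n. y n \<in> M" "\<And>n. (norm (x - y n))\<^sup>2 < \<delta> + inverse (Suc n)"
    by metis
  have par: "(norm (y n - y m))\<^sup>2 \<le> 2 * inverse (Suc n) + 2 * inverse (Suc m)" for n m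
  proof -
    have "(1/2) *\<^sub>R (y n + y m) \<in> M" using M(1) y(1) by (simp add: subspace_add subspace_scale)
    from \<delta>[OF this] have "4 * \<delta> \<le> 4 * (norm (x - (1/2) *\<^sub>R (y n + y m)))\<^sup>2" by simp
    also have "\<dots> = 2 * (norm (x - y n))\<^sup>2 + 2 * (norm (x - y m))\<^sup>2 - (norm (y n - y m))\<^sup>2"
      unfolding power2_norm_eq_inner by (simp add: inner_commute inner_simps field_simps)
    finally show ?thesis using y(2)[of n] y(2)[of m] by linarith
  qed
  have "Cauchy y"
  proof (rule CauchyI)
    fix e :: real assume e: "0 < e"
    obtain K where K: "inverse (real (Suc K)) < e\<^sup>2 / 4"
      using reals_Archimedean[of "e\<^sup>2 / 4"] e by auto
    have "norm (y m - y n) < e" if "m \<ge> K" "n \<ge> K" for m n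
    proof -
      have "inverse (real (Suc m)) \<le> inverse (Suc K)" "inverse (real (Suc n)) \<le> inverse (Suc K)"
        using that by (auto intro!: le_imp_inverse_le)
      hence "(norm (y m - y n))\<^sup>2 < e\<^sup>2" using par[of m n] K by linarith
      thus ?thesis using e by (simp add: power_less_imp_less_base)
    qed
    thus "\<exists>M. \<forall>m\<ge>M. \<forall>n\<ge>M. norm (y m - y n) < e" by blast
  qed
  then obtain z where z: "y \<longlonglongrightarrow> z" by (auto simp: Cauchy_convergent_iff convergent_def)
  have zM: "z \<in> M" using closed_sequentially[OF M(2) _ z] y(1) by blast
  have "(norm (x - z))\<^sup>2 \<le> \<delta> + 0"
  proof (rule LIMSEQ_le)
    show "(\<lambda>n. (norm (x - y n))\<^sup>2) \<longlonglongrightarrow> (norm (x - z))\<^sup>2" by (intro tendsto_intros z)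
    show "(\<lambda>n. \<delta> + inverse (Suc n)) \<longlonglongrightarrow> \<delta> + 0"
      by (intro tendsto_intros LIMSEQ_inverse_real_of_nat)
  qed (use y(2) in \<open>auto intro: less_imp_le\<close>)
  hence min: "(norm (x - z))\<^sup>2 \<le> (norm (x - m))\<^sup>2" if "m \<in> M" for m
    using \<delta>[OF that] by linarith
  have "inner (x - z) m = 0" if m: "m \<in> M" for m
  proof (rule quadratic_minimum_imp_zero)
    fix t :: real
    have "z + t *\<^sub>R m \<in> M" using M(1) zM m by (simp add: subspace_add subspace_scale)
    from min[OF this] show "0 \<le> t\<^sup>2 * inner m m - 2 * t * inner (x - z) m"
      unfolding power2_norm_eq_inner
      by (simp add: inner_commute inner_simps power2_eq_square algebra_simps)
  qed
  thus ?thesis using that zM by blast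
qed

text \<open>The representing vector is a multiple of a vector orthogonal to the kernel of \<open>\<phi>\<close>.\<close>

lemma riesz_representation:
  fixes \<phi> :: "'a::chilbert_space \<Rightarrow> real"
  assumes \<phi>: "bounded_linear \<phi>"
  obtains y where "\<And>x. \<phi> x = inner x y"
proof (cases "\<forall>x. \<phi> x = 0")
  case True
  thus ?thesis by (intro that[of 0]) simp
next
  case False
  then obtain z where z: "\<phi> z \<noteq> 0" by blast
  interpret bounded_linear \<phi> by fact
  define M where "M = {x. \<phi> x = 0}"
  have "subspace M" by (auto simp: M_def subspace_def add scaleR zero)
  moreover have "closed M"
    unfolding M_def by (intro closed_Collect_eq continuous_on continuous_on_const continuous_on_id)
  ultimately obtain y where y: "y \<in> M" "\<And>m. m \<in> M \<Longrightarrow> inner (z - y) m = 0"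
    using projection_exists[of M z] by blast
  define w where "w = z - y"
  have w: "\<phi> w \<noteq> 0" using z y(1) by (simp add: w_def diff M_def)
  hence w0: "inner w w \<noteq> 0" using zero by auto
  show ?thesis
  proof (rule that[of "(\<phi> w / inner w w) *\<^sub>R w"])
    fix x
    have "x - (\<phi> x / \<phi> w) *\<^sub>R w \<in> M" using w by (simp add: M_def diff scaleR)
    hence "inner w (x - (\<phi> x / \<phi> w) *\<^sub>R w) = 0" using y(2) w_def by blast
    thus "\<phi> x = inner x ((\<phi> w / inner w w) *\<^sub>R w)"
      using w w0 by (simp add: inner_simps inner_commute field_simps)
  qed
qed

text \<open>Rules deriving \<open>is_clinear\<close> and \<open>nc_series\<close> for composite operators and series.\<close>

named_theorems clin

lemma is_clinearD: "is_clinear A \<Longrightarrow> A (c *\<^sub>C x) = c *\<^sub>C A x"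
  by (simp add: is_clinear_def)

text \<open>The real adjoint relation, tested also at \<open>\<i> x\<close>, yields the imaginary part.\<close>

lemma adjoint_pair_imp_cinner:
  assumes "is_clinear A" "\<And>x y. inner (A x) y = inner x (B y)"
  shows "cinner (A x) y = cinner x (B y)"
  using assms(2)[of x y] assms(2)[of "\<i> *\<^sub>C x" y] assms(1)
  by (simp add: cinner_eq_inner is_clinearD)

lemma op_adj_unique:
  fixes B :: "'b::chilbert_space \<Rightarrow>\<^sub>L 'a::chilbert_space"
  assumes "is_clinear A" "\<And>x y. inner (A x) y = inner x (B y)"
  shows "op_adj A = B"
  unfolding op_adj_def
proof (rule the_equality)
  show "\<forall>x y. cinner (A x) y = cinner x (B y)" using adjoint_pair_imp_cinner[OF assms] by blast
  fix B' :: "'b \<Rightarrow>\<^sub>L 'a"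
  assume B': "\<forall>x y. cinner (A x) y = cinner x (B' y)"
  show "B' = B"
  proof (rule blinfun_eqI, rule inner_eqI_right)
    fix x y
    have "inner x (B' y) = inner (A x) y" using B' by (metis Re_cinner)
    thus "inner x (B' y) = inner x (B y)" by (simp add: assms(2))
  qed
qed

lemma adjoint_exists:
  fixes A :: "'a::chilbert_space \<Rightarrow>\<^sub>L 'b::chilbert_space"
  obtains B :: "'b \<Rightarrow>\<^sub>L 'a" where "\<And>x y. inner (A x) y = inner x (B y)"
proof -
  have "\<exists>z. \<forall>x. inner (A x) y = inner x z" for y
  proof -
    have "bounded_linear (\<lambda>x. inner (A x) y)"
      by (intro bounded_linear_compose[OF bounded_linear_inner_left] blinfun.bounded_linear_right)
    thus ?thesis using riesz_representation by metis
  qed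
  then obtain B where B: "\<And>x y. inner (A x) y = inner x (B y)" by metis
  have "bounded_linear B"
  proof (rule bounded_linear_intro)
    show "B (x + y) = B x + B y" for x y
      by (rule inner_eqI_right) (simp add: inner_add_right flip: B)
    show "B (r *\<^sub>R x) = r *\<^sub>R B x" for r x
      by (rule inner_eqI_right) (simp flip: B)
    fix x
    have "(norm (B x))\<^sup>2 = inner (A (B x)) x" by (simp add: B power2_norm_eq_inner)
    also have "\<dots> \<le> norm (A (B x)) * norm x" by (rule norm_cauchy_schwarz)
    also have "\<dots> \<le> norm A * norm (B x) * norm x" by (intro mult_right_mono norm_blinfun) simp
    finally show "norm (B x) \<le> norm x * norm A"
      by (cases "norm (B x) = 0") (auto simp: power2_eq_square mult_ac)
  qed
  thus ?thesis using that[of "Blinfun B"] B by (simp add: bounded_linear_Blinfun_apply)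
qed

lemma inner_op_adj: "is_clinear A \<Longrightarrow> inner x (op_adj A y) = inner (A x) y"
  by (metis adjoint_exists op_adj_unique)

lemma inner_op_adj_left: "is_clinear A \<Longrightarrow> inner (op_adj A y) x = inner y (A x)"
  by (metis inner_op_adj inner_commute)

lemma op_adj_clinear [clin]:
  assumes "is_clinear A"
  shows "is_clinear (op_adj A)"
proof -
  have c: "cinner (A x) y = cinner x (op_adj A y)" for x y
    by (rule adjoint_pair_imp_cinner) (simp_all add: assms inner_op_adj)
  show ?thesis
    unfolding is_clinear_def
  proof (intro allI, rule inner_eqI_right)
    fix z x and a :: complex
    show "inner z (op_adj A (a *\<^sub>C x)) = inner z (a *\<^sub>C op_adj A x)"
      by (simp add: cinner_scaleC_right c[symmetric] flip: Re_cinner)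
  qed
qed

lemma op_adj_adj [simp]: "is_clinear A \<Longrightarrow> op_adj (op_adj A) = A"
  by (rule op_adj_unique) (simp_all add: op_adj_clinear inner_op_adj_left)

lemma clinear_compose [clin]: "is_clinear A \<Longrightarrow> is_clinear B \<Longrightarrow> is_clinear (A o\<^sub>L B)"
  by (simp add: is_clinear_def)

lemma clinear_add [clin]: "is_clinear A \<Longrightarrow> is_clinear B \<Longrightarrow> is_clinear (A + B)"
  by (simp add: is_clinear_def blinfun.add_left scaleC_add_right)

lemma clinear_diff [clin]: "is_clinear A \<Longrightarrow> is_clinear B \<Longrightarrow> is_clinear (A - B)"
  by (simp add: is_clinear_def blinfun.diff_left scaleC_diff)

lemma clinear_uminus [clin]: "is_clinear A \<Longrightarrow> is_clinear (- A)"
  by (simp add: is_clinear_def blinfun.minus_left scaleC_minus)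

lemma clinear_zero [clin]: "is_clinear 0"
  by (simp add: is_clinear_def)

lemma clinear_id [clin]: "is_clinear id_blinfun"
  by (simp add: is_clinear_def)

lemma clinear_sum [clin]: "(\<And>i. i \<in> I \<Longrightarrow> is_clinear (A i)) \<Longrightarrow> is_clinear (sum A I)"
  by (induction I rule: infinite_finite_induct) (auto intro: clin)

lemma scaleR_scaleC_commute: "r *\<^sub>R c *\<^sub>C x = c *\<^sub>C r *\<^sub>R (x::'a::chilbert_space)"
  by (metis bounded_linear.axioms(1) bounded_linear_scaleC linear_scale)

lemma clinear_scaleR [clin]: "is_clinear A \<Longrightarrow> is_clinear (r *\<^sub>R A)"
  by (simp add: is_clinear_def blinfun.scaleR_left scaleR_scaleC_commute)

lemma clinear_col2 [clin]: "is_clinear A \<Longrightarrow> is_clinear B \<Longrightarrow> is_clinear (col2 A B)"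
  by (simp add: is_clinear_def scaleC_prod_def)

lemma clinear_col [clin]: "(\<And>i. is_clinear (A i)) \<Longrightarrow> is_clinear (col A)"
  by (simp add: is_clinear_def scaleC_vec_def)

lemma clinear_vec_proj [clin]: "is_clinear (vec_proj i)"
  by (simp add: is_clinear_def scaleC_vec_def)

lemma clinear_inl [clin]: "is_clinear inl_op"
  by (simp add: is_clinear_def scaleC_prod_def)

lemma clinear_inr [clin]: "is_clinear inr_op"
  by (simp add: is_clinear_def scaleC_prod_def)

lemma clinear_fst [clin]: "is_clinear fst_blinfun"
  by (simp add: is_clinear_def scaleC_prod_def)

lemma clinear_snd [clin]: "is_clinear snd_blinfun"
  by (simp add: is_clinear_def scaleC_prod_def)

lemma J_op_apply: "J_op p = (fst p, - snd p)"
  by (simp add: J_op_def blinfun.minus_left)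

lemma J_op_involutive: "J_op (J_op p) = p"
  by (simp add: J_op_apply)

lemma op_adj_compose: "is_clinear A \<Longrightarrow> is_clinear B \<Longrightarrow> op_adj (A o\<^sub>L B) = op_adj B o\<^sub>L op_adj A"
  by (rule op_adj_unique) (auto intro: clin simp: inner_op_adj)

lemma op_adj_inl: "op_adj inl_op = fst_blinfun"
  by (rule op_adj_unique) (auto intro: clin simp: inner_prod_def)

lemma op_adj_inr: "op_adj inr_op = snd_blinfun"
  by (rule op_adj_unique) (auto intro: clin simp: inner_prod_def)

lemma op_adj_zero [simp]: "op_adj 0 = 0"
  by (rule op_adj_unique) (auto intro: clin)

lemma op_adj_id [simp]: "op_adj id_blinfun = id_blinfun"
  by (rule op_adj_unique) (auto intro: clin)

lemma op_adj_uminus: "is_clinear A \<Longrightarrow> op_adj (- A) = - op_adj A"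
  by (rule op_adj_unique) (auto intro: clin simp: blinfun.minus_left inner_op_adj)

lemma blinfun_compose_assoc: "(A o\<^sub>L B) o\<^sub>L C = A o\<^sub>L (B o\<^sub>L C)"
  by (rule blinfun_eqI) simp

lemma blinfun_compose_id [simp]: "A o\<^sub>L id_blinfun = A" "id_blinfun o\<^sub>L A = A"
  by (auto intro: blinfun_eqI)

lemma op_inv_inverse:
  assumes "op_inverse_of A B"
  shows "op_inv A = B"
  unfolding op_inv_def
proof (rule the_equality)
  fix B' assume "op_inverse_of A B'"
  hence "B' = B' o\<^sub>L (A o\<^sub>L B)" using assms by (simp add: op_inverse_of_def)
  also have "\<dots> = (B' o\<^sub>L A) o\<^sub>L B" by (simp add: blinfun_compose_assoc)
  finally show "B' = B" using \<open>op_inverse_of A B'\<close> by (simp add: op_inverse_of_def)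
qed fact

section \<open>Positive operators and their square roots\<close>

text \<open>The sesquilinear defect \<open>cinner (A x) y - cinner x (A y)\<close> vanishes on the diagonal, since
  \<open>cinner (A x) x\<close> is real; by polarization over the complex numbers it vanishes identically.\<close>

lemma op_pos_symmetric:
  assumes "op_pos A"
  shows "inner (A x) y = inner x (A y)"
proof -
  define h where "h x y = cinner (A x) y - cinner x (A y)" for x y
  have A: "is_clinear A" using assms by (simp add: op_pos_def)
  have diag: "h x x = 0" for x
  proof -
    have "cinner (A x) x \<in> \<real>\<^sub>\<ge>\<^sub>0" using assms by (simp add: op_pos_def)
    hence "Im (cinner (A x) x) = 0" by (auto elim: nonneg_Reals_cases)
    thus ?thesis unfolding h_def using cinner_commute[of x "A x"]
      by (simp add: complex_eq_iff)
  qed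
  have add: "h (x + y) z = h x z + h y z" "h z (x + y) = h z x + h z y" for x y z
    by (simp_all add: h_def blinfun.add_right cinner_add_left cinner_add_right)
  have 1: "h x y + h y x = 0" for x y using diag[of "x + y"] unfolding add by (simp add: diag add.commute)
  have "h x (\<i> *\<^sub>C y) = - \<i> * h x y" "h (\<i> *\<^sub>C y) x = \<i> * h y x"
    by (simp_all add: h_def is_clinearD[OF A] cinner_scaleC_left cinner_scaleC_right algebra_simps)
  hence "\<i> * (h y x - h x y) = 0" using 1[of x "\<i> *\<^sub>C y"] by (simp add: algebra_simps)
  hence "h x y = 0" using 1[of x y] by simp
  thus ?thesis unfolding h_def by (metis Re_cinner eq_iff_diff_eq_0)
qed

lemma op_pos_iff:
  "op_pos A \<longleftrightarrow> is_clinear A \<and> (\<forall>x y. inner (A x) y = inner x (A y)) \<and> (\<forall>x. 0 \<le> inner (A x) x)"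
proof (intro iffI conjI allI)
  assume A: "op_pos A"
  show "is_clinear A" using A by (simp add: op_pos_def)
  show "inner (A x) y = inner x (A y)" for x y by (rule op_pos_symmetric[OF A])
  have "cinner (A x) x \<in> \<real>\<^sub>\<ge>\<^sub>0" for x using A by (simp add: op_pos_def)
  thus "0 \<le> inner (A x) x" for x
    by (metis Re_cinner complex_nonneg_Reals_iff)
next
  assume A: "is_clinear A \<and> (\<forall>x y. inner (A x) y = inner x (A y)) \<and> (\<forall>x. 0 \<le> inner (A x) x)"
  have "cinner (A x) x = cinner x (A x)" for x
    using A by (intro adjoint_pair_imp_cinner) auto
  hence "Im (cinner (A x) x) = 0" for x
    using cinner_commute[of x "A x"] by (metis Reals_cnj_iff complex_is_Real_iff)
  moreover have "0 \<le> Re (cinner (A x) x)" for x using A by (metis Re_cinner)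
  ultimately show "op_pos A" using A unfolding op_pos_def complex_nonneg_Reals_iff by blast
qed

lemma op_pos_clinear: "op_pos A \<Longrightarrow> is_clinear A"
  and op_pos_nonneg: "op_pos A \<Longrightarrow> 0 \<le> inner (A x) x"
  unfolding op_pos_iff by blast+

text \<open>Positivity of \<open>A\<close> tested at \<open>x - A x / k\<close>.\<close>

lemma op_pos_norm_le:
  assumes A: "op_pos A" and k: "\<And>x. inner (A x) x \<le> k * (norm x)\<^sup>2" "0 < k"
  shows "(norm (A x))\<^sup>2 \<le> k * inner (A x) x"
proof -
  define y where "y = x - (1 / k) *\<^sub>R A x"
  note sym = op_pos_symmetric[OF A]
  have "0 \<le> inner (A y) y" by (rule op_pos_nonneg[OF A])
  also have "\<dots> = inner (A x) x - 2 / k * (norm (A x))\<^sup>2 + (1 / k)\<^sup>2 * inner (A (A x)) (A x)"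
    unfolding y_def blinfun.diff_right blinfun.scaleR_right inner_diff_left inner_diff_right
      inner_scaleR_left inner_scaleR_right sym[of "A x" x] power2_norm_eq_inner
    using k(2) by (simp add: power2_eq_square field_simps)
  also have "\<dots> \<le> inner (A x) x - 2 / k * (norm (A x))\<^sup>2 + (1 / k)\<^sup>2 * (k * (norm (A x))\<^sup>2)"
    using k by (intro add_left_mono mult_left_mono) auto
  also have "\<dots> = inner (A x) x - (norm (A x))\<^sup>2 / k"
    using k(2) by (simp add: power2_eq_square field_simps)
  finally show ?thesis using k(2) by (simp add: field_simps)
qed

lemma inner_blinfun_le: "inner (blinfun_apply A x) x \<le> norm A * (norm x)\<^sup>2"
proof -
  have "inner (A x) x \<le> norm (A x) * norm x" by (rule norm_cauchy_schwarz)
  also have "\<dots> \<le> norm A * norm x * norm x" by (intro mult_right_mono norm_blinfun) simp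
  finally show ?thesis by (simp add: power2_eq_square mult_ac)
qed

lemma op_pos_inner_zero:
  assumes "op_pos A" "inner (A x) x = 0"
  shows "A x = 0"
proof -
  have "(norm (A x))\<^sup>2 \<le> (norm A + 1) * inner (A x) x"
  proof (rule op_pos_norm_le[OF assms(1)])
    show "inner (A x) x \<le> (norm A + 1) * (norm x)\<^sup>2" for x
      using inner_blinfun_le[of A x] by (simp add: algebra_simps add_increasing)
  qed (simp add: add_pos_nonneg pos_add_strict add_nonneg_pos)
  thus ?thesis using assms(2) by simp
qed

text \<open>A fixed point \<open>Y\<close> of \<open>Y = (A + Y\<^sup>2) / 2\<close> satisfies \<open>(I - Y)\<^sup>2 = I - A\<close>.  The iteration
  converges in operator norm: its increments are dominated by those of the scalar iteration for
  \<open>A = 1\<close>, which is increasing and bounded.\<close>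

primrec sqrt_iter :: "('a::chilbert_space \<Rightarrow>\<^sub>L 'a) \<Rightarrow> nat \<Rightarrow> 'a \<Rightarrow>\<^sub>L 'a" where
  "sqrt_iter A 0 = 0"
| "sqrt_iter A (Suc n) = (1/2) *\<^sub>R (A + (sqrt_iter A n o\<^sub>L sqrt_iter A n))"

primrec sqrt_majorant :: "nat \<Rightarrow> real" where
  "sqrt_majorant 0 = 0"
| "sqrt_majorant (Suc n) = (1 + (sqrt_majorant n)\<^sup>2) / 2"

lemma sqrt_majorant_bounds: "0 \<le> sqrt_majorant n \<and> sqrt_majorant n \<le> 1"
  by (induction n) (auto simp: power_le_one)

lemma sqrt_majorant_convergent: "convergent sqrt_majorant"
proof (rule Bseq_mono_convergent)
  show "Bseq sqrt_majorant" using sqrt_majorant_bounds by (intro BseqI'[of _ 1]) auto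
  have "sqrt_majorant n \<le> sqrt_majorant (Suc n)" for n
    using zero_le_power2[of "1 - sqrt_majorant n"] by (simp add: power2_diff)
  thus "\<forall>m n. m \<le> n \<longrightarrow> sqrt_majorant m \<le> sqrt_majorant n"
    using lift_Suc_mono_le by blast
qed

lemma norm_sqrt_iter:
  assumes "norm A \<le> 1"
  shows "norm (sqrt_iter A n) \<le> sqrt_majorant n"
proof (induction n)
  case (Suc n)
  have "norm (sqrt_iter A n o\<^sub>L sqrt_iter A n) \<le> norm (sqrt_iter A n) * norm (sqrt_iter A n)"
    by (rule norm_blinfun_compose)
  also have "\<dots> \<le> (sqrt_majorant n)\<^sup>2"
    unfolding power2_eq_square using Suc by (intro mult_mono) (auto simp: sqrt_majorant_bounds)
  finally have "norm (A + (sqrt_iter A n o\<^sub>L sqrt_iter A n)) \<le> 1 + (sqrt_majorant n)\<^sup>2"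
    using norm_triangle_mono[OF assms] by blast
  thus ?case by simp
qed simp

lemma norm_sqrt_iter_diff:
  assumes "norm A \<le> 1"
  shows "norm (sqrt_iter A (Suc n) - sqrt_iter A n) \<le> sqrt_majorant (Suc n) - sqrt_majorant n"
proof (induction n)
  case 0
  show ?case using assms by simp
next
  case (Suc n)
  let ?X = "sqrt_iter A (Suc n)" and ?Y = "sqrt_iter A n"
  let ?s = "sqrt_majorant (Suc n)" and ?t = "sqrt_majorant n"
  have "sqrt_iter A (Suc (Suc n)) - ?X = (1/2) *\<^sub>R ((?X o\<^sub>L ?X) - (?Y o\<^sub>L ?Y))"
    by (subst sqrt_iter.simps(2), subst (2) sqrt_iter.simps(2)) (simp only: scaleR_diff_right[symmetric] add_diff_cancel_left)
  also have "(?X o\<^sub>L ?X) - (?Y o\<^sub>L ?Y) = (?X o\<^sub>L (?X - ?Y)) + ((?X - ?Y) o\<^sub>L ?Y)"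
    by (rule blinfun_eqI)
      (simp add: blinfun.diff_left blinfun.diff_right blinfun.add_left del: sqrt_iter.simps)
  finally have "norm (sqrt_iter A (Suc (Suc n)) - ?X) =
      norm ((?X o\<^sub>L (?X - ?Y)) + ((?X - ?Y) o\<^sub>L ?Y)) / 2" by (simp del: sqrt_iter.simps)
  also have "\<dots> \<le> (?s * (?s - ?t) + (?s - ?t) * ?t) / 2"
  proof (intro divide_right_mono norm_triangle_mono order_trans[OF norm_blinfun_compose] mult_mono Suc norm_sqrt_iter assms)
    show "0 \<le> ?s" "0 \<le> ?s - ?t"
      using sqrt_majorant_bounds order_trans[OF norm_ge_zero Suc] by blast+
  qed simp_all
  also have "\<dots> = (?s\<^sup>2 - ?t\<^sup>2) / 2" by (simp add: power2_eq_square algebra_simps)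
  also have "\<dots> = sqrt_majorant (Suc (Suc n)) - ?s"
  proof -
    have "(s\<^sup>2 - t\<^sup>2) / 2 = r - s" if "r = (1 + s\<^sup>2) / 2" "s = (1 + t\<^sup>2) / 2" for r s t :: real
      using that by argo
    thus ?thesis using sqrt_majorant.simps(2) by blast
  qed
  finally show ?case .
qed

lemma sqrt_iter_convergent:
  assumes "norm A \<le> 1"
  obtains Y where "sqrt_iter A \<longlonglongrightarrow> Y"
proof -
  have diff: "norm (sqrt_iter A (n + k) - sqrt_iter A n) \<le> sqrt_majorant (n + k) - sqrt_majorant n"
    for n k
  proof (induction k)
    case (Suc k)
    have "norm (sqrt_iter A (Suc (n + k)) - sqrt_iter A (n + k) + (sqrt_iter A (n + k) - sqrt_iter A n))
      \<le> (sqrt_majorant (Suc (n + k)) - sqrt_majorant (n + k)) + (sqrt_majorant (n + k) - sqrt_majorant n)"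
      by (intro norm_triangle_mono norm_sqrt_iter_diff assms Suc)
    thus ?case by (simp del: sqrt_iter.simps sqrt_majorant.simps)
  qed simp
  have "Cauchy (sqrt_iter A)"
  proof (rule CauchyI')
    fix e :: real assume "0 < e"
    then obtain M where M: "\<And>m n. m \<ge> M \<Longrightarrow> n \<ge> M \<Longrightarrow> norm (sqrt_majorant m - sqrt_majorant n) < e"
      using sqrt_majorant_convergent CauchyD by (metis Cauchy_convergent_iff)
    have "dist (sqrt_iter A m) (sqrt_iter A n) < e" if "M \<le> m" "m < n" for m n
      using diff[of m "n - m"] M[of n m] that by (simp add: dist_norm norm_minus_commute)
    thus "\<exists>M. \<forall>m\<ge>M. \<forall>n>m. dist (sqrt_iter A m) (sqrt_iter A n) < e" by blast
  qed
  thus ?thesis using that by (auto simp: Cauchy_convergent_iff convergent_def)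
qed

lemma sqrt_iter_invariants:
  assumes "is_clinear A" "\<And>x y. inner (A x) y = inner x (A y)"
  shows "is_clinear (sqrt_iter A n) \<and> (\<forall>x y. inner (sqrt_iter A n x) y = inner x (sqrt_iter A n y))"
    and "B o\<^sub>L A = A o\<^sub>L B \<Longrightarrow> B o\<^sub>L sqrt_iter A n = sqrt_iter A n o\<^sub>L B"
proof -
  show "is_clinear (sqrt_iter A n) \<and> (\<forall>x y. inner (sqrt_iter A n x) y = inner x (sqrt_iter A n y))"
    by (induction n)
      (auto intro!: clin simp: assms blinfun.scaleR_left blinfun.add_left inner_add_left inner_add_right)
  assume B: "B o\<^sub>L A = A o\<^sub>L B"
  show "B o\<^sub>L sqrt_iter A n = sqrt_iter A n o\<^sub>L B"
  proof (induction n)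
    case (Suc n)
    have 1: "B (A x) = A (B x)" "B (sqrt_iter A n x) = sqrt_iter A n (B x)" for x
      using B Suc by (metis blinfun_apply_blinfun_compose)+
    show ?case
      by (rule blinfun_eqI) (simp add: 1 blinfun.scaleR_left blinfun.scaleR_right blinfun.add_left blinfun.add_right)
  qed simp
qed

text \<open>The square root is \<open>I - Y\<close>, with \<open>Y\<close> the limit of the iteration started from the
  contraction \<open>A = I - T\<close>.  Every iterate is a polynomial in \<open>A\<close>, which is why whatever commutes
  with \<open>T\<close> commutes with the square root.\<close>

lemma contraction_sqrt_exists:
  fixes T :: "'a::chilbert_space \<Rightarrow>\<^sub>L 'a"
  assumes T: "op_pos T" "\<And>x. inner (T x) x \<le> (norm x)\<^sup>2"
  obtains R where "op_pos R" "R o\<^sub>L R = T" "\<And>B. B o\<^sub>L T = T o\<^sub>L B \<Longrightarrow> B o\<^sub>L R = R o\<^sub>L B"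
proof -
  define A where "A = id_blinfun - T"
  have Ax: "A x = x - T x" for x by (simp add: A_def blinfun.diff_left)
  have Tc: "is_clinear T" and Ts: "inner (T x) y = inner x (T y)" and Tp: "0 \<le> inner (T x) x" for x y
    using T(1) by (auto simp: op_pos_iff)
  have Ac: "is_clinear A" unfolding A_def by (intro clin Tc)
  have As: "inner (A x) y = inner x (A y)" for x y by (simp add: Ax Ts inner_simps)
  have Ap: "op_pos A"
    using Ac As T(2) by (auto simp: op_pos_iff Ax inner_simps power2_norm_eq_inner)
  have le: "inner (A x) x \<le> 1 * (norm x)\<^sup>2" for x
    using Tp[of x] by (simp add: Ax inner_simps power2_norm_eq_inner)
  have "norm (A x) \<le> 1 * norm x" for x
    using op_pos_norm_le[OF Ap le, of x] le[of x] by (simp add: power2_le_imp_le)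
  hence nA: "norm A \<le> 1" by (rule norm_blinfun_bound[rotated]) simp
  obtain Y where Y: "sqrt_iter A \<longlonglongrightarrow> Y" using sqrt_iter_convergent[OF nA] .
  have Yx: "(\<lambda>n. sqrt_iter A n x) \<longlonglongrightarrow> Y x" for x by (intro blinfun.tendsto Y tendsto_const)
  have "norm Y \<le> 1"
  proof (rule LIMSEQ_le_const2[OF tendsto_norm[OF Y]])
    have "norm (sqrt_iter A n) \<le> 1" for n
      using norm_sqrt_iter[OF nA, of n] sqrt_majorant_bounds[of n] by linarith
    thus "\<exists>N. \<forall>n\<ge>N. norm (sqrt_iter A n) \<le> 1" by blast
  qed
  have Yc: "is_clinear Y"
    unfolding is_clinear_def
  proof (intro allI)
    fix c x
    have "(\<lambda>n. sqrt_iter A n (c *\<^sub>C x)) \<longlonglongrightarrow> c *\<^sub>C Y x"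
      using tendsto_scaleC[OF Yx] sqrt_iter_invariants(1)[OF Ac As] by (simp add: is_clinearD)
    thus "Y (c *\<^sub>C x) = c *\<^sub>C Y x" using Yx LIMSEQ_unique by blast
  qed
  have Ys: "inner (Y x) y = inner x (Y y)" for x y
  proof -
    have "(\<lambda>n. inner (sqrt_iter A n x) y) \<longlonglongrightarrow> inner x (Y y)"
      using tendsto_inner[OF tendsto_const Yx] sqrt_iter_invariants(1)[OF Ac As] by simp
    thus ?thesis using tendsto_inner[OF Yx tendsto_const] LIMSEQ_unique by blast
  qed
  have fix_eq: "Y = (1/2) *\<^sub>R (A + (Y o\<^sub>L Y))"
  proof (rule LIMSEQ_unique)
    show "(\<lambda>n. sqrt_iter A (Suc n)) \<longlonglongrightarrow> Y" by (rule LIMSEQ_Suc[OF Y])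
    show "(\<lambda>n. sqrt_iter A (Suc n)) \<longlonglongrightarrow> (1/2) *\<^sub>R (A + (Y o\<^sub>L Y))"
      unfolding sqrt_iter.simps
      by (intro tendsto_intros bounded_bilinear.tendsto[OF bounded_bilinear_blinfun_compose] Y)
  qed
  have "2 *\<^sub>R Y = 2 *\<^sub>R ((1/2) *\<^sub>R (A + (Y o\<^sub>L Y)))" by (rule arg_cong[OF fix_eq])
  also have "\<dots> = A + (Y o\<^sub>L Y)" by simp
  finally have YY: "2 *\<^sub>R Y x = A x + Y (Y x)" for x
    by (metis blinfun.add_left blinfun.scaleR_left blinfun_apply_blinfun_compose)
  define R where "R = id_blinfun - Y"
  have Rx: "R x = x - Y x" for x by (simp add: R_def blinfun.diff_left)
  show ?thesis
  proof (rule that)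
    have "inner (Y x) x \<le> (norm x)\<^sup>2" for x
      using inner_blinfun_le[of Y x] mult_right_mono[OF \<open>norm Y \<le> 1\<close>, of "(norm x)\<^sup>2"] by simp
    hence "0 \<le> inner (R x) x" for x by (simp add: Rx inner_simps power2_norm_eq_inner)
    moreover have "inner (R x) y = inner x (R y)" for x y by (simp add: Rx inner_simps Ys)
    moreover have "is_clinear R" unfolding R_def by (intro clin Yc)
    ultimately show "op_pos R" unfolding op_pos_iff by blast
    show "R o\<^sub>L R = T"
    proof (rule blinfun_eqI)
      fix x
      have "R (R x) = x - 2 *\<^sub>R Y x + Y (Y x)"
        by (simp add: Rx blinfun.diff_right scaleR_2)
      thus "(R o\<^sub>L R) x = T x" by (simp add: YY Ax)
    qed
    fix B assume B: "B o\<^sub>L T = T o\<^sub>L B"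
    have "B (T x) = T (B x)" for x using B by (metis blinfun_apply_blinfun_compose)
    hence "B o\<^sub>L A = A o\<^sub>L B"
      by (intro blinfun_eqI) (simp add: Ax blinfun.diff_right)
    from sqrt_iter_invariants(2)[OF Ac As this]
    have c: "B (sqrt_iter A n x) = sqrt_iter A n (B x)" for n x by (metis blinfun_apply_blinfun_compose)
    have "B (Y x) = Y (B x)" for x
      using blinfun.tendsto[OF tendsto_const Yx, of B x] Yx[of "B x"] LIMSEQ_unique
      unfolding c by blast
    thus "B o\<^sub>L R = R o\<^sub>L B" by (intro blinfun_eqI) (simp add: Rx blinfun.diff_right)
  qed
qed

lemma op_pos_scaleR: "op_pos A \<Longrightarrow> 0 \<le> r \<Longrightarrow> op_pos (r *\<^sub>R A)"
  by (auto simp: op_pos_iff blinfun.scaleR_left intro: clin)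

lemma op_sqrt_exists:
  fixes A :: "'a::chilbert_space \<Rightarrow>\<^sub>L 'a"
  assumes A: "op_pos A"
  obtains R where "op_pos R" "R o\<^sub>L R = A" "\<And>B. B o\<^sub>L A = A o\<^sub>L B \<Longrightarrow> B o\<^sub>L R = R o\<^sub>L B"
proof -
  define k where "k = norm A + 1"
  have k: "0 < k" by (simp add: k_def add_nonneg_pos)
  have "op_pos ((1/k) *\<^sub>R A)" using A k by (intro op_pos_scaleR) auto
  moreover have "inner (((1/k) *\<^sub>R A) x) x \<le> (norm x)\<^sup>2" for x
  proof -
    have "inner (A x) x \<le> k * (norm x)\<^sup>2"
      using inner_blinfun_le[of A x] by (simp add: k_def algebra_simps add_increasing)
    thus ?thesis using k by (simp add: blinfun.scaleR_left field_simps)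
  qed
  ultimately obtain R where R: "op_pos R" "R o\<^sub>L R = (1/k) *\<^sub>R A"
    "\<And>B. B o\<^sub>L ((1/k) *\<^sub>R A) = ((1/k) *\<^sub>R A) o\<^sub>L B \<Longrightarrow> B o\<^sub>L R = R o\<^sub>L B"
    using contraction_sqrt_exists[of "(1/k) *\<^sub>R A"] by metis
  have RR: "R (R x) = (1/k) *\<^sub>R A x" for x
    using R(2) by (metis blinfun.scaleR_left blinfun_apply_blinfun_compose)
  show ?thesis
  proof (rule that[of "sqrt k *\<^sub>R R"])
    show "op_pos (sqrt k *\<^sub>R R)" using k by (intro op_pos_scaleR R) auto
    show "(sqrt k *\<^sub>R R) o\<^sub>L (sqrt k *\<^sub>R R) = A"
      using k by (intro blinfun_eqI) (simp add: blinfun.scaleR_left blinfun.scaleR_right RR)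
    fix B assume B: "B o\<^sub>L A = A o\<^sub>L B"
    have "B (A x) = A (B x)" for x using B by (metis blinfun_apply_blinfun_compose)
    hence "B o\<^sub>L R = R o\<^sub>L B"
      by (intro R(3) blinfun_eqI) (simp add: blinfun.scaleR_left blinfun.scaleR_right)
    hence "B (R x) = R (B x)" for x by (metis blinfun_apply_blinfun_compose)
    thus "B o\<^sub>L (sqrt k *\<^sub>R R) = (sqrt k *\<^sub>R R) o\<^sub>L B"
      by (intro blinfun_eqI) (simp add: blinfun.scaleR_left blinfun.scaleR_right)
  qed
qed

text \<open>Uniqueness: another positive root \<open>Q\<close> commutes with \<open>A\<close>, hence with the root \<open>R\<close> just
  constructed.  Then \<open>(R + Q)(R - Q) = 0\<close>, which forces \<open>R y = Q y = 0\<close> for \<open>y = (R - Q) x\<close>,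
  whence \<open>\<parallel>y\<parallel>\<^sup>2 = 0\<close>.\<close>

lemma op_sqrt:
  fixes A :: "'a::chilbert_space \<Rightarrow>\<^sub>L 'a"
  assumes A: "op_pos A"
  shows "op_pos (op_sqrt A)" and "op_sqrt A (op_sqrt A x) = A x"
proof -
  obtain R where R: "op_pos R" "R o\<^sub>L R = A" "\<And>B. B o\<^sub>L A = A o\<^sub>L B \<Longrightarrow> B o\<^sub>L R = R o\<^sub>L B"
    using op_sqrt_exists[OF A] by blast
  have "op_sqrt A = R"
    unfolding op_sqrt_def
  proof (rule the_equality)
    fix Q assume Q: "op_pos Q \<and> Q o\<^sub>L Q = A"
    hence "Q o\<^sub>L R = R o\<^sub>L Q" by (intro R(3)) (metis blinfun_compose_assoc)
    hence comm: "Q (R x) = R (Q x)" for x by (metis blinfun_apply_blinfun_compose)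
    have sq: "R (R x) = Q (Q x)" for x using Q R(2) by (metis blinfun_apply_blinfun_compose)
    have Qp: "op_pos Q" using Q by blast
    note pos = op_pos_nonneg[OF R(1)] op_pos_nonneg[OF Qp]
    have "R x = Q x" for x
    proof -
      define y where "y = R x - Q x"
      have "R y + Q y = 0" by (simp add: y_def blinfun.diff_right comm sq)
      hence "inner (R y) y + inner (Q y) y = 0" by (metis inner_add_left inner_zero_left)
      hence "inner (R y) y = 0" "inner (Q y) y = 0" using pos[of y] by linarith+
      hence "R y = 0" "Q y = 0" using R(1) Q op_pos_inner_zero by blast+
      moreover have "inner y y = inner x (R y - Q y)"
        by (simp add: y_def inner_diff_left inner_diff_right blinfun.diff_right op_pos_symmetric[OF R(1)]
            op_pos_symmetric[OF Qp])
      ultimately show ?thesis by (simp add: y_def)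
    qed
    thus "Q = R" by (intro blinfun_eqI) simp
  qed (use R in blast)
  thus "op_pos (op_sqrt A)" "op_sqrt A (op_sqrt A x) = A x"
    using R(1,2) blinfun_apply_blinfun_compose[of R R x] by simp_all
qed

lemma norm_op_sqrt:
  assumes "op_pos A"
  shows "(norm (op_sqrt A x))\<^sup>2 = inner (A x) x"
  using op_pos_symmetric[OF op_sqrt(1)[OF assms], of "op_sqrt A x" x] op_sqrt(2)[OF assms, of x]
  by (simp add: power2_norm_eq_inner)

lemma op_strictly_pos_inv:
  assumes "op_strictly_pos A"
  shows "A (op_inv A x) = x" "op_inv A (A x) = x" "op_pos (op_inv A)"
proof -
  obtain B where "op_inverse_of A B" using assms by (auto simp: op_strictly_pos_def)
  moreover from this have "op_inv A = B" by (rule op_inv_inverse)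
  ultimately have B: "is_clinear (op_inv A)" "A o\<^sub>L op_inv A = id_blinfun" "op_inv A o\<^sub>L A = id_blinfun"
    by (auto simp: op_inverse_of_def)
  show i: "A (op_inv A x) = x" "op_inv A (A x) = x" for x
    using B by (metis blinfun_apply_blinfun_compose id_blinfun.rep_eq id_apply)+
  have "op_pos A" using assms by (simp add: op_strictly_pos_def)
  note A = op_pos_symmetric[OF this] op_pos_nonneg[OF this]
  show "op_pos (op_inv A)"
    unfolding op_pos_iff
  proof (intro conjI allI)
    show "inner (op_inv A x) y = inner x (op_inv A y)" for x y
      using A(1)[of "op_inv A x" "op_inv A y"] by (simp add: i)
    show "0 \<le> inner (op_inv A x) x" for x
      using A(2)[of "op_inv A x"] by (simp add: i inner_commute)
  qed fact
qed

lemma op_strictly_pos_inner_zero: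
  assumes "op_strictly_pos A" "inner (A x) x = 0"
  shows "x = 0"
  using op_pos_inner_zero[of A x] assms op_strictly_pos_inv(2)[OF assms(1), of x]
  by (simp add: op_strictly_pos_def)

text \<open>If \<open>X\<^sup>*\<close> is bounded below then so is \<open>X X\<^sup>*\<close>, which has closed range and is therefore
  invertible; \<open>X\<^sup>* (X X\<^sup>*)\<^sup>-\<^sup>1\<close> is a right inverse of \<open>X\<close>, which
  injectivity makes two-sided.\<close>

lemma bijective_of_adjoint_bounded_below:
  fixes X :: "'a::chilbert_space \<Rightarrow>\<^sub>L 'b::chilbert_space"
  assumes X: "is_clinear X" "\<And>x. X x = 0 \<Longrightarrow> x = 0"
    and c: "0 < c" "\<And>y. c * norm y \<le> norm (op_adj X y)"
  obtains R where "op_inverse_of X R"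
proof -
  define A where "A = X o\<^sub>L op_adj X"
  have inn: "inner (A y) z = inner (op_adj X y) (op_adj X z)" for y z
    by (simp add: A_def inner_op_adj[OF X(1)])
  have low: "c\<^sup>2 * norm y \<le> norm (A y)" for y
  proof -
    have "(c * norm y)\<^sup>2 \<le> (norm (op_adj X y))\<^sup>2" using c by (intro power_mono) auto
    also have "\<dots> = inner (A y) y" by (simp add: inn power2_norm_eq_inner)
    also have "\<dots> \<le> norm (A y) * norm y" by (rule norm_cauchy_schwarz)
    finally show ?thesis by (cases "norm y = 0") (auto simp: power2_eq_square mult_ac)
  qed
  have sub: "subspace (range A)"
    by (metis bounded_linear.linear blinfun.bounded_linear_right linear_subspace_image subspace_UNIV)
  have "complete (blinfun_apply A ` UNIV)"
    using low c by (intro complete_isometric_image[of "c\<^sup>2"] subspace_UNIV blinfun.bounded_linear_right)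
      (auto simp: complete_UNIV)
  hence "closed (range A)" by (simp add: complete_imp_closed)
  have surj: "\<exists>z. A z = y" for y
  proof -
    obtain w where w: "w \<in> range A" "\<And>m. m \<in> range A \<Longrightarrow> inner (y - w) m = 0"
      using projection_exists[OF sub \<open>closed (range A)\<close>, of y] by blast
    have "inner (A (y - w)) (y - w) = 0" using w(2)[of "A (y - w)"] by (simp add: inner_commute)
    hence "op_adj X (y - w) = 0" by (simp add: inn)
    hence "y - w = 0" using c by (metis mult_le_0_iff norm_eq_zero norm_ge_zero norm_le_zero_iff not_less)
    thus ?thesis using w(1) by auto
  qed
  define g where "g y = (SOME z. A z = y)" for y
  have Ag: "A (g y) = y" for y unfolding g_def by (rule someI_ex) (rule surj)
  have inj: "y = z" if "A y = A z" for y z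
    using low[of "y - z"] that c by (simp add: blinfun.diff_right mult_le_0_iff)
  have "bounded_linear g"
  proof (rule bounded_linear_intro)
    show "g (x + y) = g x + g y" for x y by (rule inj) (simp add: Ag blinfun.add_right)
    show "g (r *\<^sub>R x) = r *\<^sub>R g x" for r x by (rule inj) (simp add: Ag blinfun.scaleR_right)
    show "norm (g x) \<le> norm x * (1 / c\<^sup>2)" for x
      using low[of "g x"] c by (simp add: Ag field_simps)
  qed
  hence Bg: "blinfun_apply (Blinfun g) = g" by (rule bounded_linear_Blinfun_apply)
  define R where "R = op_adj X o\<^sub>L Blinfun g"
  have XR: "X (R y) = y" for y using Ag[of y] by (simp add: R_def A_def Bg)
  have Xinj: "x = y" if "X x = X y" for x y
    using X(2)[of "x - y"] that by (simp add: blinfun.diff_right)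
  show ?thesis
  proof (rule that[of R], unfold op_inverse_of_def is_clinear_def, intro conjI allI)
    show "R (a *\<^sub>C x) = a *\<^sub>C R x" for a x
      by (rule Xinj) (simp add: XR is_clinearD[OF X(1)])
    show "X o\<^sub>L R = id_blinfun" by (rule blinfun_eqI) (simp add: XR)
    show "R o\<^sub>L X = id_blinfun" by (rule blinfun_eqI, rule Xinj) (simp add: XR)
  qed
qed

section \<open>Isometric relations\<close>

text \<open>The set \<open>\<Gamma>\<close> is the graph of an isometry between subspaces.  Projecting \<open>(x, 0)\<close>
  orthogonally onto \<open>\<Gamma>\<close> gives half of the pair over the projection of \<open>x\<close>, because
  \<open>inner (fst p) (fst q) = inner (snd p) (snd q)\<close> on \<open>\<Gamma>\<close>.  In this way both components of
  \<open>\<Gamma>\<close> inherit orthogonal projections from the closedness of \<open>\<Gamma>\<close> alone.\<close>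

lemma isometric_relation_projection:
  fixes \<Gamma> :: "('a::chilbert_space \<times> 'b::chilbert_space) set"
  assumes \<Gamma>: "subspace \<Gamma>" "closed \<Gamma>"
    and iso: "\<And>p. p \<in> \<Gamma> \<Longrightarrow> norm (fst p) = norm (snd p)"
  shows "\<exists>p\<in>\<Gamma>. \<forall>q\<in>\<Gamma>. inner (x - fst p) (fst q) = 0"
    and "\<exists>p\<in>\<Gamma>. \<forall>q\<in>\<Gamma>. inner (y - snd p) (snd q) = 0"
    and "p \<in> \<Gamma> \<Longrightarrow> q \<in> \<Gamma> \<Longrightarrow> inner (fst p) (fst q) = inner (snd p) (snd q)"
proof -
  show polar: "inner (fst p) (fst q) = inner (snd p) (snd q)" if "p \<in> \<Gamma>" "q \<in> \<Gamma>" for p q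
    using iso[OF subspace_add[OF \<Gamma>(1) that]] iso[OF that(1)] iso[OF that(2)]
    by (simp add: norm_eq_sqrt_inner inner_simps inner_commute)
  obtain p where p: "p \<in> \<Gamma>" "\<And>q. q \<in> \<Gamma> \<Longrightarrow> inner ((x, 0) - p) q = 0"
    using projection_exists[OF \<Gamma>, of "(x, 0)"] by blast
  show "\<exists>p\<in>\<Gamma>. \<forall>q\<in>\<Gamma>. inner (x - fst p) (fst q) = 0"
  proof (intro bexI ballI)
    show "2 *\<^sub>R p \<in> \<Gamma>" using \<Gamma>(1) p(1) by (simp add: subspace_scale)
    show "inner (x - fst (2 *\<^sub>R p)) (fst q) = 0" if "q \<in> \<Gamma>" for q
      using p(2)[OF that] polar[OF p(1) that]
      by (simp add: inner_prod_def inner_simps)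
  qed
  obtain p where p: "p \<in> \<Gamma>" "\<And>q. q \<in> \<Gamma> \<Longrightarrow> inner ((0, y) - p) q = 0"
    using projection_exists[OF \<Gamma>, of "(0, y)"] by blast
  show "\<exists>p\<in>\<Gamma>. \<forall>q\<in>\<Gamma>. inner (y - snd p) (snd q) = 0"
  proof (intro bexI ballI)
    show "2 *\<^sub>R p \<in> \<Gamma>" using \<Gamma>(1) p(1) by (simp add: subspace_scale)
    show "inner (y - snd (2 *\<^sub>R p)) (snd q) = 0" if "q \<in> \<Gamma>" for q
      using p(2)[OF that] polar[OF p(1) that]
      by (simp add: inner_prod_def inner_simps)
  qed
qed

text \<open>The isometry with graph \<open>\<Gamma>\<close>, extended by zero on the orthogonal complement of its domain.\<close>

lemma isometric_relation_extension:
  fixes \<Gamma> :: "('a::chilbert_space \<times> 'b::chilbert_space) set"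
  assumes \<Gamma>: "csubspace \<Gamma>" "closed \<Gamma>"
    and iso: "\<And>p. p \<in> \<Gamma> \<Longrightarrow> norm (fst p) = norm (snd p)"
  shows "\<exists>W :: 'a \<Rightarrow>\<^sub>L 'b. is_clinear W \<and> (\<forall>x. norm (W x) \<le> norm x) \<and> (\<forall>p\<in>\<Gamma>. W (fst p) = snd p)"
proof -
  note sub = csubspace_imp_subspace[OF \<Gamma>(1)]
  note rel = isometric_relation_projection[OF sub \<Gamma>(2) iso]
  obtain p where p: "\<And>x. p x \<in> \<Gamma>" "\<And>x q. q \<in> \<Gamma> \<Longrightarrow> inner (x - fst (p x)) (fst q) = 0"
    using rel(1) by metis
  have uniq: "snd r = snd (p x)" if r: "r \<in> \<Gamma>" "\<And>q. q \<in> \<Gamma> \<Longrightarrow> inner (x - fst r) (fst q) = 0" for r x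
  proof -
    have d: "r - p x \<in> \<Gamma>" using sub r(1) p(1) by (simp add: subspace_diff)
    have "inner (fst (r - p x)) (fst (r - p x)) = 0"
      using r(2)[OF d] p(2)[OF d, of x] by (simp add: inner_simps)
    hence "snd (r - p x) = 0" using iso[OF d] by simp
    thus ?thesis by simp
  qed
  define w where "w x = snd (p x)" for x
  have add: "w (x + y) = w x + w y" for x y
    unfolding w_def snd_add[symmetric]
  proof (rule uniq[symmetric])
    show "p x + p y \<in> \<Gamma>" using sub p(1) by (simp add: subspace_add)
    show "inner (x + y - fst (p x + p y)) (fst q) = 0" if "q \<in> \<Gamma>" for q
      using p(2)[OF that, of x] p(2)[OF that, of y] by (simp add: inner_simps)
  qed
  have scale: "w (c *\<^sub>C x) = c *\<^sub>C w x" for c x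
  proof -
    have "snd (c *\<^sub>C p x) = w (c *\<^sub>C x)"
      unfolding w_def
    proof (rule uniq)
      show "c *\<^sub>C p x \<in> \<Gamma>" using \<Gamma>(1) p(1) by (simp add: csubspace_def)
      fix q assume q: "q \<in> \<Gamma>"
      have "cnj c *\<^sub>C q \<in> \<Gamma>" using \<Gamma>(1) q by (simp add: csubspace_def)
      from p(2)[OF this, of x]
      have "Re (cinner (x - fst (p x)) (cnj c *\<^sub>C fst q)) = 0" by (simp add: Re_cinner scaleC_prod_def)
      hence "Re (cinner (c *\<^sub>C (x - fst (p x))) (fst q)) = 0"
        by (simp add: cinner_scaleC_left cinner_scaleC_right)
      thus "inner (c *\<^sub>C x - fst (c *\<^sub>C p x)) (fst q) = 0"
        by (simp add: Re_cinner scaleC_prod_def scaleC_diff)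
    qed
    thus ?thesis by (simp add: w_def scaleC_prod_def)
  qed
  have contr: "norm (w x) \<le> norm x" for x
  proof -
    have "norm (w x) = norm (fst (p x))" using iso[OF p(1)] by (simp add: w_def)
    moreover have "inner (fst (p x)) (fst (p x)) = inner x (fst (p x))"
      using p(2)[OF p(1), of x x] by (simp add: inner_simps)
    hence "(norm (fst (p x)))\<^sup>2 \<le> norm x * norm (fst (p x))"
      by (metis norm_cauchy_schwarz power2_norm_eq_inner)
    hence "norm (fst (p x)) \<le> norm x"
      by (cases "norm (fst (p x)) = 0") (auto simp: power2_eq_square)
    ultimately show ?thesis by simp
  qed
  have "bounded_linear w"
    by (rule bounded_linear_intro[of _ 1]) (use add scale contr in \<open>auto simp flip: scaleC_of_real\<close>)
  hence W: "blinfun_apply (Blinfun w) = w" by (rule bounded_linear_Blinfun_apply)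
  show ?thesis
    by (rule exI[of _ "Blinfun w"])
      (auto simp: W is_clinear_def scale contr intro!: uniq[symmetric, folded w_def])
qed

section \<open>The algebra of formal power series\<close>

lemma splits_Nil: "splits [] = {([], [])}"
  by (auto simp: splits_def)

lemma splits_Cons: "splits (i # \<alpha>) = insert ([], i # \<alpha>) ((\<lambda>p. (i # fst p, snd p)) ` splits \<alpha>)"
  by (force simp: splits_def append_eq_Cons_conv image_iff)

lemma splits_snoc: "splits (\<alpha> @ [j]) = insert (\<alpha> @ [j], []) ((\<lambda>p. (fst p, snd p @ [j])) ` splits \<alpha>)"
proof -
  have "\<beta> @ \<gamma> = \<alpha> @ [j] \<longleftrightarrow> \<beta> = \<alpha> @ [j] \<and> \<gamma> = [] \<or> (\<exists>\<delta>. \<gamma> = \<delta> @ [j] \<and> \<beta> @ \<delta> = \<alpha>)" for \<beta> \<gamma>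
    by (cases \<gamma> rule: rev_cases) auto
  thus ?thesis by (force simp: splits_def image_iff)
qed

lemma sum_splits_Cons:
  "(\<Sum>p\<in>splits (i # \<alpha>). f p) = f ([], i # \<alpha>) + (\<Sum>p\<in>splits \<alpha>. f (i # fst p, snd p) :: 'a::comm_monoid_add)"
  unfolding splits_Cons
  by (subst sum.insert) (auto simp: finite_splits sum.reindex inj_on_def prod_eq_iff)

lemma sum_splits_snoc:
  "(\<Sum>p\<in>splits (\<alpha> @ [j]). f p) = f (\<alpha> @ [j], []) + (\<Sum>p\<in>splits \<alpha>. f (fst p, snd p @ [j]) :: 'a::comm_monoid_add)"
  unfolding splits_snoc
  by (subst sum.insert) (auto simp: finite_splits sum.reindex inj_on_def prod_eq_iff)

lemma nc_mult_Nil: "(S \<odot> R) [] = S [] o\<^sub>L R []"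
  by (simp add: nc_mult_def splits_Nil)

text \<open>Products are computed by peeling off the first or the last letter of the word; the
  multiplicative identities below are inductions along these two recursions.\<close>

lemma nc_mult_Cons: "(S \<odot> R) (i # \<alpha>) = (S [] o\<^sub>L R (i # \<alpha>)) + ((\<lambda>\<beta>. S (i # \<beta>)) \<odot> R) \<alpha>"
  by (simp add: nc_mult_def split_def sum_splits_Cons)

lemma nc_mult_snoc: "(S \<odot> R) (\<alpha> @ [j]) = (S (\<alpha> @ [j]) o\<^sub>L R []) + (S \<odot> (\<lambda>\<gamma>. R (\<gamma> @ [j]))) \<alpha>"
  by (simp add: nc_mult_def split_def sum_splits_snoc)

lemma nc_apply_Nil: "(S \<odot>\<^sub>v u) [] = S [] (u [])"
  by (simp add: nc_apply_def splits_Nil)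

lemma nc_apply_Cons: "(S \<odot>\<^sub>v u) (i # \<alpha>) = S [] (u (i # \<alpha>)) + ((\<lambda>\<beta>. S (i # \<beta>)) \<odot>\<^sub>v u) \<alpha>"
  by (simp add: nc_apply_def split_def sum_splits_Cons)

lemma nc_apply_snoc: "(S \<odot>\<^sub>v u) (\<alpha> @ [j]) = S (\<alpha> @ [j]) (u []) + (S \<odot>\<^sub>v (\<lambda>\<gamma>. u (\<gamma> @ [j]))) \<alpha>"
  by (simp add: nc_apply_def split_def sum_splits_snoc)

lemma blinfun_compose_distrib:
  "(A + B) o\<^sub>L C = (A o\<^sub>L C) + (B o\<^sub>L C)" "A o\<^sub>L (C + D) = (A o\<^sub>L C) + (A o\<^sub>L D)"
  "(A - B) o\<^sub>L C = (A o\<^sub>L C) - (B o\<^sub>L C)" "A o\<^sub>L (C - D) = (A o\<^sub>L C) - (A o\<^sub>L D)"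
  "0 o\<^sub>L C = 0" "A o\<^sub>L 0 = 0" "(- A) o\<^sub>L C = - (A o\<^sub>L C)" "A o\<^sub>L (- C) = - (A o\<^sub>L C)"
  by (auto intro!: blinfun_eqI simp: blinfun.add_left blinfun.add_right blinfun.diff_left
      blinfun.diff_right blinfun.minus_left blinfun.minus_right)

lemma nc_mult_add_left: "(S + S') \<odot> R = S \<odot> R + S' \<odot> R"
  and nc_mult_add_right: "S \<odot> (R + R') = S \<odot> R + S \<odot> R'"
  and nc_mult_diff_left: "(S - S') \<odot> R = S \<odot> R - S' \<odot> R"
  and nc_mult_zero_left: "(\<lambda>_. 0) \<odot> R = (\<lambda>_. 0)"
  by (auto simp: nc_mult_def fun_eq_iff split_def blinfun_compose_distrib sum.distrib sum_subtractf)

lemma nc_mult_zero_right: "S \<odot> (\<lambda>_. 0) = (\<lambda>_. 0)"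
  by (simp add: nc_mult_def blinfun_compose_distrib)

lemma nc_apply_zero_right: "S \<odot>\<^sub>v (\<lambda>_. 0) = (\<lambda>_. 0)"
  by (simp add: nc_apply_def)

lemma nc_apply_add_left: "(S + S') \<odot>\<^sub>v u = S \<odot>\<^sub>v u + S' \<odot>\<^sub>v u"
  and nc_apply_diff_left: "(S - S') \<odot>\<^sub>v u = S \<odot>\<^sub>v u - S' \<odot>\<^sub>v u"
  and nc_apply_zero_left: "(\<lambda>_. 0) \<odot>\<^sub>v u = (\<lambda>_. 0)"
  by (auto simp: nc_apply_def fun_eq_iff split_def blinfun.add_left blinfun.diff_left sum.distrib sum_subtractf)

lemma nc_mult_const_left: "nc_const A \<odot> R = (\<lambda>\<alpha>. A o\<^sub>L R \<alpha>)"
proof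
  show "(nc_const A \<odot> R) \<alpha> = A o\<^sub>L R \<alpha>" for \<alpha>
    by (cases \<alpha>) (simp_all add: nc_mult_Nil nc_mult_Cons nc_const_def nc_mult_zero_left)
qed

lemma nc_mult_const_right: "S \<odot> nc_const A = (\<lambda>\<alpha>. S \<alpha> o\<^sub>L A)"
proof
  show "(S \<odot> nc_const A) \<alpha> = S \<alpha> o\<^sub>L A" for \<alpha>
    by (cases \<alpha> rule: rev_cases) (simp_all add: nc_mult_Nil nc_mult_snoc nc_const_def nc_mult_zero_right)
qed

lemma nc_apply_const_left: "nc_const A \<odot>\<^sub>v u = (\<lambda>\<alpha>. A (u \<alpha>))"
proof
  show "(nc_const A \<odot>\<^sub>v u) \<alpha> = A (u \<alpha>)" for \<alpha>
    by (cases \<alpha>) (simp_all add: nc_apply_Nil nc_apply_Cons nc_const_def nc_apply_zero_left)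
qed

lemma nc_apply_const_right: "S \<odot>\<^sub>v nc_const x = (\<lambda>\<alpha>. S \<alpha> x)"
proof
  show "(S \<odot>\<^sub>v nc_const x) \<alpha> = S \<alpha> x" for \<alpha>
    by (cases \<alpha> rule: rev_cases) (simp_all add: nc_apply_Nil nc_apply_snoc nc_const_def nc_apply_zero_right)
qed

lemma nc_mult_one_left [simp]: "nc_const id_blinfun \<odot> R = R"
  and nc_mult_one_right [simp]: "S \<odot> nc_const id_blinfun = S"
  by (simp_all add: nc_mult_const_left nc_mult_const_right)

lemma nc_mult_const_const: "nc_const A1 \<odot> nc_const A2 = nc_const (A1 o\<^sub>L A2)"
  by (auto simp: nc_mult_const_left fun_eq_iff) (auto simp: nc_const_def blinfun_compose_distrib)

lemma nc_const_zero: "nc_const 0 = (\<lambda>_. 0)"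
  by (simp add: nc_const_def fun_eq_iff)

lemma nc_mult_assoc: "(S \<odot> R) \<odot> Q = S \<odot> (R \<odot> Q)"
proof
  show "((S \<odot> R) \<odot> Q) \<alpha> = (S \<odot> (R \<odot> Q)) \<alpha>" for \<alpha>
  proof (induction \<alpha> arbitrary: S R)
    case Nil
    show ?case by (simp add: nc_mult_Nil blinfun_compose_assoc)
  next
    case (Cons i \<alpha>)
    have "(\<lambda>\<beta>. (S \<odot> R) (i # \<beta>)) =
        nc_const (S []) \<odot> (\<lambda>\<beta>. R (i # \<beta>)) + (\<lambda>\<beta>. S (i # \<beta>)) \<odot> R"
      by (simp add: nc_mult_Cons nc_mult_const_left fun_eq_iff)
    thus ?case
      by (simp add: nc_mult_Cons nc_mult_Nil nc_mult_add_left Cons.IH)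
        (simp add: nc_mult_const_left blinfun_compose_distrib blinfun_compose_assoc add.assoc)
  qed
qed

lemma nc_apply_assoc: "(S \<odot> R) \<odot>\<^sub>v u = S \<odot>\<^sub>v (R \<odot>\<^sub>v u)"
proof
  show "((S \<odot> R) \<odot>\<^sub>v u) \<alpha> = (S \<odot>\<^sub>v (R \<odot>\<^sub>v u)) \<alpha>" for \<alpha>
  proof (induction \<alpha> arbitrary: S R)
    case Nil
    show ?case by (simp add: nc_mult_Nil nc_apply_Nil)
  next
    case (Cons i \<alpha>)
    have "(\<lambda>\<beta>. (S \<odot> R) (i # \<beta>)) =
        nc_const (S []) \<odot> (\<lambda>\<beta>. R (i # \<beta>)) + (\<lambda>\<beta>. S (i # \<beta>)) \<odot> R"
      by (simp add: nc_mult_Cons nc_mult_const_left fun_eq_iff)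
    thus ?case
      by (simp add: nc_mult_Nil nc_apply_Cons nc_apply_add_left Cons.IH)
        (simp add: nc_apply_const_left blinfun.add_right add.assoc)
  qed
qed

lemma nc_series_const [clin]: "is_clinear A \<Longrightarrow> nc_series (nc_const A)"
  by (auto simp: nc_series_def nc_const_def intro: clin)

lemma nc_series_mult [clin]: "nc_series S \<Longrightarrow> nc_series R \<Longrightarrow> nc_series (S \<odot> R)"
  by (auto simp: nc_series_def nc_mult_def split_def intro!: clin)

lemma nc_series_add [clin]: "nc_series S \<Longrightarrow> nc_series R \<Longrightarrow> nc_series (S + R)"
  by (auto simp: nc_series_def intro!: clin)

lemma nc_series_diff [clin]: "nc_series S \<Longrightarrow> nc_series R \<Longrightarrow> nc_series (S - R)"
  by (auto simp: nc_series_def intro!: clin)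

lemma nc_inv_unique:
  assumes "nc_inverse_of S R"
  shows "nc_inv S = R"
  unfolding nc_inv_def
proof (rule the_equality)
  fix Q assume "nc_inverse_of S Q"
  hence "Q = Q \<odot> (S \<odot> R)" using assms by (simp add: nc_inverse_of_def)
  also have "\<dots> = (Q \<odot> S) \<odot> R" by (simp add: nc_mult_assoc)
  finally show "Q = R" using \<open>nc_inverse_of S Q\<close> by (simp add: nc_inverse_of_def)
qed fact

lemma nc_inv_cancel:
  assumes "nc_invertible S"
  shows "nc_inv S \<odot> S = nc_const id_blinfun" "S \<odot> nc_inv S = nc_const id_blinfun"
  using assms nc_inv_unique unfolding nc_invertible_def nc_inverse_of_def by metis+

lemma length_snd_splits: "p \<in> splits \<alpha> \<Longrightarrow> length (snd p) \<le> length \<alpha>"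
  by (auto simp: splits_def)

text \<open>The recursion is the equation \<open>S R = I\<close> solved for the coefficient of \<open>R\<close> at \<open>i # \<alpha>\<close>,
  given the inverse \<open>A\<close> of the constant coefficient of \<open>S\<close>.\<close>

context
  notes sum.cong [fundef_cong]
begin
function nc_rinv :: "('b::chilbert_space \<Rightarrow>\<^sub>L 'a::chilbert_space) \<Rightarrow> ('d list \<Rightarrow> 'a \<Rightarrow>\<^sub>L 'b) \<Rightarrow> 'd list \<Rightarrow> 'b \<Rightarrow>\<^sub>L 'a" where
  "nc_rinv A S [] = A"
| "nc_rinv A S (i # \<alpha>) = - (A o\<^sub>L (\<Sum>p\<in>splits \<alpha>. S (i # fst p) o\<^sub>L nc_rinv A S (snd p)))"
  by pat_completeness auto
termination
  by (relation "Wellfounded.measure (\<lambda>(A, S, \<alpha>). length \<alpha>)") (auto simp: less_Suc_eq_le dest: length_snd_splits)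
end

lemma nc_rinv:
  fixes S :: "'d list \<Rightarrow> 'a::chilbert_space \<Rightarrow>\<^sub>L 'b::chilbert_space"
  assumes "S [] o\<^sub>L A = id_blinfun"
  shows "S \<odot> nc_rinv A S = nc_const id_blinfun"
proof
  fix \<alpha>
  show "(S \<odot> nc_rinv A S) \<alpha> = nc_const id_blinfun \<alpha>"
  proof (cases \<alpha>)
    case Nil
    thus ?thesis by (simp add: nc_mult_Nil assms nc_const_def)
  next
    case (Cons i \<beta>)
    have "S [] o\<^sub>L (A o\<^sub>L X) = X" for X :: "'b \<Rightarrow>\<^sub>L 'b" using assms by (metis blinfun_compose_assoc blinfun_compose_id(2))
    thus ?thesis
      unfolding Cons nc_mult_Cons by (simp add: nc_const_def blinfun_compose_distrib nc_mult_def split_def)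
  qed
qed

lemma nc_series_rinv:
  assumes "is_clinear A" "nc_series S"
  shows "nc_series (nc_rinv A S)"
proof -
  have "is_clinear (nc_rinv A S \<alpha>)" for \<alpha>
  proof (induction "length \<alpha>" arbitrary: \<alpha> rule: less_induct)
    case less
    show ?case
    proof (cases \<alpha>)
      case (Cons i \<beta>)
      have "is_clinear (nc_rinv A S (snd p))" if "p \<in> splits \<beta>" for p
        using length_snd_splits[OF that] by (intro less) (simp add: Cons)
      thus ?thesis using assms by (auto simp: Cons nc_series_def intro!: clin)
    qed (simp add: assms)
  qed
  thus ?thesis by (simp add: nc_series_def)
qed

text \<open>The right inverse \<open>R\<close> of \<open>S\<close> again has an invertible constant coefficient, so it has a right
  inverse itself; by associativity that one must be \<open>S\<close>.\<close>

lemma nc_invertibleI: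
  assumes S: "nc_series S" and A: "is_clinear A" "op_inverse_of (S []) A"
  shows "nc_invertible S"
proof -
  let ?R = "nc_rinv A S"
  let ?Q = "nc_rinv (S []) ?R"
  have SR: "S \<odot> ?R = nc_const id_blinfun" by (rule nc_rinv) (use A in \<open>simp add: op_inverse_of_def\<close>)
  have RQ: "?R \<odot> ?Q = nc_const id_blinfun" by (rule nc_rinv) (use A in \<open>simp add: op_inverse_of_def\<close>)
  have "S = S \<odot> (?R \<odot> ?Q)" by (simp add: RQ)
  also have "\<dots> = ?Q" by (simp add: SR flip: nc_mult_assoc)
  finally have "nc_inverse_of S ?R"
    using SR RQ nc_series_rinv[OF A(1) S] by (simp add: nc_inverse_of_def)
  thus ?thesis by (auto simp: nc_invertible_def)
qed

lemma word_op_append: "word_op T (\<alpha> @ \<beta>) = word_op T \<alpha> o\<^sub>L word_op T \<beta>"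
  by (induction \<alpha>) (simp_all add: blinfun_compose_assoc)

lemma clinear_word_op [clin]: "(\<And>i. is_clinear (T i)) \<Longrightarrow> is_clinear (word_op T \<alpha>)"
  by (induction \<alpha>) (auto intro: clin)

lemma nc_resolvent_eq:
  fixes T :: "'d::finite \<Rightarrow> 'a::chilbert_space \<Rightarrow>\<^sub>L 'a"
  assumes T: "\<And>i. is_clinear (T i)"
  shows "nc_resolvent T = word_op T"
  unfolding nc_resolvent_def
proof (rule nc_inv_unique)
  let ?Q = "nc_const id_blinfun - nc_Z \<odot> nc_const (col T)"
  have "vec_proj i o\<^sub>L col T = T i" for i by (rule blinfun_eqI) simp
  hence Q: "?Q \<alpha> = (case \<alpha> of [] \<Rightarrow> id_blinfun | [i] \<Rightarrow> - T i | _ \<Rightarrow> 0)" for \<alpha>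
    unfolding nc_mult_const_right by (simp add: nc_const_def nc_Z_def blinfun_compose_distrib split: list.split)
  have Q1: "(\<lambda>\<beta>. ?Q (i # \<beta>)) = nc_const (- T i)" for i
    unfolding Q by (auto simp: nc_const_def fun_eq_iff split: list.split)
  have Q2: "(\<lambda>\<beta>. ?Q (\<beta> @ [i])) = nc_const (- T i)" for i
    unfolding Q by (auto simp: nc_const_def fun_eq_iff split: list.split)
  show "nc_inverse_of ?Q (word_op T)"
    unfolding nc_inverse_of_def
  proof (intro conjI ext)
    show "nc_series (word_op T)" by (auto simp: nc_series_def intro: clin T)
    show "(?Q \<odot> word_op T) \<alpha> = nc_const id_blinfun \<alpha>" for \<alpha>
    proof (cases \<alpha>)
      case Nil thus ?thesis unfolding Nil nc_mult_Nil Q by (simp add: nc_const_def)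
    next
      case (Cons i \<beta>) thus ?thesis
        unfolding Cons nc_mult_Cons Q1 unfolding Q unfolding nc_mult_const_left
        by (simp add: nc_mult_const_left nc_const_def blinfun_compose_distrib)
    qed
    show "(word_op T \<odot> ?Q) \<alpha> = nc_const id_blinfun \<alpha>" for \<alpha>
    proof (cases \<alpha> rule: rev_cases)
      case Nil thus ?thesis unfolding Nil nc_mult_Nil Q by (simp add: nc_const_def)
    next
      case (snoc \<beta> i) thus ?thesis
        unfolding snoc nc_mult_snoc Q2 unfolding Q unfolding nc_mult_const_right
        by (simp add: nc_mult_const_right nc_const_def blinfun_compose_distrib word_op_append)
    qed
  qed
qed

lemma nc_Z_Nil: "nc_Z [] = 0"
  by (simp add: nc_Z_def)

lemma nc_Z_snoc: "(\<lambda>\<gamma>. nc_Z (\<gamma> @ [j])) = nc_const (vec_proj j)"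
  by (auto simp: nc_Z_def nc_const_def fun_eq_iff append_eq_Cons_conv split: list.split)

lemma nc_transfer_Nil: "nc_transfer T C B D [] = D"
  by (simp add: nc_transfer_def nc_mult_Nil nc_const_def nc_Z_def blinfun_compose_distrib)

lemma nc_transfer_snoc:
  assumes T: "\<And>i. is_clinear (T i)"
  shows "nc_transfer T C B D (\<alpha> @ [j]) = C o\<^sub>L word_op T \<alpha> o\<^sub>L vec_proj j o\<^sub>L B"
proof -
  have "nc_const D (\<alpha> @ [j]) = 0" by (simp add: nc_const_def)
  thus ?thesis
    by (simp add: nc_transfer_def nc_mult_const_right nc_mult_snoc nc_resolvent_eq[OF T]
        nc_mult_const_left nc_Z_Nil nc_Z_snoc blinfun_compose_distrib)
qed

lemma nc_series_transfer:
  assumes "\<And>i. is_clinear (T i)" "is_clinear C" "is_clinear B" "is_clinear D"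
  shows "nc_series (nc_transfer T C B D)"
proof -
  have "is_clinear (nc_transfer T C B D \<alpha>)" for \<alpha>
    by (cases \<alpha> rule: rev_cases)
      (auto simp: nc_transfer_Nil nc_transfer_snoc[OF assms(1)] intro!: clin assms)
  thus ?thesis by (simp add: nc_series_def)
qed

section \<open>Polynomials in the Fock space\<close>

text \<open>The adjoint of right multiplication by \<open>z\<^sub>j\<close>.  Right
  multiplications commute with multiplication by a series from the left, so backward shifts commute
  with the adjoints of multipliers.\<close>

lift_definition bshift :: "'d \<Rightarrow> ('d, 'a::chilbert_space) fock \<Rightarrow> ('d, 'a) fock" is
  "\<lambda>j f \<alpha>. f (\<alpha> @ [j])"
proof -
  fix j :: 'd and f :: "'d list \<Rightarrow> 'a"
  assume f: "(\<lambda>\<alpha>. (norm (f \<alpha>))\<^sup>2) summable_on UNIV"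
  hence "(\<lambda>\<alpha>. (norm (f \<alpha>))\<^sup>2) summable_on range (\<lambda>\<alpha>. \<alpha> @ [j])"
    by (rule summable_on_subset_banach) simp
  thus "(\<lambda>\<alpha>. (norm (f (\<alpha> @ [j])))\<^sup>2) summable_on UNIV"
    by (subst (asm) summable_on_reindex) (auto simp: inj_on_def comp_def)
qed

lemma UNIV_words: "(UNIV :: 'd list set) = insert [] ((\<lambda>p. snd p @ [fst p]) ` UNIV)"
proof -
  have "\<alpha> = [] \<or> \<alpha> \<in> (\<lambda>p. snd p @ [fst p]) ` UNIV" for \<alpha> :: "'d list"
    by (cases \<alpha> rule: rev_cases) (auto simp: image_iff)
  thus ?thesis by auto
qed

text \<open>A word is empty or ends in a unique letter.\<close>

lemma inner_fock_decomp:
  fixes f g :: "('d::finite, 'a::chilbert_space) fock"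
  shows "inner f g = inner (fock_coeff f []) (fock_coeff g []) + (\<Sum>j\<in>UNIV. inner (bshift j f) (bshift j g))"
proof -
  let ?h = "\<lambda>\<alpha>. inner (fock_coeff f \<alpha>) (fock_coeff g \<alpha>)"
  let ?R = "(\<lambda>p :: 'd \<times> 'd list. snd p @ [fst p]) ` UNIV"
  have s: "?h summable_on ?R"
    by (rule summable_on_subset_banach[OF fock_summable_inner]) simp
  have inj: "inj_on (\<lambda>p :: 'd \<times> 'd list. snd p @ [fst p]) UNIV" by (auto simp: inj_on_def)
  have s': "(\<lambda>p. ?h (snd p @ [fst p])) summable_on UNIV"
    using s by (subst (asm) summable_on_reindex[OF inj]) (simp add: comp_def)
  have "inner f g = infsum ?h (insert [] ?R)"
    unfolding inner_fock_def by (subst UNIV_words[symmetric]) simp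
  also have "\<dots> = infsum ?h {[]} + infsum ?h ?R"
    by (subst infsum_Un_disjoint[symmetric]) (auto intro: s)
  also have "infsum ?h ?R = infsum (\<lambda>p. ?h (snd p @ [fst p])) (UNIV \<times> UNIV)"
    by (subst infsum_reindex[OF inj]) (simp add: comp_def)
  also have "\<dots> = infsum (\<lambda>j. infsum (\<lambda>\<alpha>. ?h (\<alpha> @ [j])) UNIV) UNIV"
    using infsum_Sigma'_banach[of "\<lambda>j \<alpha>. ?h (\<alpha> @ [j])" UNIV "\<lambda>_. UNIV"] s'
    by (simp add: split_def)
  also have "\<dots> = (\<Sum>j\<in>UNIV. inner (bshift j f) (bshift j g))"
    by (simp add: inner_fock_def bshift.rep_eq)
  finally show ?thesis by simp
qed

lemma norm_fock_decomp:
  fixes f :: "('d::finite, 'a::chilbert_space) fock"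
  shows "(norm f)\<^sup>2 = (norm (fock_coeff f []))\<^sup>2 + (\<Sum>j\<in>UNIV. (norm (bshift j f))\<^sup>2)"
  using inner_fock_decomp[of f f] by (simp add: power2_norm_eq_inner)

definition words :: "nat \<Rightarrow> 'd list set" where
  "words n = {\<alpha>. length \<alpha> < n}"

lemma finite_words [simp]: "finite (words n :: 'd::finite list set)"
  using finite_lists_length_le[of "UNIV :: 'd set" n]
  by (rule finite_subset[rotated]) (auto simp: words_def)

definition poly_below :: "nat \<Rightarrow> ('d, 'a::chilbert_space) fock \<Rightarrow> bool" where
  "poly_below n f \<longleftrightarrow> (\<forall>\<alpha>. n \<le> length \<alpha> \<longrightarrow> fock_coeff f \<alpha> = 0)"

lemma mem_words [simp]: "\<alpha> \<in> words n \<longleftrightarrow> length \<alpha> < n"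
  by (simp add: words_def)

lemma poly_belowD: "poly_below n f \<Longrightarrow> n \<le> length \<alpha> \<Longrightarrow> fock_coeff f \<alpha> = 0"
  by (simp add: poly_below_def)

lemma poly_below_nonzero: "poly_below n f \<Longrightarrow> fock_coeff f \<alpha> \<noteq> 0 \<Longrightarrow> length \<alpha> < n"
  using poly_belowD not_less by blast

definition polynomial :: "('d, 'a::chilbert_space) fock \<Rightarrow> bool" where
  "polynomial f \<longleftrightarrow> (\<exists>n. poly_below n f)"

lemma poly_below_mono: "poly_below n f \<Longrightarrow> n \<le> m \<Longrightarrow> poly_below m f"
  by (auto simp: poly_below_def)

lemma polynomial_common_bound:
  assumes "polynomial f" "polynomial g"
  obtains n where "poly_below n f" "poly_below n g"
proof -
  obtain m k where "poly_below m f" "poly_below k g" using assms by (auto simp: polynomial_def)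
  thus ?thesis using that[of "max m k"] poly_below_mono by (metis max.cobounded1 max.cobounded2)
qed

lemma poly_below_bshift: "poly_below (Suc n) f \<Longrightarrow> poly_below n (bshift j f)"
  by (auto simp: poly_below_def bshift.rep_eq)

lemma polynomial_bshift: "polynomial f \<Longrightarrow> polynomial (bshift j f)"
  unfolding polynomial_def by (meson poly_below_bshift poly_below_mono le_SucI order_refl)

lemma polynomial_add: "polynomial f \<Longrightarrow> polynomial g \<Longrightarrow> polynomial (f + g)"
proof (erule (1) polynomial_common_bound)
  fix n assume "poly_below n f" "poly_below n g"
  hence "poly_below n (f + g)" by (simp add: poly_below_def plus_fock.rep_eq)
  thus "polynomial (f + g)" unfolding polynomial_def by blast
qed

lemma polynomial_scaleC: "polynomial f \<Longrightarrow> polynomial (c *\<^sub>C f)"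
proof -
  have "poly_below n f \<Longrightarrow> poly_below n (c *\<^sub>C f)" for n by (simp add: poly_below_def scaleC_fock.rep_eq)
  thus "polynomial f \<Longrightarrow> polynomial (c *\<^sub>C f)" unfolding polynomial_def by blast
qed

lemma polynomial_zero: "polynomial 0"
  by (auto simp: polynomial_def poly_below_def zero_fock.rep_eq)

text \<open>Induction on the degree, in the form in which identities telescope along backward shifts.\<close>

lemma polynomial_induct [consumes 1, case_names zero bshift]:
  assumes "polynomial f" "Pr 0"
    and "\<And>f. polynomial f \<Longrightarrow> (\<And>j. polynomial (bshift j f)) \<Longrightarrow> (\<And>j. Pr (bshift j f)) \<Longrightarrow> Pr f"
  shows "Pr f"
proof -
  have "Pr f" if "poly_below n f" for n f
    using that
  proof (induction n arbitrary: f)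
    case 0
    hence "f = 0" by (auto simp: poly_below_def fock_eq_iff zero_fock.rep_eq)
    thus ?case using assms(2) by simp
  next
    case (Suc n)
    have p: "polynomial f" unfolding polynomial_def by (rule exI[of _ "Suc n"]) fact
    have "Pr (bshift j f)" for j
      by (rule Suc.IH[OF poly_below_bshift[OF Suc.prems]])
    thus ?case by (rule assms(3)[OF p polynomial_bshift[OF p]])
  qed
  thus ?thesis using assms(1) by (auto simp: polynomial_def)
qed

definition coeff_sum :: "('d list \<Rightarrow> 'a::chilbert_space \<Rightarrow> 'b::comm_monoid_add) \<Rightarrow> ('d, 'a) fock \<Rightarrow> 'b" where
  "coeff_sum L f = (\<Sum>\<alpha> | fock_coeff f \<alpha> \<noteq> 0. L \<alpha> (fock_coeff f \<alpha>))"

lemma coeff_sum_words: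
  fixes f :: "('d::finite, 'a::chilbert_space) fock"
  assumes "poly_below n f" "\<And>\<alpha>. L \<alpha> 0 = 0"
  shows "coeff_sum L f = (\<Sum>\<alpha>\<in>words n. L \<alpha> (fock_coeff f \<alpha>))"
  unfolding coeff_sum_def
  by (rule sum.mono_neutral_left) (use assms in \<open>auto dest: poly_below_nonzero\<close>)

lemma sum_words_Suc:
  "(\<Sum>\<alpha>\<in>words (Suc n). h \<alpha>) = h [] + (\<Sum>j\<in>(UNIV::'d::finite set). \<Sum>\<alpha>\<in>words n. h (\<alpha> @ [j]))"
proof -
  have "(words (Suc n) :: 'd list set) = insert [] ((\<lambda>p. snd p @ [fst p]) ` (UNIV \<times> words n))"
  proof -
    have 1: "\<alpha> \<in> insert [] ((\<lambda>p. snd p @ [fst p]) ` (UNIV \<times> words n))" if "\<alpha> \<in> words (Suc n)" for \<alpha> :: "'d list"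
      using that by (cases \<alpha> rule: rev_cases) (auto simp: image_iff)
    have 2: "insert [] ((\<lambda>p. snd p @ [fst p]) ` (UNIV \<times> words n)) \<subseteq> (words (Suc n) :: 'd list set)"
      by auto
    show ?thesis by (rule equalityI[OF subsetI 2]) (rule 1)
  qed
  hence "(\<Sum>\<alpha>\<in>words (Suc n). h \<alpha>) = h [] + (\<Sum>p\<in>UNIV \<times> words n. h (snd p @ [fst p]))"
    by (simp add: sum.reindex inj_on_def prod_eq_iff image_iff)
  thus ?thesis by (simp add: sum.cartesian_product split_def)
qed

lemma coeff_sum_decomp:
  fixes f :: "('d::finite, 'a::chilbert_space) fock"
  assumes "polynomial f" "\<And>\<alpha>. L \<alpha> 0 = 0"
  shows "coeff_sum L f = L [] (fock_coeff f []) + (\<Sum>j\<in>UNIV. coeff_sum (\<lambda>\<alpha>. L (\<alpha> @ [j])) (bshift j f))"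
proof -
  obtain n where n: "poly_below n f" using assms(1) by (auto simp: polynomial_def)
  hence n': "poly_below (Suc n) f" by (rule poly_below_mono) simp
  show ?thesis
    by (simp add: coeff_sum_words[OF n'] coeff_sum_words[OF poly_below_bshift[OF n']] assms(2)
        sum_words_Suc bshift.rep_eq)
qed

lemma coeff_sum_zero: "coeff_sum L 0 = 0"
  by (simp add: coeff_sum_def zero_fock.rep_eq)

lemma finite_support_fock:
  assumes "finite {\<alpha>. h \<alpha> \<noteq> 0}"
  shows "fock_coeff (Abs_fock h) = h"
proof (rule Abs_fock_inverse, rule CollectI)
  have "(\<lambda>\<alpha>. (norm (h \<alpha>))\<^sup>2) summable_on {\<alpha>. h \<alpha> \<noteq> 0}" using assms by simp
  thus "(\<lambda>\<alpha>. (norm (h \<alpha>))\<^sup>2) summable_on UNIV"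
    by (rule summable_on_cong_neutral[THEN iffD1, rotated -1]) auto
qed

definition trunc :: "nat \<Rightarrow> ('d list \<Rightarrow> 'a::chilbert_space) \<Rightarrow> ('d, 'a) fock" where
  "trunc n v = Abs_fock (\<lambda>\<alpha>. if length \<alpha> < n then v \<alpha> else 0)"

lemma fock_coeff_trunc:
  fixes v :: "'d::finite list \<Rightarrow> 'a::chilbert_space"
  shows "fock_coeff (trunc n v) = (\<lambda>\<alpha>. if length \<alpha> < n then v \<alpha> else 0)"
  unfolding trunc_def
  by (rule finite_support_fock, rule finite_subset[OF _ finite_words[of n]]) (auto simp: words_def)

lemma poly_below_trunc: "poly_below n (trunc n (v :: 'd::finite list \<Rightarrow> 'a::chilbert_space))"
  by (simp add: poly_below_def fock_coeff_trunc)

text \<open>Pairing of an arbitrary formal series with a polynomial; it extends the inner product of the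
  Fock space and tests equality of formal series.\<close>

definition fpair :: "('d list \<Rightarrow> 'a::chilbert_space) \<Rightarrow> ('d, 'a) fock \<Rightarrow> real" where
  "fpair v = coeff_sum (\<lambda>\<alpha>. inner (v \<alpha>))"

lemma fpair_words:
  fixes f :: "('d::finite, 'a::chilbert_space) fock"
  shows "poly_below n f \<Longrightarrow> fpair v f = (\<Sum>\<alpha>\<in>words n. inner (v \<alpha>) (fock_coeff f \<alpha>))"
  unfolding fpair_def by (rule coeff_sum_words) auto

lemma fpair_fock:
  fixes f :: "('d::finite, 'a::chilbert_space) fock"
  assumes "polynomial f"
  shows "fpair (fock_coeff g) f = inner g f"
proof -
  obtain n where n: "poly_below n f" using assms by (auto simp: polynomial_def)
  have "inner g f = infsum (\<lambda>\<alpha>. inner (fock_coeff g \<alpha>) (fock_coeff f \<alpha>)) (words n)"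
    unfolding inner_fock_def
    by (rule infsum_cong_neutral) (auto simp: poly_belowD[OF n])
  thus ?thesis by (simp add: fpair_words[OF n])
qed

lemma fpair_ext:
  fixes v w :: "'d::finite list \<Rightarrow> 'a::chilbert_space"
  assumes "\<And>f. polynomial f \<Longrightarrow> fpair v f = fpair w f"
  shows "v = w"
proof
  fix \<alpha>
  have "inner y (v \<alpha>) = inner y (w \<alpha>)" for y
  proof -
    define f where "f = trunc (Suc (length \<alpha>)) (\<lambda>\<beta>. if \<beta> = \<alpha> then y else 0)"
    have f: "poly_below (Suc (length \<alpha>)) f" unfolding f_def by (rule poly_below_trunc)
    have "inner (u \<beta>) (fock_coeff f \<beta>) = (if \<beta> = \<alpha> then inner y (u \<alpha>) else 0)" for u :: "'d list \<Rightarrow> 'a" and \<beta>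
      by (simp add: f_def fock_coeff_trunc inner_commute)
    moreover have "\<alpha> \<in> words (Suc (length \<alpha>))" by (simp add: words_def)
    ultimately have "fpair u f = inner y (u \<alpha>)" for u
      by (simp add: fpair_words[OF f])
    thus ?thesis using assms[of f] f by (auto simp: polynomial_def)
  qed
  thus "v \<alpha> = w \<alpha>" by (rule inner_eqI_right)
qed

lemma fock_eqI_polynomial:
  fixes g h :: "('d::finite, 'a::chilbert_space) fock"
  assumes "\<And>f. polynomial f \<Longrightarrow> inner g f = inner h f"
  shows "g = h"
  using fpair_ext[of "fock_coeff g" "fock_coeff h"] assms by (simp add: fpair_fock fock_coeff_inject)

text \<open>Testing against the truncations of \<open>v\<close> itself bounds the partial sums of \<open>\<Sum>\<parallel>v\<^sub>\<alpha>\<parallel>\<^sup>2\<close>.\<close>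

lemma fock_of_bounded:
  fixes v :: "'d::finite list \<Rightarrow> 'a::chilbert_space"
  assumes K: "\<And>f. polynomial f \<Longrightarrow> fpair v f \<le> K * norm f" "0 \<le> K"
  obtains g where "fock_coeff g = v" "norm g \<le> K"
proof -
  have le: "(\<Sum>\<alpha>\<in>words n. (norm (v \<alpha>))\<^sup>2) \<le> K\<^sup>2" for n
  proof -
    define f where "f = trunc n v"
    have f: "poly_below n f" unfolding f_def by (rule poly_below_trunc)
    have c: "\<alpha> \<in> words n \<Longrightarrow> fock_coeff f \<alpha> = v \<alpha>" for \<alpha> by (simp add: f_def fock_coeff_trunc words_def)
    have p: "polynomial f" using f by (auto simp: polynomial_def)
    have e1: "fpair v f = (\<Sum>\<alpha>\<in>words n. (norm (v \<alpha>))\<^sup>2)"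
      unfolding fpair_words[OF f] power2_norm_eq_inner by (rule sum.cong) (auto simp: c)
    have e2: "(norm f)\<^sup>2 = (\<Sum>\<alpha>\<in>words n. (norm (v \<alpha>))\<^sup>2)"
      unfolding power2_norm_eq_inner fpair_fock[OF p, symmetric] fpair_words[OF f] by (rule sum.cong) (auto simp: c)
    have "norm f * norm f \<le> K * norm f" using K(1)[OF p] e1 e2 by (simp add: power2_eq_square)
    hence "norm f \<le> K" using K(2) by (cases "norm f = 0") auto
    thus ?thesis using e2 by (metis norm_ge_zero power_mono)
  qed
  have fin: "(\<Sum>\<alpha>\<in>F. (norm (v \<alpha>))\<^sup>2) \<le> K\<^sup>2" if "finite F" for F
  proof -
    have "F \<subseteq> words (Suc (Max (insert 0 (length ` F))))"
      using that by (auto simp: words_def less_Suc_eq_le intro!: Max_ge)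
    hence "(\<Sum>\<alpha>\<in>F. (norm (v \<alpha>))\<^sup>2) \<le> (\<Sum>\<alpha>\<in>words (Suc (Max (insert 0 (length ` F)))). (norm (v \<alpha>))\<^sup>2)"
      by (intro sum_mono2) auto
    thus ?thesis using le order_trans by blast
  qed
  have summ: "(\<lambda>\<alpha>. (norm (v \<alpha>))\<^sup>2) summable_on UNIV"
    by (rule nonneg_bdd_above_summable_on) (auto intro!: bdd_aboveI2[where M = "K\<^sup>2"] fin)
  define g where "g = Abs_fock v"
  have g: "fock_coeff g = v" unfolding g_def using summ by (simp add: Abs_fock_inverse)
  have "(norm g)\<^sup>2 \<le> K\<^sup>2"
    unfolding norm_fock_sq g by (rule infsum_le_finite_sums[OF summ fin])
  thus ?thesis using that[of g] g K(2) power2_le_imp_le by blast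
qed

text \<open>The formal adjoint of multiplication by \<open>S\<close>.  The sum is finite when \<open>f\<close> is a polynomial,
  whether or not \<open>S\<close> is a bounded multiplier.\<close>

definition series_adj :: "('d list \<Rightarrow> 'a::chilbert_space \<Rightarrow>\<^sub>L 'b::chilbert_space) \<Rightarrow> ('d, 'b) fock \<Rightarrow> ('d, 'a) fock" where
  "series_adj S f = Abs_fock (\<lambda>\<gamma>. \<Sum>\<beta> | fock_coeff f (\<beta> @ \<gamma>) \<noteq> 0. op_adj (S \<beta>) (fock_coeff f (\<beta> @ \<gamma>)))"

lemma fock_coeff_series_adj:
  fixes f :: "('d::finite, 'b::chilbert_space) fock"
  assumes f: "poly_below n f"
  shows "fock_coeff (series_adj S f) \<gamma> = (\<Sum>\<beta>\<in>words n. op_adj (S \<beta>) (fock_coeff f (\<beta> @ \<gamma>)))"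
proof -
  let ?h = "\<lambda>\<gamma>. \<Sum>\<beta> | fock_coeff f (\<beta> @ \<gamma>) \<noteq> 0. op_adj (S \<beta>) (fock_coeff f (\<beta> @ \<gamma>))"
  have h: "?h \<gamma> = (\<Sum>\<beta>\<in>words n. op_adj (S \<beta>) (fock_coeff f (\<beta> @ \<gamma>)))" for \<gamma>
    by (rule sum.mono_neutral_left) (use f in \<open>auto dest: poly_below_nonzero\<close>)
  have "?h \<gamma> = 0" if "n \<le> length \<gamma>" for \<gamma>
    unfolding h using f that by (intro sum.neutral) (auto simp: poly_below_def)
  hence "{\<gamma>. ?h \<gamma> \<noteq> 0} \<subseteq> words n" unfolding words_def using not_less by blast
  hence "finite {\<gamma>. ?h \<gamma> \<noteq> 0}" by (rule finite_subset) simp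
  thus ?thesis unfolding series_adj_def h[symmetric] by (subst finite_support_fock) auto
qed

lemma poly_below_series_adj:
  fixes f :: "('d::finite, 'b::chilbert_space) fock"
  assumes f: "poly_below n f"
  shows "poly_below n (series_adj S f)"
  using f unfolding poly_below_def[of n "series_adj S f"] fock_coeff_series_adj[OF f]
  by (auto simp: poly_below_def intro!: sum.neutral)

lemma polynomial_series_adj:
  fixes f :: "('d::finite, 'b::chilbert_space) fock"
  shows "polynomial f \<Longrightarrow> polynomial (series_adj S f)"
  unfolding polynomial_def using poly_below_series_adj by blast

lemma bshift_series_adj:
  fixes f :: "('d::finite, 'b::chilbert_space) fock"
  assumes "polynomial f"
  shows "bshift j (series_adj S f) = series_adj S (bshift j f)"
proof -
  obtain n where "poly_below n f" using assms by (auto simp: polynomial_def)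
  hence n: "poly_below (Suc n) f" by (rule poly_below_mono) simp
  have n': "poly_below (Suc n) (bshift j f)" using poly_below_bshift[OF n] by (rule poly_below_mono) simp
  show ?thesis
    by (simp add: fock_eq_iff bshift.rep_eq fock_coeff_series_adj[OF n] fock_coeff_series_adj[OF n'])
qed

lemma series_adj_Nil:
  fixes f :: "('d::finite, 'b::chilbert_space) fock"
  assumes "polynomial f"
  shows "fock_coeff (series_adj S f) [] = coeff_sum (\<lambda>\<beta>. op_adj (S \<beta>)) f"
proof -
  obtain n where n: "poly_below n f" using assms by (auto simp: polynomial_def)
  show ?thesis by (simp add: fock_coeff_series_adj[OF n] coeff_sum_words[OF n])
qed

lemma series_adj_add:
  fixes f :: "('d::finite, 'b::chilbert_space) fock"
  assumes "polynomial f" "polynomial g"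
  shows "series_adj S (f + g) = series_adj S f + series_adj S g"
proof -
  obtain n where n: "poly_below n f" "poly_below n g" by (rule polynomial_common_bound[OF assms])
  hence "poly_below n (f + g)" by (simp add: poly_below_def plus_fock.rep_eq)
  with n show ?thesis
    by (simp add: fock_eq_iff fock_coeff_series_adj plus_fock.rep_eq blinfun.add_right sum.distrib)
qed

lemma series_adj_scaleC:
  fixes f :: "('d::finite, 'b::chilbert_space) fock"
  assumes f: "polynomial f" and S: "nc_series S"
  shows "series_adj S (c *\<^sub>C f) = c *\<^sub>C series_adj S f"
proof -
  obtain n where n: "poly_below n f" using f by (auto simp: polynomial_def)
  hence n': "poly_below n (c *\<^sub>C f)" by (simp add: poly_below_def scaleC_fock.rep_eq)
  have "is_clinear (op_adj (S \<beta>))" for \<beta> using S by (auto simp: nc_series_def intro: clin)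
  thus ?thesis
    by (simp add: fock_eq_iff fock_coeff_series_adj[OF n] fock_coeff_series_adj[OF n']
        scaleC_fock.rep_eq scaleC_sum is_clinearD)
qed

text \<open>Both sides are the sum of \<open>inner (S\<^sub>\<beta> u\<^sub>\<gamma>) f\<^sub>\<beta>\<^sub>\<gamma>\<close> over all pairs \<open>(\<beta>, \<gamma>)\<close>.\<close>

lemma fpair_nc_apply:
  fixes f :: "('d::finite, 'b::chilbert_space) fock"
  assumes f: "polynomial f" and S: "nc_series S"
  shows "fpair (S \<odot>\<^sub>v u) f = fpair u (series_adj S f)"
proof -
  obtain n where n: "poly_below n f" using f by (auto simp: polynomial_def)
  have "fpair (S \<odot>\<^sub>v u) f = (\<Sum>\<alpha>\<in>words n. \<Sum>p\<in>splits \<alpha>. inner (S (fst p) (u (snd p))) (fock_coeff f \<alpha>))"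
    by (simp add: fpair_words[OF n] nc_apply_def split_def inner_sum_left)
  also have "\<dots> = (\<Sum>q\<in>Sigma (words n) splits. inner (S (fst (snd q)) (u (snd (snd q)))) (fock_coeff f (fst q)))"
    by (subst sum.Sigma) (auto simp: finite_splits split_def)
  also have "\<dots> = (\<Sum>p | length (fst p) + length (snd p) < n. inner (S (snd p) (u (fst p))) (fock_coeff f (snd p @ fst p)))"
    by (rule sum.reindex_bij_witness[of _ "\<lambda>p. (snd p @ fst p, snd p, fst p)" "\<lambda>q. (snd (snd q), fst (snd q))"])
      (auto simp: words_def splits_def)
  also have "\<dots> = (\<Sum>p\<in>words n \<times> words n. inner (S (snd p) (u (fst p))) (fock_coeff f (snd p @ fst p)))"
    by (rule sum.mono_neutral_left) (auto simp: poly_belowD[OF n])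
  also have "\<dots> = (\<Sum>\<gamma>\<in>words n. \<Sum>\<beta>\<in>words n. inner (S \<beta> (u \<gamma>)) (fock_coeff f (\<beta> @ \<gamma>)))"
    by (simp add: sum.cartesian_product split_def)
  also have "\<dots> = fpair u (series_adj S f)"
    using S by (simp add: fpair_words[OF poly_below_series_adj[OF n]] fock_coeff_series_adj[OF n]
        inner_sum_right inner_op_adj nc_series_def)
  finally show ?thesis .
qed

lemma series_adj_mult:
  fixes f :: "('d::finite, 'b::chilbert_space) fock"
  assumes f: "polynomial f" and S: "nc_series S" "nc_series R"
  shows "series_adj (S \<odot> R) f = series_adj R (series_adj S f)"
proof (rule inner_eqI_right)
  fix u
  show "inner u (series_adj (S \<odot> R) f) = inner u (series_adj R (series_adj S f))"
    using f S by (simp add: polynomial_series_adj nc_series_mult nc_apply_assoc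
        flip: fpair_fock fpair_nc_apply)
qed

text \<open>A series is recovered from its action on constants, which the formal adjoint determines by
  duality.\<close>

lemma series_adj_inject:
  fixes S R :: "'d::finite list \<Rightarrow> 'a::chilbert_space \<Rightarrow>\<^sub>L 'b::chilbert_space"
  assumes S: "nc_series S" "nc_series R"
    and eq: "\<And>f. polynomial f \<Longrightarrow> series_adj S f = series_adj R f"
  shows "S = R"
proof (intro ext blinfun_eqI)
  fix \<alpha> x
  have "S \<odot>\<^sub>v nc_const x = R \<odot>\<^sub>v nc_const x"
    by (rule fpair_ext) (simp add: fpair_nc_apply S eq)
  thus "S \<alpha> x = R \<alpha> x" by (simp add: nc_apply_const_right fun_eq_iff)
qed

lemma series_adj_const:
  fixes f :: "('d::finite, 'b::chilbert_space) fock"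
  assumes f: "polynomial f" and A: "is_clinear A"
  shows "fock_coeff (series_adj (nc_const A) f) \<gamma> = op_adj A (fock_coeff f \<gamma>)"
proof -
  obtain n where n0: "poly_below n f" using f by (auto simp: polynomial_def)
  have n: "poly_below (Suc n) f" using n0 by (rule poly_below_mono) simp
  have "op_adj (nc_const A \<beta>) y = (if \<beta> = [] then op_adj A y else 0)" for \<beta> :: "'d list" and y
    by (simp add: nc_const_def)
  thus ?thesis by (simp add: fock_coeff_series_adj[OF n])
qed

lemma series_adj_zero [simp]: "series_adj S 0 = 0"
  by (simp add: series_adj_def fock_eq_iff zero_fock.rep_eq finite_support_fock)

lemma series_adj_uminus_series:
  fixes f :: "('d::finite, 'b::chilbert_space) fock"
  assumes f: "polynomial f" and S: "nc_series S"
  shows "series_adj (\<lambda>\<alpha>. - S \<alpha>) f = - series_adj S f"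
proof -
  obtain n where n: "poly_below n f" using f by (auto simp: polynomial_def)
  have "op_adj (- S \<beta>) = - op_adj (S \<beta>)" for \<beta> using S by (intro op_adj_uminus) (simp add: nc_series_def)
  thus ?thesis
    by (simp add: fock_eq_iff fock_coeff_series_adj[OF n] uminus_fock.rep_eq blinfun.minus_left sum_negf)
qed

section \<open>Multipliers and de Branges--Rovnyak spaces\<close>

lemma bshift_add: "bshift j (f + g) = bshift j f + bshift j g"
  by (simp add: fock_eq_iff bshift.rep_eq plus_fock.rep_eq)

lemma bshift_scaleC: "bshift j (c *\<^sub>C f) = c *\<^sub>C bshift j f"
  by (simp add: fock_eq_iff bshift.rep_eq scaleC_fock.rep_eq)

lemma fock_eqI_bshift:
  assumes "fock_coeff f [] = fock_coeff g []" "\<And>j. bshift j f = bshift j g"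
  shows "f = g"
  unfolding fock_eq_iff
proof
  show "fock_coeff f \<alpha> = fock_coeff g \<alpha>" for \<alpha>
    by (cases \<alpha> rule: rev_cases) (use assms in \<open>auto simp: bshift.rep_eq fun_eq_iff fock_eq_iff\<close>)
qed

lemma schur_class_nc_series [clin]: "schur_class S \<Longrightarrow> nc_series S"
  by (simp add: schur_class_def)

lemma norm_mult_op:
  assumes "schur_class S"
  shows "norm (mult_op S u) \<le> norm u"
proof -
  obtain v where "fock_coeff v = S \<odot>\<^sub>v fock_coeff u" "norm v \<le> norm u"
    using assms by (auto simp: schur_class_def)
  moreover from this have "mult_op S u = v"
    using fock_coeff_mult_op[OF assms, of u] by (metis fock_coeff_inject)
  ultimately show ?thesis by simp
qed

lemma mult_op_clinear [clin]:
  assumes "schur_class S"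
  shows "is_clinear (mult_op S)"
  using schur_class_nc_series[OF assms]
  by (simp add: is_clinear_def fock_eq_iff fock_coeff_mult_op[OF assms] scaleC_fock.rep_eq
      nc_apply_def split_def scaleC_sum nc_series_def)

lemma op_adj_mult_op:
  fixes S :: "'d::finite list \<Rightarrow> 'u::chilbert_space \<Rightarrow>\<^sub>L 'y::chilbert_space"
  assumes S: "schur_class S" and f: "polynomial f"
  shows "op_adj (mult_op S) f = series_adj S f"
proof (rule inner_eqI_right)
  fix u
  have "inner u (op_adj (mult_op S) f) = fpair (S \<odot>\<^sub>v fock_coeff u) f"
    using S f by (simp add: inner_op_adj mult_op_clinear fpair_fock flip: fock_coeff_mult_op)
  also have "\<dots> = inner u (series_adj S f)"
    using S f by (simp add: fpair_nc_apply schur_class_nc_series fpair_fock polynomial_series_adj)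
  finally show "inner u (op_adj (mult_op S) f) = inner u (series_adj S f)" .
qed

text \<open>Contractivity may be checked on the formal adjoint: it bounds the pairing of \<open>S u\<close> with
  polynomials by \<open>\<parallel>u\<parallel>\<close>.\<close>

lemma schur_classI:
  fixes S :: "'d::finite list \<Rightarrow> 'u::chilbert_space \<Rightarrow>\<^sub>L 'y::chilbert_space"
  assumes S: "nc_series S" and le: "\<And>f. polynomial f \<Longrightarrow> norm (series_adj S f) \<le> norm f"
  shows "schur_class S"
  unfolding schur_class_def
proof (intro conjI allI S)
  fix u :: "('d, 'u) fock"
  have "fpair (S \<odot>\<^sub>v fock_coeff u) f \<le> norm u * norm f" if f: "polynomial f" for f
  proof -
    have "fpair (S \<odot>\<^sub>v fock_coeff u) f = inner u (series_adj S f)"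
      using S f by (simp add: fpair_nc_apply fpair_fock polynomial_series_adj)
    also have "\<dots> \<le> norm u * norm (series_adj S f)" by (rule norm_cauchy_schwarz)
    also have "\<dots> \<le> norm u * norm f" using le[OF f] by (intro mult_left_mono) auto
    finally show ?thesis .
  qed
  thus "\<exists>v. fock_coeff v = S \<odot>\<^sub>v fock_coeff u \<and> norm v \<le> norm u"
    using fock_of_bounded[of "S \<odot>\<^sub>v fock_coeff u" "norm u"] by (metis norm_ge_zero)
qed

lemma norm_op_adj_le:
  assumes A: "is_clinear A" and le: "\<And>x. norm (A x) \<le> norm x"
  shows "norm (op_adj A y) \<le> norm y"
proof -
  have "(norm (op_adj A y))\<^sup>2 = inner (A (op_adj A y)) y"
    by (simp add: power2_norm_eq_inner inner_op_adj[OF A])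
  also have "\<dots> \<le> norm (A (op_adj A y)) * norm y" by (rule norm_cauchy_schwarz)
  also have "\<dots> \<le> norm (op_adj A y) * norm y" by (intro mult_right_mono le) simp
  finally show ?thesis by (cases "norm (op_adj A y) = 0") (auto simp: power2_eq_square)
qed

lemma op_pos_defect:
  assumes "is_clinear A" "\<And>x. norm (A x) \<le> norm x"
  shows "op_pos (id_blinfun - (A o\<^sub>L op_adj A))"
  unfolding op_pos_iff
proof (intro conjI allI)
  show "is_clinear (id_blinfun - (A o\<^sub>L op_adj A))" by (intro clin assms)
  show "inner ((id_blinfun - (A o\<^sub>L op_adj A)) x) y = inner x ((id_blinfun - (A o\<^sub>L op_adj A)) y)" for x y
    by (simp add: blinfun.diff_left inner_simps inner_op_adj[OF assms(1), symmetric]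
        inner_op_adj_left[OF assms(1), symmetric])
  have "(norm (op_adj A x))\<^sup>2 \<le> (norm x)\<^sup>2" for x
    by (intro power_mono norm_op_adj_le assms) simp
  thus "0 \<le> inner ((id_blinfun - (A o\<^sub>L op_adj A)) x) x" for x
    by (simp add: blinfun.diff_left inner_simps inner_op_adj[OF assms(1), symmetric] power2_norm_eq_inner)
qed

lemma dbr_op_pos: "schur_class S \<Longrightarrow> op_pos (dbr_op S)"
  unfolding dbr_op_def by (intro op_sqrt op_pos_defect mult_op_clinear norm_mult_op)

lemma dbr_op_sq:
  assumes "schur_class S"
  shows "dbr_op S (dbr_op S f) = f - mult_op S (op_adj (mult_op S) f)"
  unfolding dbr_op_def
  by (subst op_sqrt(2)) (simp_all add: op_pos_defect mult_op_clinear norm_mult_op assms blinfun.diff_left)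

lemma inner_dbr_op: "schur_class S \<Longrightarrow> inner (dbr_op S f) g = inner f (dbr_op S g)"
  by (intro op_pos_symmetric dbr_op_pos)

lemma norm_dbr_op:
  assumes "schur_class S"
  shows "(norm (dbr_op S f))\<^sup>2 = (norm f)\<^sup>2 - (norm (op_adj (mult_op S) f))\<^sup>2"
  using inner_dbr_op[OF assms, of f "dbr_op S f"]
  by (simp add: power2_norm_eq_inner dbr_op_sq[OF assms] inner_simps
      inner_op_adj_left mult_op_clinear[OF assms])

lemma csubspace_op_ker: "is_clinear A \<Longrightarrow> csubspace (op_ker A)"
  by (auto simp: csubspace_def op_ker_def blinfun.add_right is_clinearD)

lemma closed_op_ker: "closed (op_ker A)"
  unfolding op_ker_def by (intro closed_Collect_eq continuous_intros)

lemma orth_proj_eqI: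
  assumes M: "csubspace M" and y: "y \<in> M" "\<And>m. m \<in> M \<Longrightarrow> inner (x - y) m = 0"
  shows "orth_proj M x = y"
  unfolding orth_proj_def
proof (rule the_equality)
  show "y \<in> M \<and> (\<forall>m\<in>M. cinner (x - y) m = 0)" using orthogonal_cinner_eq_0[OF M y(2)] y(1) by blast
  fix z assume z: "z \<in> M \<and> (\<forall>m\<in>M. cinner (x - z) m = 0)"
  have d: "y - z \<in> M" using csubspace_imp_subspace[OF M] y(1) z by (blast intro: subspace_diff)
  hence "Re (cinner (x - z) (y - z)) = 0" using z by simp
  hence "inner (x - z) (y - z) = 0" by (simp only: Re_cinner)
  hence "inner (y - z) (y - z) = 0" using y(2)[OF d] by (simp add: inner_simps)
  thus "z = y" by simp
qed

text \<open>The preimages of an element of \<open>\<H>(S)\<close> differ by elements of the kernel, so the lift is the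
  preimage orthogonal to the kernel.\<close>

lemma dbr_lift_eq:
  assumes S: "schur_class S" and g: "\<And>m. dbr_op S m = 0 \<Longrightarrow> inner g m = 0"
  shows "dbr_lift S (fock_coeff (dbr_op S g)) = g"
proof -
  define h where "h = (SOME h. fock_coeff (dbr_op S h) = fock_coeff (dbr_op S g))"
  have "fock_coeff (dbr_op S h) = fock_coeff (dbr_op S g)" unfolding h_def by (rule someI) (rule refl)
  hence "dbr_op S (h - g) = 0" by (simp add: fock_coeff_inject blinfun.diff_right)
  hence "orth_proj (op_ker (dbr_op S)) h = h - g"
    by (intro orth_proj_eqI csubspace_op_ker op_pos_clinear dbr_op_pos S) (auto simp: op_ker_def g)
  thus ?thesis unfolding dbr_lift_def Let_def h_def[symmetric] by simp
qed

lemma dbr_cases: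
  assumes "f \<in> dbr S"
  obtains g where "f = fock_coeff (dbr_op S g)" "\<And>m. dbr_op S m = 0 \<Longrightarrow> inner g m = 0"
proof -
  obtain h where h: "f = fock_coeff (dbr_op S h)" using assms by (auto simp: dbr_def)
  have "subspace (op_ker (dbr_op S))"
    by (auto simp: subspace_def op_ker_def blinfun.add_right blinfun.scaleR_right)
  then obtain k where k: "k \<in> op_ker (dbr_op S)" "\<And>m. m \<in> op_ker (dbr_op S) \<Longrightarrow> inner (h - k) m = 0"
    using projection_exists[OF _ closed_op_ker, of "dbr_op S" h] by blast
  show ?thesis
    by (rule that[of "h - k"]) (use h k in \<open>auto simp: op_ker_def blinfun.diff_right\<close>)
qed

section \<open>A factorization theorem of Leech type\<close>

lemma csubspace_polynomial_relation:
  fixes F :: "('d, 'a::chilbert_space) fock \<Rightarrow> 'b::chilbert_space"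
  assumes "\<And>f g. polynomial f \<Longrightarrow> polynomial g \<Longrightarrow> F (f + g) = F f + F g"
    and "\<And>c f. polynomial f \<Longrightarrow> F (c *\<^sub>C f) = c *\<^sub>C F f"
  shows "csubspace (F ` Collect polynomial)"
proof -
  have "F 0 = 0" using assms(1)[OF polynomial_zero polynomial_zero] by simp
  hence "0 \<in> F ` Collect polynomial" by (metis imageI mem_Collect_eq polynomial_zero)
  moreover have "F f + F g \<in> F ` Collect polynomial" if "polynomial f" "polynomial g" for f g
    using that polynomial_add by (metis assms(1) imageI mem_Collect_eq)
  moreover have "c *\<^sub>C F f \<in> F ` Collect polynomial" if "polynomial f" for f c
    using that polynomial_scaleC by (metis assms(2) imageI mem_Collect_eq)
  ultimately show ?thesis unfolding csubspace_def by blast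
qed

lemma isometric_closure:
  fixes \<Gamma> :: "('a::chilbert_space \<times> 'b::chilbert_space) set"
  assumes "\<And>p. p \<in> \<Gamma> \<Longrightarrow> norm (fst p) = norm (snd p)" "p \<in> closure \<Gamma>"
  shows "norm (fst p) = norm (snd p)"
proof -
  have "closed {p :: 'a \<times> 'b. norm (fst p) = norm (snd p)}"
    by (intro closed_Collect_eq continuous_intros)
  moreover have "\<Gamma> \<subseteq> {p. norm (fst p) = norm (snd p)}" using assms(1) by blast
  ultimately show ?thesis using closure_minimal assms(2) by blast
qed

lemma norm_vec_sq: "(norm (v :: 'a::chilbert_space ^ 'd))\<^sup>2 = (\<Sum>j\<in>UNIV. (norm (v $ j))\<^sup>2)"
  by (simp add: power2_norm_eq_inner inner_vec_def)

lemma norm_prod_sq: "(norm (p :: 'a::chilbert_space \<times> 'b::chilbert_space))\<^sup>2 = (norm (fst p))\<^sup>2 + (norm (snd p))\<^sup>2"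
  by (simp add: power2_norm_eq_inner inner_prod_def)

definition inj_op :: "'d::finite \<Rightarrow> 'a::chilbert_space \<Rightarrow>\<^sub>L ('a ^ 'd)" where
  "inj_op j = col (\<lambda>k. if k = j then id_blinfun else 0)"

lemma clinear_inj_op [clin]: "is_clinear (inj_op j)"
  unfolding inj_op_def by (intro clinear_col) (auto intro: clin)

lemma sum_inj_op: "(\<Sum>j\<in>UNIV. inj_op j (v $ j)) = v"
proof (subst vec_eq_iff, intro allI)
  fix k
  have "(\<Sum>j\<in>UNIV. inj_op j (v $ j)) $ k = (\<Sum>j\<in>UNIV. if k = j then v $ j else 0)"
    unfolding inj_op_def sum_component by (intro sum.cong) auto
  thus "(\<Sum>j\<in>UNIV. inj_op j (v $ j)) $ k = v $ k" by simp
qed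

lemma coeff_sum_compose:
  "coeff_sum (\<lambda>\<alpha>. blinfun_apply (A o\<^sub>L L \<alpha>)) f = A (coeff_sum (\<lambda>\<alpha>. L \<alpha>) f)"
  by (simp add: coeff_sum_def blinfun.sum_right)

text \<open>The hypothesis says \<open>u u\<^sup>* - v v\<^sup>* = \<Delta>\<^sup>* \<Delta>\<close> on polynomials.  Splitting off constant
  coefficients, it turns into
    \<open>\<Sum>\<^sub>j \<parallel>\<Delta> f\<^sub>j\<parallel>\<^sup>2 + \<parallel>(u\<^sup>* f)\<^sub>\<emptyset>\<parallel>\<^sup>2 = \<parallel>\<Delta> f\<parallel>\<^sup>2 + \<parallel>(v\<^sup>* f)\<^sub>\<emptyset>\<parallel>\<^sup>2\<close>
  with \<open>f\<^sub>j\<close> the backward shifts of \<open>f\<close>, so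
  \<open>((\<Delta> f\<^sub>j)\<^sub>j, (u\<^sup>* f)\<^sub>\<emptyset>) \<mapsto> (\<Delta> f, (v\<^sup>* f)\<^sub>\<emptyset>)\<close> is an isometry (the lurking isometry).  Its
  contractive extension \<open>W\<close> is the adjoint of a colligation, and \<open>\<E>\<close> is the transfer function
  of that colligation: contractivity of \<open>W\<close> makes \<open>\<E>\<close> Schur, and running the colligation on
  \<open>u\<^sup>* f\<close> reproduces the states \<open>\<Delta> f\<close> and the outputs \<open>v\<^sup>* f\<close>, so \<open>\<E>\<^sup>* u\<^sup>* = v\<^sup>*\<close>.\<close>

lemma leech_factorization:
  fixes u :: "'d::finite list \<Rightarrow> 'f::chilbert_space \<Rightarrow>\<^sub>L 'y::chilbert_space"
    and v :: "'d list \<Rightarrow> 'u::chilbert_space \<Rightarrow>\<^sub>L 'y"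
    and \<Delta> :: "('d, 'y) fock \<Rightarrow>\<^sub>L 'l::chilbert_space"
  assumes u: "nc_series u" and v: "nc_series v" and \<Delta>: "is_clinear \<Delta>"
    and eq: "\<And>f. polynomial f \<Longrightarrow>
      (norm (series_adj u f))\<^sup>2 - (norm (series_adj v f))\<^sup>2 = (norm (\<Delta> f))\<^sup>2"
  obtains \<E> where "schur_class \<E>" "u \<odot> \<E> = v"
proof -
  define L where "L f = ((\<chi> j. \<Delta> (bshift j f)), fock_coeff (series_adj u f) [])" for f
  define R where "R f = (\<Delta> f, fock_coeff (series_adj v f) [])" for f
  define \<Gamma> where "\<Gamma> = closure ((\<lambda>f. (L f, R f)) ` Collect polynomial)"
  have "csubspace ((\<lambda>f. (L f, R f)) ` Collect polynomial)"
  proof (rule csubspace_polynomial_relation)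
    fix f g :: "('d, 'y) fock" and c assume fg: "polynomial f" 
    show "(L (c *\<^sub>C f), R (c *\<^sub>C f)) = c *\<^sub>C (L f, R f)"
      using fg by (simp add: L_def R_def series_adj_scaleC u v bshift_scaleC is_clinearD[OF \<Delta>]
          scaleC_fock.rep_eq scaleC_prod_def scaleC_vec_def)
    assume "polynomial g"
    thus "(L (f + g), R (f + g)) = (L f, R f) + (L g, R g)"
      using fg by (simp add: L_def R_def series_adj_add bshift_add blinfun.add_right plus_fock.rep_eq vec_eq_iff)
  qed
  hence \<Gamma>: "csubspace \<Gamma>" "closed \<Gamma>" by (simp_all add: \<Gamma>_def csubspace_closure)
  have iso0: "norm (L f) = norm (R f)" if f: "polynomial f" for f
  proof -
    have "(norm (L f))\<^sup>2 = (\<Sum>j\<in>UNIV. (norm (\<Delta> (bshift j f)))\<^sup>2) + (norm (fock_coeff (series_adj u f) []))\<^sup>2"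
      by (simp add: L_def norm_prod_sq norm_vec_sq)
    also have "(\<Sum>j\<in>UNIV. (norm (\<Delta> (bshift j f)))\<^sup>2) =
        (\<Sum>j\<in>UNIV. (norm (bshift j (series_adj u f)))\<^sup>2) - (\<Sum>j\<in>UNIV. (norm (bshift j (series_adj v f)))\<^sup>2)"
      using f by (simp add: bshift_series_adj eq[OF polynomial_bshift[OF f], symmetric] sum_subtractf)
    also have "\<dots> + (norm (fock_coeff (series_adj u f) []))\<^sup>2 =
        (norm (series_adj u f))\<^sup>2 - (norm (series_adj v f))\<^sup>2 + (norm (fock_coeff (series_adj v f) []))\<^sup>2"
      using norm_fock_decomp[of "series_adj u f"] norm_fock_decomp[of "series_adj v f"] by linarith
    also have "\<dots> = (norm (R f))\<^sup>2"
      by (simp add: R_def norm_prod_sq eq[OF f])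
    finally show ?thesis by simp
  qed
  have iso: "norm (fst p) = norm (snd p)" if "p \<in> \<Gamma>" for p
    by (rule isometric_closure[OF _ that[unfolded \<Gamma>_def]]) (auto simp: iso0)
  obtain W :: "(('l ^ 'd) \<times> 'f) \<Rightarrow>\<^sub>L ('l \<times> 'u)" where W: "is_clinear W" "\<And>x. norm (W x) \<le> norm x"
    "\<And>p. p \<in> \<Gamma> \<Longrightarrow> W (fst p) = snd p"
    using isometric_relation_extension[OF \<Gamma> iso] by blast
  have WL: "W (L f) = R f" if "polynomial f" for f
  proof -
    have "(L f, R f) \<in> \<Gamma>" unfolding \<Gamma>_def by (rule subsetD[OF closure_subset]) (use that in simp)
    from W(3)[OF this] show ?thesis unfolding fst_conv snd_conv .
  qed
  \<comment> \<open>The blocks of \<open>W\<close>: state and output maps, with the state input split by letters.\<close>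
  define a where "a j = fst_blinfun o\<^sub>L W o\<^sub>L inl_op o\<^sub>L inj_op j" for j
  define b where "b = fst_blinfun o\<^sub>L W o\<^sub>L inr_op"
  define c where "c j = snd_blinfun o\<^sub>L W o\<^sub>L inl_op o\<^sub>L inj_op j" for j
  define d where "d = snd_blinfun o\<^sub>L W o\<^sub>L inr_op"
  have W_split: "W (l, y) = ((\<Sum>j\<in>UNIV. a j (l $ j)) + b y, (\<Sum>j\<in>UNIV. c j (l $ j)) + d y)" for l y
  proof -
    have "(l, y) = inl_op (\<Sum>j\<in>UNIV. inj_op j (l $ j)) + inr_op y" by (simp add: sum_inj_op)
    hence "W (l, y) = (\<Sum>j\<in>UNIV. W (inl_op (inj_op j (l $ j)))) + W (inr_op y)"
      by (simp only: blinfun.add_right blinfun.sum_right)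
    thus ?thesis
      by (simp add: a_def b_def c_def d_def prod_eq_iff fst_sum snd_sum del: inl_op_apply inr_op_apply)
  qed
  \<comment> \<open>\<open>X \<alpha>\<close> is the state and \<open>Ea \<alpha>\<close> the output produced by an input at the word \<open>\<alpha>\<close>; backward
    shifts consume a word from its end, hence the reversals.\<close>
  define X where "X \<alpha> = word_op a (rev \<alpha>) o\<^sub>L b" for \<alpha>
  define Ea where "Ea \<alpha> = (case rev \<alpha> of [] \<Rightarrow> d | j # \<beta> \<Rightarrow> c j o\<^sub>L word_op a \<beta> o\<^sub>L b)" for \<alpha>
  have X: "X [] = b" "X (\<alpha> @ [j]) = a j o\<^sub>L X \<alpha>" for \<alpha> j by (simp_all add: X_def blinfun_compose_assoc)
  have Ea: "Ea [] = d" "Ea (\<alpha> @ [j]) = c j o\<^sub>L X \<alpha>" for \<alpha> j by (simp_all add: Ea_def X_def blinfun_compose_assoc)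
  have Ea_clin: "is_clinear (Ea \<alpha>)" for \<alpha>
    unfolding Ea_def a_def b_def c_def d_def
    by (auto split: list.split intro!: clin W(1))
  define \<E> where "\<E> \<alpha> = op_adj (Ea \<alpha>)" for \<alpha>
  have \<E>: "nc_series \<E>" "op_adj (\<E> \<alpha>) = Ea \<alpha>" for \<alpha>
    using Ea_clin by (simp_all add: \<E>_def nc_series_def op_adj_clinear)
  \<comment> \<open>The state reached after processing all of \<open>g\<close>.\<close>
  define st where "st g = coeff_sum (\<lambda>\<alpha>. X \<alpha>) g" for g
  have step: "(st g, fock_coeff (series_adj \<E> g) []) = W ((\<chi> j. st (bshift j g)), fock_coeff g [])"
    if g: "polynomial g" for g
  proof -
    have "st g = b (fock_coeff g []) + (\<Sum>j\<in>UNIV. a j (st (bshift j g)))"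
      unfolding st_def by (subst coeff_sum_decomp[OF g]) (simp_all add: X coeff_sum_compose)
    moreover have "fock_coeff (series_adj \<E> g) [] = d (fock_coeff g []) + (\<Sum>j\<in>UNIV. c j (st (bshift j g)))"
      unfolding series_adj_Nil[OF g] st_def \<E>
      by (subst coeff_sum_decomp[OF g]) (simp_all add: Ea coeff_sum_compose)
    ultimately show ?thesis by (simp add: W_split add.commute)
  qed
  have contr: "(norm (st g))\<^sup>2 + (norm (series_adj \<E> g))\<^sup>2 \<le> (norm g)\<^sup>2" if "polynomial g" for g
    using that
  proof (induction g rule: polynomial_induct)
    case zero
    show ?case by (simp add: st_def coeff_sum_zero)
  next
    case (bshift g)
    have "(norm (st g))\<^sup>2 + (norm (fock_coeff (series_adj \<E> g) []))\<^sup>2 =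
        (norm (W ((\<chi> j. st (bshift j g)), fock_coeff g [])))\<^sup>2"
      unfolding step[OF bshift(1), symmetric] by (simp add: norm_prod_sq)
    also have "\<dots> \<le> (norm ((\<chi> j. st (bshift j g)), fock_coeff g []))\<^sup>2"
      by (intro power_mono W) simp
    also have "\<dots> = (\<Sum>j\<in>UNIV. (norm (st (bshift j g)))\<^sup>2) + (norm (fock_coeff g []))\<^sup>2"
      by (simp add: norm_prod_sq norm_vec_sq)
    also have "\<dots> \<le> (\<Sum>j\<in>UNIV. (norm (bshift j g))\<^sup>2 - (norm (bshift j (series_adj \<E> g)))\<^sup>2) + (norm (fock_coeff g []))\<^sup>2"
      using bshift(3) by (intro add_right_mono sum_mono) (simp add: bshift_series_adj[OF bshift(1)] algebra_simps)
    finally show ?case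
      by (simp add: norm_fock_decomp[of g] norm_fock_decomp[of "series_adj \<E> g"] sum_subtractf)
  qed
  have st: "st (series_adj u f) = \<Delta> f \<and> series_adj \<E> (series_adj u f) = series_adj v f" if "polynomial f" for f
    using that
  proof (induction f rule: polynomial_induct)
    case zero
    show ?case by (simp add: st_def coeff_sum_zero)
  next
    case (bshift f)
    have p: "polynomial (series_adj u f)" by (rule polynomial_series_adj) fact
    have "(st (series_adj u f), fock_coeff (series_adj \<E> (series_adj u f)) []) = W (L f)"
      using bshift by (simp add: step[OF p] L_def bshift_series_adj)
    also have "\<dots> = R f" by (rule WL) fact
    finally have 1: "st (series_adj u f) = \<Delta> f"
      and 2: "fock_coeff (series_adj \<E> (series_adj u f)) [] = fock_coeff (series_adj v f) []"
      by (simp_all add: R_def)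
    have "series_adj \<E> (series_adj u f) = series_adj v f"
    proof (rule fock_eqI_bshift)
      show "bshift j (series_adj \<E> (series_adj u f)) = bshift j (series_adj v f)" for j
        using bshift(3)[of j] by (simp add: bshift_series_adj p bshift(1))
    qed (rule 2)
    with 1 show ?case ..
  qed
  show ?thesis
  proof (rule that)
    have "norm (series_adj \<E> g) \<le> norm g" if "polynomial g" for g
    proof (rule power2_le_imp_le)
      show "(norm (series_adj \<E> g))\<^sup>2 \<le> (norm g)\<^sup>2"
        using contr[OF that] zero_le_power2[of "norm (st g)"] by linarith
    qed simp
    thus "schur_class \<E>" by (intro schur_classI \<E>)
    show "u \<odot> \<E> = v"
      by (rule series_adj_inject) (auto intro: clin u v \<E> simp: series_adj_mult u \<E> st)
  qed
qed

section \<open>Observability operators and the kernel identity\<close>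

lemma obs_op_clinear [clin]:
  assumes "output_stable E T" "is_clinear E" "\<And>i. is_clinear (T i)"
  shows "is_clinear (obs_op E T)"
  using assms clinear_word_op[of T]
  by (simp add: is_clinear_def fock_eq_iff fock_coeff_obs_op obs_series_def scaleC_fock.rep_eq)

lemma bshift_obs_op:
  assumes "output_stable E T"
  shows "bshift j (obs_op E T x) = obs_op E T (T j x)"
  by (simp add: fock_eq_iff bshift.rep_eq fock_coeff_obs_op[OF assms] obs_series_def word_op_append)

lemma inner_coeff_sum_obs:
  assumes "is_clinear C" "\<And>i. is_clinear (T i)"
  shows "inner x (coeff_sum (\<lambda>\<alpha>. op_adj (C o\<^sub>L word_op T \<alpha>)) p) = fpair (obs_series C T x) p"
  using assms by (simp add: fpair_def coeff_sum_def obs_series_def inner_sum_right inner_op_adj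
      clinear_compose clinear_word_op)

lemma op_adj_col2:
  assumes "is_clinear A" "is_clinear B"
  shows "op_adj (col2 A B) p = op_adj A (fst p) + op_adj B (snd p)"
  by (rule inner_eqI_right) (simp add: assms inner_op_adj clinear_col2 inner_prod_def inner_add_right)

lemma op_adj_col:
  fixes T :: "'d::finite \<Rightarrow> 'a::chilbert_space \<Rightarrow>\<^sub>L 'b::chilbert_space"
  assumes "\<And>i. is_clinear (T i)"
  shows "op_adj (col T) v = (\<Sum>j\<in>UNIV. op_adj (T j) (v $ j))"
  by (rule inner_eqI_right) (simp add: assms inner_op_adj clinear_col inner_vec_def inner_sum_right)

lemma op_adj_vec_components:
  assumes "is_clinear B"
  shows "op_adj B v = (\<Sum>j\<in>UNIV. op_adj (vec_proj j o\<^sub>L B) (v $ j))"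
  by (rule inner_eqI_right)
    (simp add: assms inner_op_adj clinear_compose clinear_vec_proj inner_vec_def inner_sum_right)

definition jform :: "('a::chilbert_space \<Rightarrow>\<^sub>L 'a) \<Rightarrow> ('d, 'a) fock \<Rightarrow> real" where
  "jform J = coeff_sum (\<lambda>_ x. inner (J x) x)"

lemma jform_decomp:
  fixes p :: "('d::finite, 'a::chilbert_space) fock"
  assumes "polynomial p"
  shows "jform J p = inner (J (fock_coeff p [])) (fock_coeff p []) + (\<Sum>j\<in>UNIV. jform J (bshift j p))"
  unfolding jform_def by (rule coeff_sum_decomp[OF assms]) simp

lemma jform_J_op:
  fixes p :: "('d::finite, 'a::chilbert_space \<times> 'b::chilbert_space) fock"
  assumes "polynomial p"
  shows "jform J_op p = (norm (series_adj (nc_const inl_op) p))\<^sup>2 - (norm (series_adj (nc_const inr_op) p))\<^sup>2"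
proof -
  obtain n where n: "poly_below n p" using assms by (auto simp: polynomial_def)
  have norm: "(norm q)\<^sup>2 = (\<Sum>\<alpha>\<in>words n. (norm (fock_coeff q \<alpha>))\<^sup>2)" if "poly_below n q"
    for q :: "('d, 'c::chilbert_space) fock"
  proof -
    have "polynomial q" using that unfolding polynomial_def by blast
    from fpair_fock[OF this, of q] show ?thesis
      by (simp add: fpair_words[OF that] power2_norm_eq_inner)
  qed
  show ?thesis
    unfolding jform_def norm[OF poly_below_series_adj[OF n]]
    by (subst coeff_sum_words[OF n])
      (simp_all add: J_op_def inner_prod_def series_adj_const[OF assms] clin op_adj_inl op_adj_inr
        power2_norm_eq_inner blinfun.minus_left sum_subtractf sum.distrib sum_negf)
qed

text \<open>In operator form this is \<open>\<AA> J \<AA>\<^sup>* = J' - \<O> Q \<O>\<^sup>*\<close> on polynomials, with \<open>\<O>\<close> the formal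
  observability operator of \<open>(C, T)\<close> and \<open>\<xi> = \<O>\<^sup>*\<close>.  With
  \<open>\<eta> = ((\<xi> p\<^sub>j)\<^sub>j, p\<^sub>\<emptyset>)\<close>, where \<open>p\<^sub>j\<close> are the backward shifts of \<open>p\<close>, both
  \<open>\<xi> p = [T; C]\<^sup>* \<eta>\<close> and \<open>(\<AA>\<^sup>* p)\<^sub>\<emptyset> = [B; D]\<^sup>* \<eta>\<close>.  The identity assumed for \<open>B\<close> and \<open>D\<close>,
  evaluated at \<open>\<eta>\<close>, is therefore the increment of the claim from the shifts \<open>p\<^sub>j\<close> to \<open>p\<close>.\<close>

theorem kernel_identity:
  fixes T :: "'d::finite \<Rightarrow> 'x::chilbert_space \<Rightarrow>\<^sub>L 'x"
    and B :: "'w::chilbert_space \<Rightarrow>\<^sub>L ('x ^ 'd)" and D :: "'w \<Rightarrow>\<^sub>L 'z::chilbert_space"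
  assumes T: "\<And>i. is_clinear (T i)" and C: "is_clinear C" and B: "is_clinear B" and D: "is_clinear D"
    and id: "col2 B D o\<^sub>L J o\<^sub>L op_adj (col2 B D) =
       diag2 (tensor_id Q) J' - (col2 (col T) C o\<^sub>L Q o\<^sub>L op_adj (col2 (col T) C))"
    and p: "polynomial p"
  defines "\<xi> \<equiv> coeff_sum (\<lambda>\<alpha>. op_adj (C o\<^sub>L word_op T \<alpha>))"
  shows "jform J (series_adj (nc_transfer T C B D) p) = jform J' p - inner (Q (\<xi> p)) (\<xi> p)"
  using p
proof (induction p rule: polynomial_induct)
  case zero
  show ?case by (simp add: jform_def \<xi>_def coeff_sum_zero)
next
  case (bshift p)
  let ?A = "nc_transfer T C B D"
  define \<eta> where "\<eta> = ((\<chi> j. \<xi> (bshift j p)), fock_coeff p [])"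
  have \<xi>: "\<xi> p = op_adj (col2 (col T) C) \<eta>"
  proof -
    have "op_adj (C o\<^sub>L word_op T (\<alpha> @ [j])) = op_adj (T j) o\<^sub>L op_adj (C o\<^sub>L word_op T \<alpha>)" for \<alpha> j
      by (subst op_adj_compose[symmetric])
        (simp_all add: T C clin clinear_word_op word_op_append blinfun_compose_assoc)
    thus ?thesis
      unfolding \<xi>_def by (subst coeff_sum_decomp[OF bshift(1)])
        (simp_all add: op_adj_col2 op_adj_col T C clin \<eta>_def \<xi>_def coeff_sum_compose add.commute)
  qed
  have A0: "fock_coeff (series_adj ?A p) [] = op_adj (col2 B D) \<eta>"
  proof -
    have "op_adj (?A (\<alpha> @ [j])) = op_adj (vec_proj j o\<^sub>L B) o\<^sub>L op_adj (C o\<^sub>L word_op T \<alpha>)" for \<alpha> j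
      by (subst op_adj_compose[symmetric])
        (simp_all add: T B C clin clinear_word_op nc_transfer_snoc[OF T] blinfun_compose_assoc)
    thus ?thesis
      unfolding series_adj_Nil[OF bshift(1)] by (subst coeff_sum_decomp[OF bshift(1)])
        (simp_all add: op_adj_col2 op_adj_vec_components[OF B] B D nc_transfer_Nil \<eta>_def
          \<xi>_def coeff_sum_compose add.commute)
  qed
  have adj: "inner (M (N' (op_adj M \<eta>))) \<eta> = inner (N' (op_adj M \<eta>)) (op_adj M \<eta>)" if "is_clinear M"
    for M :: "'v::chilbert_space \<Rightarrow>\<^sub>L (('x ^ 'd) \<times> 'z)" and N' :: "'v \<Rightarrow>\<^sub>L 'v"
    using that by (simp add: inner_op_adj)
  have "inner (J (fock_coeff (series_adj ?A p) [])) (fock_coeff (series_adj ?A p) []) =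
      inner ((col2 B D o\<^sub>L J o\<^sub>L op_adj (col2 B D)) \<eta>) \<eta>"
    by (simp add: A0 adj[of "col2 B D" J] clin B D del: col2_apply)
  also have "\<dots> = inner (diag2 (tensor_id Q) J' \<eta>) \<eta> - inner (Q (\<xi> p)) (\<xi> p)"
    unfolding id \<xi>
    by (simp add: blinfun.diff_left inner_diff_left adj[of "col2 (col T) C" Q] clin T C del: col2_apply diag2_apply)
  also have "inner (diag2 (tensor_id Q) J' \<eta>) \<eta> =
      (\<Sum>j\<in>UNIV. inner (Q (\<xi> (bshift j p))) (\<xi> (bshift j p))) + inner (J' (fock_coeff p [])) (fock_coeff p [])"
    by (simp add: \<eta>_def inner_prod_def inner_vec_def)
  finally show ?case
    using bshift by (simp add: jform_decomp[OF polynomial_series_adj[OF bshift(1)]] jform_decomp[OF bshift(1)]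
        bshift_series_adj sum_subtractf)
qed

section \<open>Backward shifts and adjoints of multipliers\<close>

lift_definition rmult :: "'d \<Rightarrow> ('d, 'a::chilbert_space) fock \<Rightarrow> ('d, 'a) fock" is
  "\<lambda>j f \<alpha>. if \<alpha> \<noteq> [] \<and> last \<alpha> = j then f (butlast \<alpha>) else 0"
proof -
  fix j :: 'd and f :: "'d list \<Rightarrow> 'a"
  let ?h = "\<lambda>\<alpha>. (norm (if \<alpha> \<noteq> [] \<and> last \<alpha> = j then f (butlast \<alpha>) else 0))\<^sup>2"
  assume f: "(\<lambda>\<alpha>. (norm (f \<alpha>))\<^sup>2) summable_on UNIV"
  have h1: "?h summable_on range (\<lambda>\<alpha>. \<alpha> @ [j])"
    by (subst summable_on_reindex) (auto simp: inj_on_def comp_def f)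
  have h2: "?h \<alpha> = 0" if "\<alpha> \<notin> range (\<lambda>\<alpha>. \<alpha> @ [j])" for \<alpha>
    using that by (cases \<alpha> rule: rev_cases) auto
  show "?h summable_on UNIV"
  proof (rule summable_on_cong_neutral[THEN iffD1, rotated -1])
    show "?h summable_on range (\<lambda>\<alpha>. \<alpha> @ [j])" by (rule h1)
    show "?h \<alpha> = 0" if "\<alpha> \<in> UNIV - range (\<lambda>\<alpha>. \<alpha> @ [j])" for \<alpha> using h2 that by blast
  qed auto
qed

lemma rmult_Nil: "fock_coeff (rmult j f) [] = 0"
  by (simp add: rmult.rep_eq)

lemma bshift_rmult: "bshift k (rmult j f) = (if k = j then f else 0)"
  by (auto simp: fock_eq_iff rmult.rep_eq bshift.rep_eq zero_fock.rep_eq)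

lemma inner_rmult:
  fixes f :: "('d::finite, 'a::chilbert_space) fock"
  shows "inner (rmult j f) g = inner f (bshift j g)"
proof -
  have "inner (rmult j f) g = (\<Sum>k\<in>UNIV. if k = j then inner f (bshift j g) else 0)"
    unfolding inner_fock_decomp[of "rmult j f"] bshift_rmult rmult_Nil by (simp add: if_distrib if_distribR cong: if_cong)
  thus ?thesis by simp
qed

lemma mult_op_rmult:
  assumes S: "schur_class S"
  shows "mult_op S (rmult j f) = rmult j (mult_op S f)"
proof (rule fock_eqI_bshift)
  show "fock_coeff (mult_op S (rmult j f)) [] = fock_coeff (rmult j (mult_op S f)) []"
    by (simp add: fock_coeff_mult_op[OF S] nc_apply_Nil rmult_Nil)
  fix k
  have "(\<lambda>\<gamma>. fock_coeff (rmult j f) (\<gamma> @ [k])) = fock_coeff (bshift k (rmult j f))"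
    by (simp add: bshift.rep_eq)
  hence "fock_coeff (bshift k (mult_op S (rmult j f))) = S \<odot>\<^sub>v fock_coeff (bshift k (rmult j f))"
    by (simp add: fun_eq_iff bshift.rep_eq fock_coeff_mult_op[OF S] nc_apply_snoc rmult_Nil)
  also have "\<dots> = fock_coeff (bshift k (rmult j (mult_op S f)))"
    by (simp add: bshift_rmult fock_coeff_mult_op[OF S, symmetric] zero_fock.rep_eq[abs_def, symmetric])
  finally show "bshift k (mult_op S (rmult j f)) = bshift k (rmult j (mult_op S f))"
    by (simp add: fock_coeff_inject)
qed

lemma bshift_op_adj_mult_op:
  fixes S :: "'d::finite list \<Rightarrow> 'u::chilbert_space \<Rightarrow>\<^sub>L 'y::chilbert_space"
  assumes S: "schur_class S"
  shows "bshift j (op_adj (mult_op S) g) = op_adj (mult_op S) (bshift j g)"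
proof (rule inner_eqI_right)
  fix w
  have "inner w (bshift j (op_adj (mult_op S) g)) = inner (mult_op S (rmult j w)) g"
    by (simp only: inner_rmult[symmetric] inner_op_adj[OF mult_op_clinear[OF S]])
  also have "\<dots> = inner w (op_adj (mult_op S) (bshift j g))"
    by (simp only: mult_op_rmult[OF S] inner_rmult inner_op_adj[OF mult_op_clinear[OF S]])
  finally show "inner w (bshift j (op_adj (mult_op S) g)) = inner w (op_adj (mult_op S) (bshift j g))" .
qed

lemma inner_fock_const:
  fixes g :: "('d::finite, 'a::chilbert_space) fock"
  shows "inner (fock_const w) g = inner w (fock_coeff g [])"
proof -
  have "bshift j (fock_const w) = 0" for j :: 'd
    by (simp add: fock_eq_iff bshift.rep_eq fock_const.rep_eq zero_fock.rep_eq)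
  thus ?thesis by (simp add: inner_fock_decomp[of "fock_const w" g] fock_const.rep_eq)
qed

section \<open>The interpolation data\<close>

text \<open>From now on \<open>S\<close> stands for the multiplier \<open>S\<^sub>0\<close>.\<close>

locale interpolation_data =
  fixes E :: "'x::chilbert_space \<Rightarrow>\<^sub>L 'y::chilbert_space" and T :: "'d::finite \<Rightarrow> 'x \<Rightarrow>\<^sub>L 'x"
    and S :: "'d list \<Rightarrow> 'u::chilbert_space \<Rightarrow>\<^sub>L 'y" and N :: "'x \<Rightarrow>\<^sub>L 'u" and P :: "'x \<Rightarrow>\<^sub>L 'x"
  assumes E_clinear: "is_clinear E" and T_clinear: "\<And>i. is_clinear (T i)" and stable: "output_stable E T"
    and schur: "schur_class S" and N_clinear: "is_clinear N"
    and N_adj: "op_adj N = op_adj (obs_op E T) o\<^sub>L mult_op S o\<^sub>L const_op"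
    and P_def: "P = (op_adj (obs_op E T) o\<^sub>L obs_op E T) - (op_adj (obs_op N T) o\<^sub>L obs_op N T)"
    and P_pos: "op_strictly_pos P"
begin

abbreviation "M \<equiv> mult_op S"
abbreviation "G \<equiv> dbr_op S"
abbreviation "\<O> \<equiv> obs_op E T"

lemma O_clinear: "is_clinear \<O>"
  by (intro clin stable E_clinear T_clinear)

lemma M_clinear: "is_clinear M"
  by (intro clin schur)

text \<open>The definition of \<open>N\<close> is the statement for the empty word; the backward shifts, which commute
  with \<open>M\<^sup>*\<close> and act on \<open>\<O> x\<close> through \<open>T\<close>, transport it to all words.\<close>

lemma adj_M_obs: "fock_coeff (op_adj M (\<O> x)) = obs_series N T x"
proof
  fix \<alpha>
  have const: "fock_coeff (op_adj M (\<O> x)) [] = N x" for x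
  proof (rule inner_eqI_right)
    fix w
    have "inner w (fock_coeff (op_adj M (\<O> x)) []) = inner (op_adj N w) x"
      by (simp add: inner_fock_const[symmetric] inner_op_adj M_clinear N_adj inner_op_adj_left O_clinear)
    thus "inner w (fock_coeff (op_adj M (\<O> x)) []) = inner w (N x)"
      by (simp add: inner_op_adj_left N_clinear)
  qed
  show "fock_coeff (op_adj M (\<O> x)) \<alpha> = obs_series N T x \<alpha>"
  proof (induction \<alpha> arbitrary: x rule: rev_induct)
    case Nil
    show ?case by (simp add: const obs_series_def)
  next
    case (snoc j \<alpha>)
    have "fock_coeff (op_adj M (\<O> x)) (\<alpha> @ [j]) = fock_coeff (bshift j (op_adj M (\<O> x))) \<alpha>"
      by (simp add: bshift.rep_eq)
    also have "\<dots> = fock_coeff (op_adj M (\<O> (T j x))) \<alpha>"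
      by (simp only: bshift_op_adj_mult_op[OF schur] bshift_obs_op[OF stable])
    finally show ?case by (simp add: snoc obs_series_def word_op_append)
  qed
qed

lemma N_stable: "output_stable N T"
  unfolding output_stable_def
proof (intro exI allI conjI)
  show "fock_coeff (op_adj M (\<O> x)) = obs_series N T x" for x by (rule adj_M_obs)
  show "norm (op_adj M (\<O> x)) \<le> norm \<O> * norm x" for x
    using norm_op_adj_le[OF M_clinear norm_mult_op[OF schur], of "\<O> x"] norm_blinfun[of \<O> x]
    by linarith
qed

lemma obs_N: "obs_op N T x = op_adj M (\<O> x)"
  using adj_M_obs[of x] fock_coeff_obs_op[OF N_stable, of x] by (metis fock_coeff_inject)

text \<open>\<open>V P\<^sup>-\<^sup>1\<^sup>/\<^sup>2\<close> is an isometry, and \<open>Q\<close> is the projection onto the orthogonal complement of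
  its range.\<close>

definition "V = G o\<^sub>L \<O>"
definition "Q = id_blinfun - (V o\<^sub>L op_inv P o\<^sub>L op_adj V)"

lemma V_clinear: "is_clinear V"
  unfolding V_def by (intro clin op_pos_clinear dbr_op_pos schur O_clinear)

lemma op_adj_V: "op_adj V f = op_adj \<O> (G f)"
  by (rule inner_eqI_right) (simp add: inner_op_adj V_clinear O_clinear, simp add: V_def inner_dbr_op schur)

lemma G_V: "G (V x) = \<O> x - M (obs_op N T x)"
  by (simp add: V_def dbr_op_sq schur obs_N)

lemma inner_P: "inner (P x) y = inner (\<O> x) (\<O> y) - inner (obs_op N T x) (obs_op N T y)"
proof -
  have "is_clinear (obs_op N T)" by (intro clin N_stable N_clinear T_clinear)
  thus ?thesis by (simp add: P_def blinfun.diff_left inner_diff_left inner_op_adj_left O_clinear)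
qed

lemma P_symmetric: "inner (P x) y = inner x (P y)"
  using P_pos by (auto simp: op_strictly_pos_def intro: op_pos_symmetric)

lemma P_nonneg: "0 \<le> inner (P x) x"
  using P_pos by (auto simp: op_strictly_pos_def intro: op_pos_nonneg)

lemma V_adj_V: "op_adj V (V x) = P x"
proof (rule inner_eqI_right)
  fix y
  have "inner y (op_adj V (V x)) = inner (\<O> y) (G (V x))"
    by (simp add: op_adj_V inner_op_adj O_clinear)
  also have "\<dots> = inner (\<O> y) (\<O> x) - inner (obs_op N T y) (obs_op N T x)"
    by (simp add: G_V inner_diff_right obs_N inner_op_adj_left M_clinear)
  also have "\<dots> = inner y (P x)" unfolding P_symmetric[symmetric] inner_P ..
  finally show "inner y (op_adj V (V x)) = inner y (P x)" .
qed

lemmas P_inv = op_strictly_pos_inv[OF P_pos]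

lemma Q_apply: "Q h = h - V (op_inv P (op_adj V h))"
  by (simp add: Q_def blinfun.diff_left)

lemma Q_clinear: "is_clinear Q"
  unfolding Q_def by (intro clin V_clinear op_pos_clinear P_inv)

lemma inner_Q: "inner (Q h) k = inner h (Q k)"
  by (simp add: Q_apply inner_simps inner_op_adj[OF V_clinear, symmetric] inner_op_adj_left[OF V_clinear, symmetric]
      op_pos_symmetric[OF P_inv(3)])

lemma V_adj_Q: "op_adj V (Q h) = 0"
  by (simp add: Q_apply blinfun.diff_right V_adj_V P_inv)

lemma Q_Q: "Q (Q h) = Q h"
  by (subst Q_apply) (simp add: V_adj_Q)

lemma inner_V_Q: "inner (V x) (Q h) = 0"
  by (simp add: inner_op_adj[OF V_clinear, symmetric] V_adj_Q)

lemma norm_Q: "(norm (Q h))\<^sup>2 = (norm h)\<^sup>2 - inner (op_inv P (op_adj V h)) (op_adj V h)"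
proof -
  have "(norm (Q h))\<^sup>2 = inner (Q h) h" by (simp add: power2_norm_eq_inner inner_Q Q_Q)
  thus ?thesis by (simp add: Q_apply inner_diff_left power2_norm_eq_inner inner_op_adj[OF V_clinear, symmetric])
qed

text \<open>The Stein equation of \<open>P\<close>: split off the constant coefficients of the two observability
  series.\<close>

lemma stein:
  "inner (P x) y = (\<Sum>j\<in>UNIV. inner (P (T j x)) (T j y)) + inner (E x) (E y) - inner (N x) (N y)"
  unfolding inner_P inner_fock_decomp[of "\<O> x"] inner_fock_decomp[of "obs_op N T x"]
  by (simp add: bshift_obs_op stable N_stable fock_coeff_obs_op obs_series_def sum_subtractf)

end

section \<open>The chain matrix\<close>

locale chain_matrix = interpolation_data E T S N P
  for E :: "'x::chilbert_space \<Rightarrow>\<^sub>L 'y::chilbert_space" and T :: "'d::finite \<Rightarrow> 'x \<Rightarrow>\<^sub>L 'x"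
    and S :: "'d list \<Rightarrow> 'u::chilbert_space \<Rightarrow>\<^sub>L 'y" and N :: "'x \<Rightarrow>\<^sub>L 'u" and P :: "'x \<Rightarrow>\<^sub>L 'x" +
  fixes B :: "('f::chilbert_space \<times> 'u) \<Rightarrow>\<^sub>L ('x ^ 'd)" and D :: "('f \<times> 'u) \<Rightarrow>\<^sub>L ('y \<times> 'u)"
  assumes B_clinear: "is_clinear B" and D_clinear: "is_clinear D"
    and K_inj: "inj (blinfun_apply (col2 B D))"
    and K_id: "col2 B D o\<^sub>L J_op o\<^sub>L op_adj (col2 B D) =
      diag2 (tensor_id (op_inv P)) J_op - (col2 (col T) (col2 E N) o\<^sub>L op_inv P o\<^sub>L op_adj (col2 (col T) (col2 E N)))"
begin

abbreviation "C \<equiv> col2 E N"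
abbreviation "K \<equiv> col2 B D"
abbreviation "X \<equiv> col2 (col T) C"
abbreviation "\<AA> \<equiv> nc_transfer T C B D"

lemma C_clinear: "is_clinear C"
  and K_clinear: "is_clinear K"
  and X_clinear: "is_clinear X"
  and A_series: "nc_series \<AA>"
  by (intro clin nc_series_transfer E_clinear N_clinear T_clinear B_clinear D_clinear)+

text \<open>\<open>\<Lambda>\<close> is the inverse of the diagonal operator in the identity for \<open>K = [B; D] \<close>.\<close>

definition "\<Lambda> = diag2 (tensor_id P) J_op"

lemma \<Lambda>_apply: "\<Lambda> (v, p) = ((\<chi> j. P (v $ j)), J_op p)"
  by (simp add: \<Lambda>_def)

lemma inner_\<Lambda>: "inner (\<Lambda> q) r = inner q (\<Lambda> r)"
  by (cases q, cases r) (simp add: \<Lambda>_apply J_op_apply inner_prod_def inner_vec_def P_symmetric)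

lemma X_stein: "op_adj X (\<Lambda> (X x)) = P x"
proof (rule inner_eqI_right)
  fix y
  have "inner y (op_adj X (\<Lambda> (X x))) = inner (\<Lambda> (X x)) (X y)"
    by (simp add: inner_op_adj X_clinear inner_commute del: col2_apply)
  also have "\<dots> = inner (P x) y"
    unfolding stein[of x y] by (simp add: \<Lambda>_apply J_op_apply inner_prod_def inner_vec_def)
  finally show "inner y (op_adj X (\<Lambda> (X x))) = inner y (P x)" by (simp add: inner_commute)
qed

lemma K_id_apply: "K (J_op (op_adj K (\<Lambda> q))) = q - X (op_inv P (op_adj X (\<Lambda> q)))"
proof -
  have "K (J_op (op_adj K (\<Lambda> q))) = (K o\<^sub>L J_op o\<^sub>L op_adj K) (\<Lambda> q)"
    by (simp del: col2_apply)
  also have "\<dots> = diag2 (tensor_id (op_inv P)) J_op (\<Lambda> q) - X (op_inv P (op_adj X (\<Lambda> q)))"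
    unfolding K_id by (simp add: blinfun.diff_left del: col2_apply diag2_apply)
  also have "diag2 (tensor_id (op_inv P)) J_op (\<Lambda> q) = q"
  proof -
    obtain w y z where "q = (w, y, z)" by (cases q) auto
    thus ?thesis by (simp add: \<Lambda>_apply J_op_apply P_inv vec_eq_iff)
  qed
  finally show ?thesis .
qed

text \<open>By the Stein equation \<open>K J K\<^sup>* \<Lambda> X x = X x - X P\<^sup>-\<^sup>1 P x = 0\<close>, and \<open>K\<close> is injective.\<close>

lemma K_adj_X: "op_adj K (\<Lambda> (X x)) = 0"
proof -
  have "K (J_op (op_adj K (\<Lambda> (X x)))) = K 0"
    unfolding K_id_apply X_stein by (simp add: P_inv blinfun.zero_right del: col2_apply)
  hence "J_op (op_adj K (\<Lambda> (X x))) = 0" using K_inj by (blast dest: injD)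
  thus ?thesis by (metis J_op_involutive blinfun.zero_right)
qed

text \<open>The range of \<open>K\<close> is \<open>\<Lambda>\<close>-orthogonal to that of \<open>X\<close>, so \<open>K J K\<^sup>* \<Lambda> K = K\<close>; injectivity
  of \<open>K\<close> upgrades the one-sided identity in the hypothesis to this second one.\<close>

lemma K_J_unitary: "op_adj K (\<Lambda> (K w)) = J_op w"
proof -
  have "op_adj X (\<Lambda> (K w)) = 0"
  proof (rule inner_eqI_right)
    fix x
    have "inner x (op_adj X (\<Lambda> (K w))) = inner (op_adj K (\<Lambda> (X x))) w"
      by (simp add: inner_op_adj inner_op_adj_left X_clinear K_clinear inner_\<Lambda> del: col2_apply)
    thus "inner x (op_adj X (\<Lambda> (K w))) = inner x 0" unfolding K_adj_X by simp
  qed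
  hence "K (J_op (op_adj K (\<Lambda> (K w)))) = K w"
    unfolding K_id_apply by (simp add: blinfun.zero_right del: col2_apply)
  hence "J_op (op_adj K (\<Lambda> (K w))) = w" using K_inj by (blast dest: injD)
  thus ?thesis by (metis J_op_involutive)
qed

lemma K_form: "(\<Sum>j\<in>UNIV. inner (P (B w $ j)) (B w $ j)) + inner (J_op (D w)) (D w) = inner (J_op w) w"
proof -
  have "inner (J_op w) w = inner (\<Lambda> (K w)) (K w)"
    by (simp add: K_J_unitary[symmetric] inner_op_adj_left K_clinear del: col2_apply)
  thus ?thesis by (simp add: \<Lambda>_apply inner_prod_def inner_vec_def)
qed

text \<open>The lower right corner of the identity for \<open>K\<close>:
  \<open>D\<^sub>2\<^sub>2 D\<^sub>2\<^sub>2\<^sup>* = I + D\<^sub>2\<^sub>1 D\<^sub>2\<^sub>1\<^sup>* + N P\<^sup>-\<^sup>1 N\<^sup>*\<close>.\<close>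

lemma D_adj_lower:
  "(norm y)\<^sup>2 + (norm (fst (op_adj D (0, y))))\<^sup>2 \<le> (norm (snd (op_adj D (0, y))))\<^sup>2"
proof -
  define q :: "('x ^ 'd) \<times> ('y \<times> 'u)" where "q = (0, (0, y))"
  have "op_adj K q = op_adj D (0, y)"
    by (simp add: q_def op_adj_col2 B_clinear D_clinear)
  hence "inner ((K o\<^sub>L J_op o\<^sub>L op_adj K) q) q = inner (J_op (op_adj D (0, y))) (op_adj D (0, y))"
    by (simp add: inner_op_adj[OF K_clinear, symmetric] del: col2_apply)
  moreover have "inner ((K o\<^sub>L J_op o\<^sub>L op_adj K) q) q =
      - (norm y)\<^sup>2 - inner (op_inv P (op_adj X q)) (op_adj X q)"
    unfolding K_id
    by (simp add: blinfun.diff_left inner_diff_left inner_op_adj[OF X_clinear, symmetric] del: col2_apply)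
      (simp add: q_def J_op_apply inner_prod_def power2_norm_eq_inner inner_vec_def)
  ultimately show ?thesis
    using op_pos_nonneg[OF P_inv(3), of "op_adj X q"]
    by (simp add: J_op_apply inner_prod_def power2_norm_eq_inner)
qed

lemma blk_eq:
  "blk11 \<AA> = nc_const fst_blinfun \<odot> \<AA> \<odot> nc_const inl_op"
  "blk12 \<AA> = nc_const fst_blinfun \<odot> \<AA> \<odot> nc_const inr_op"
  "blk21 \<AA> = nc_const snd_blinfun \<odot> \<AA> \<odot> nc_const inl_op"
  "blk22 \<AA> = nc_const snd_blinfun \<odot> \<AA> \<odot> nc_const inr_op"
  by (simp_all add: nc_mult_const_left nc_mult_const_right blk11_def blk12_def blk21_def blk22_def)

lemma blk_series:
  "nc_series (blk11 \<AA>)" "nc_series (blk12 \<AA>)" "nc_series (blk21 \<AA>)" "nc_series (blk22 \<AA>)"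
  unfolding blk_eq by (intro clin A_series)+

text \<open>Invertibility is decided by the constant coefficient \<open>Y = D\<^sub>2\<^sub>1 e + D\<^sub>2\<^sub>2\<close>, with \<open>e\<close> the contractive constant
  coefficient of \<open>\<E>\<close>.  If \<open>Y w = 0\<close>, then \<open>K_form\<close> at \<open>(e w, w)\<close> has a nonnegative left and a
  nonpositive right side, so \<open>K (e w, w) = 0\<close> and \<open>w = 0\<close>.  On the other side \<open>D_adj_lower\<close> bounds
  \<open>Y\<^sup>*\<close> from below.\<close>

lemma denominator_invertible:
  assumes \<E>: "schur_class \<E>"
  shows "nc_invertible (blk21 \<AA> \<odot> \<E> + blk22 \<AA>)"
proof -
  define e where "e = \<E> []"
  have e_clin: "is_clinear e" using schur_class_nc_series[OF \<E>] by (simp add: e_def nc_series_def)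
  have e: "norm (e w) \<le> norm w" for w
  proof -
    have "norm (e w) = norm (fock_coeff (mult_op \<E> (fock_const w)) [])"
      by (simp add: fock_coeff_mult_op \<E> nc_apply_Nil fock_const.rep_eq e_def)
    also have "\<dots> \<le> norm (fock_const w :: ('d, 'u) fock)"
      using norm_fock_coeff_le norm_mult_op[OF \<E>] order_trans by blast
    also have "\<dots> = norm w"
      using inner_fock_const[of w "fock_const w :: ('d, 'u) fock"]
      by (simp add: norm_eq_sqrt_inner fock_const.rep_eq)
    finally show ?thesis .
  qed
  have ser: "nc_series (blk21 \<AA> \<odot> \<E> + blk22 \<AA>)"
    by (intro nc_series_add nc_series_mult blk_series schur_class_nc_series \<E>)
  define Y where "Y = (blk21 \<AA> \<odot> \<E> + blk22 \<AA>) []"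
  have Y_clin: "is_clinear Y" using ser by (simp add: Y_def nc_series_def)
  have Y: "Y w = snd (D (e w, w))" for w
  proof -
    have "(e w, w) = inl_op (e w) + inr_op w" by simp
    hence "D (e w, w) = D (inl_op (e w)) + D (inr_op w)" by (simp only: blinfun.add_right)
    thus ?thesis
      by (simp add: Y_def nc_mult_Nil blk21_def blk22_def nc_transfer_Nil blinfun.add_left e_def)
  qed
  have Y_inj: "w = 0" if "Y w = 0" for w
  proof -
    let ?k = "(e w, w)"
    have s: "snd (D ?k) = 0" using that by (simp add: Y)
    have "(norm (e w))\<^sup>2 \<le> (norm w)\<^sup>2" using e by (intro power_mono) auto
    hence le: "(\<Sum>j\<in>UNIV. inner (P (B ?k $ j)) (B ?k $ j)) + (norm (fst (D ?k)))\<^sup>2 \<le> 0"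
      using K_form[of ?k] s by (simp add: J_op_apply inner_prod_def power2_norm_eq_inner)
    have nn: "0 \<le> (\<Sum>j\<in>UNIV. inner (P (B ?k $ j)) (B ?k $ j))" by (intro sum_nonneg P_nonneg)
    hence z: "(\<Sum>j\<in>UNIV. inner (P (B ?k $ j)) (B ?k $ j)) = 0" and "(norm (fst (D ?k)))\<^sup>2 = 0"
      using le zero_le_power2[of "norm (fst (D ?k))"] by linarith+
    hence "D ?k = 0" using s by (simp add: prod_eq_iff)
    moreover have "inner (P (B ?k $ j)) (B ?k $ j) = 0" for j
      using z by (subst (asm) sum_nonneg_eq_0_iff) (auto simp: P_nonneg)
    hence "B ?k = 0" using op_strictly_pos_inner_zero[OF P_pos] by (simp add: vec_eq_iff)
    ultimately have "K ?k = K 0" by (simp add: blinfun.zero_right flip: zero_prod_def)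
    hence "?k = 0" using K_inj by (blast dest: injD)
    thus ?thesis by (simp add: zero_prod_def)
  qed
  \<comment> \<open>With \<open>a = D\<^sub>2\<^sub>1\<^sup>* y\<close> and \<open>b = D\<^sub>2\<^sub>2\<^sup>* y\<close>: \<open>\<parallel>Y\<^sup>* y\<parallel> \<ge> \<parallel>b\<parallel> - \<parallel>a\<parallel> \<ge> \<parallel>y\<parallel>\<^sup>2 / (\<parallel>a\<parallel> + \<parallel>b\<parallel>)\<close>, and
    \<open>\<parallel>a\<parallel> + \<parallel>b\<parallel> \<le> \<parallel>y\<parallel> / c\<close>; adding 1 keeps the denominator nonzero.\<close>
  define c where "c = 1 / (2 * (norm (op_adj D) + 1))"
  have c: "0 < c" by (simp add: c_def add_nonneg_pos)
  have Y_low: "c * norm y \<le> norm (op_adj Y y)" for y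
  proof -
    define a where "a = fst (op_adj D (0, y))"
    define b where "b = snd (op_adj D (0, y))"
    have "op_adj Y y = op_adj e a + b"
    proof (rule inner_eqI_right)
      fix w
      have "inner w (op_adj Y y) = inner (D (e w, w)) (0, y)"
        by (simp add: inner_op_adj Y_clin Y inner_prod_def)
      also have "\<dots> = inner (e w, w) (op_adj D (0, y))" by (simp add: inner_op_adj D_clinear)
      also have "\<dots> = inner w (op_adj e a + b)"
        by (simp add: inner_prod_def a_def b_def inner_op_adj e_clin inner_add_right)
      finally show "inner w (op_adj Y y) = inner w (op_adj e a + b)" .
    qed
    moreover have "norm b \<le> norm (op_adj e a + b) + norm (op_adj e a)"
      by (metis add_diff_cancel_left' norm_triangle_ineq4)
    moreover have "norm (op_adj e a) \<le> norm a" by (rule norm_op_adj_le[OF e_clin e])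
    ultimately have ab: "norm b - norm a \<le> norm (op_adj Y y)" by simp
    have ineq: "(norm y)\<^sup>2 + (norm a)\<^sup>2 \<le> (norm b)\<^sup>2"
      using D_adj_lower[of y] by (simp add: a_def b_def)
    hence "(norm a)\<^sup>2 \<le> (norm b)\<^sup>2" using zero_le_power2[of "norm y"] by linarith
    hence a_le: "norm a \<le> norm b" by (rule power2_le_imp_le) simp
    have "norm b \<le> norm (op_adj D (0, y))" unfolding b_def by (metis norm_snd_le prod.collapse)
    also have "\<dots> \<le> norm (op_adj D) * norm (0 :: 'y, y)" by (rule norm_blinfun)
    also have "\<dots> \<le> (norm (op_adj D) + 1) * norm y" by (simp add: norm_Pair algebra_simps)
    finally have b_le: "norm a + norm b \<le> norm y / c" using a_le by (simp add: c_def algebra_simps)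
    have "(norm y)\<^sup>2 \<le> (norm b - norm a) * (norm a + norm b)"
      using ineq by (simp add: power2_eq_square algebra_simps)
    also have "\<dots> \<le> (norm b - norm a) * (norm y / c)" using a_le b_le by (intro mult_left_mono) auto
    also have "\<dots> \<le> norm (op_adj Y y) * (norm y / c)" using ab c by (intro mult_right_mono) auto
    finally show ?thesis
      using c by (cases "norm y = 0") (auto simp: power2_eq_square field_simps)
  qed
  obtain R where "op_inverse_of Y R" using bijective_of_adjoint_bounded_below[OF Y_clin Y_inj c Y_low] by blast
  thus ?thesis by (intro nc_invertibleI[OF ser, of R]) (auto simp: Y_def op_inverse_of_def)
qed

text \<open>\<open>r = [I, -S] \<close>, hence \<open>r \<AA> = [u, -v] \<close>.\<close>

definition "u = blk11 \<AA> - S \<odot> blk21 \<AA>"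
definition "v = S \<odot> blk22 \<AA> - blk12 \<AA>"
definition r :: "'d list \<Rightarrow> ('y \<times> 'u) \<Rightarrow>\<^sub>L 'y" where
  "r = nc_const fst_blinfun - S \<odot> nc_const snd_blinfun"

lemma S_series: "nc_series S"
  by (intro clin schur)

lemma r_series: "nc_series r"
  unfolding r_def by (intro nc_series_diff nc_series_mult nc_series_const clin S_series)

lemma u_eq: "u = r \<odot> \<AA> \<odot> nc_const inl_op"
  by (simp add: u_def r_def blk_eq nc_mult_diff_left nc_mult_assoc)

lemma v_eq: "v = (\<lambda>\<alpha>. - (r \<odot> \<AA> \<odot> nc_const inr_op) \<alpha>)"
  by (simp add: v_def r_def blk_eq nc_mult_diff_left nc_mult_assoc fun_eq_iff)

lemma u_series: "nc_series u"
  unfolding u_eq by (intro clin r_series A_series)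

lemma v_series: "nc_series v"
  unfolding v_def by (intro nc_series_diff nc_series_mult S_series blk_series)

text \<open>The state \<open>\<xi>\<close> of the kernel identity at \<open>r\<^sup>* f\<close> is \<open>\<O>\<^sup>* (I - M M\<^sup>*) f\<close>.\<close>

lemma coeff_sum_r:
  assumes f: "polynomial f"
  shows "coeff_sum (\<lambda>\<alpha>. op_adj (C o\<^sub>L word_op T \<alpha>)) (series_adj r f) = op_adj V (G f)"
proof (rule inner_eqI_right)
  fix x
  have "inner x (coeff_sum (\<lambda>\<alpha>. op_adj (C o\<^sub>L word_op T \<alpha>)) (series_adj r f)) =
      fpair (obs_series C T x) (series_adj r f)"
    by (simp add: inner_coeff_sum_obs C_clinear T_clinear)
  also have "\<dots> = fpair (r \<odot>\<^sub>v obs_series C T x) f"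
    by (simp add: fpair_nc_apply f r_series)
  also have "r \<odot>\<^sub>v obs_series C T x = fock_coeff (G (V x))"
    by (simp add: G_V minus_fock.rep_eq[abs_def] fock_coeff_mult_op schur fock_coeff_obs_op stable N_stable
        r_def nc_apply_diff_left nc_apply_assoc nc_apply_const_left obs_series_def fun_eq_iff)
  also have "fpair (fock_coeff (G (V x))) f = inner x (op_adj V (G f))"
    by (simp add: fpair_fock f inner_dbr_op schur inner_op_adj V_clinear)
  finally show "inner x (coeff_sum (\<lambda>\<alpha>. op_adj (C o\<^sub>L word_op T \<alpha>)) (series_adj r f)) = inner x (op_adj V (G f))" .
qed

text \<open>The kernel identity at \<open>p = r\<^sup>* f = (f, -S\<^sup>* f)\<close>: its form is
  \<open>\<parallel>f\<parallel>\<^sup>2 - \<parallel>S\<^sup>* f\<parallel>\<^sup>2 = \<parallel>G f\<parallel>\<^sup>2\<close>, and subtracting \<open>inner (P\<^sup>-\<^sup>1 V\<^sup>* G f) (V\<^sup>* G f)\<close> leaves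
  \<open>\<parallel>Q G f\<parallel>\<^sup>2\<close>.\<close>

lemma key_identity:
  assumes f: "polynomial f"
  shows "(norm (series_adj u f))\<^sup>2 - (norm (series_adj v f))\<^sup>2 = (norm ((Q o\<^sub>L G) f))\<^sup>2"
proof -
  let ?p = "series_adj r f"
  have p: "polynomial ?p" by (rule polynomial_series_adj[OF f])
  have blocks: "fst_blinfun o\<^sub>L inl_op = (id_blinfun :: 'y \<Rightarrow>\<^sub>L 'y)" "snd_blinfun o\<^sub>L inr_op = (id_blinfun :: 'u \<Rightarrow>\<^sub>L 'u)"
    "snd_blinfun o\<^sub>L (inl_op :: 'y \<Rightarrow>\<^sub>L ('y \<times> 'u)) = 0" "fst_blinfun o\<^sub>L (inr_op :: 'u \<Rightarrow>\<^sub>L ('y \<times> 'u)) = 0"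
    by (auto intro: blinfun_eqI)
  have "r \<odot> nc_const inl_op = nc_const id_blinfun"
    by (simp add: r_def nc_mult_diff_left nc_mult_assoc nc_mult_const_const blocks nc_const_zero nc_mult_zero_right fun_eq_iff)
  moreover have "r \<odot> nc_const inr_op = (\<lambda>\<alpha>. - S \<alpha>)"
    by (simp add: r_def nc_mult_diff_left nc_mult_assoc nc_mult_const_const blocks nc_const_zero nc_mult_zero_right fun_eq_iff)
  ultimately have "jform J_op ?p = (norm (series_adj (nc_const id_blinfun) f))\<^sup>2 - (norm (series_adj (\<lambda>\<alpha>. - S \<alpha>) f))\<^sup>2"
    by (simp add: jform_J_op[OF p] series_adj_mult[symmetric] f r_series clin)
  also have "\<dots> = (norm f)\<^sup>2 - (norm (series_adj S f))\<^sup>2"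
  proof -
    have "series_adj (nc_const id_blinfun) f = f" by (simp add: fock_eq_iff series_adj_const f clin)
    thus ?thesis by (simp add: series_adj_uminus_series f S_series)
  qed
  also have "\<dots> = (norm (G f))\<^sup>2" by (simp add: norm_dbr_op schur op_adj_mult_op f)
  finally have 1: "jform J_op ?p = (norm (G f))\<^sup>2" .
  have "(norm (series_adj u f))\<^sup>2 - (norm (series_adj v f))\<^sup>2 = jform J_op (series_adj \<AA> ?p)"
    by (simp add: jform_J_op[OF polynomial_series_adj[OF p]] u_eq v_eq series_adj_uminus_series
        series_adj_mult polynomial_series_adj f r_series A_series clin)
  also have "\<dots> = jform J_op ?p - inner (op_inv P (op_adj V (G f))) (op_adj V (G f))"
    using kernel_identity[OF T_clinear C_clinear B_clinear D_clinear K_id p] by (simp only: coeff_sum_r[OF f])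
  also have "\<dots> = (norm (Q (G f)))\<^sup>2" by (simp add: 1 norm_Q)
  finally show ?thesis by simp
qed

text \<open>Both sides say \<open>S (\<AA>\<^sub>2\<^sub>1 \<E> + \<AA>\<^sub>2\<^sub>2) = \<AA>\<^sub>1\<^sub>1 \<E> + \<AA>\<^sub>1\<^sub>2\<close>.\<close>

lemma parameter_iff:
  "S = (blk11 \<AA> \<odot> \<E> + blk12 \<AA>) \<odot> nc_inv (blk21 \<AA> \<odot> \<E> + blk22 \<AA>) \<longleftrightarrow> u \<odot> \<E> = v"
  if "nc_invertible (blk21 \<AA> \<odot> \<E> + blk22 \<AA>)"
proof -
  let ?N = "blk11 \<AA> \<odot> \<E> + blk12 \<AA>" and ?D = "blk21 \<AA> \<odot> \<E> + blk22 \<AA>"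
  have "u \<odot> \<E> = v \<longleftrightarrow> S \<odot> ?D = ?N"
    by (auto simp: u_def v_def nc_mult_diff_left nc_mult_add_right nc_mult_assoc fun_eq_iff algebra_simps)
  moreover have "S \<odot> ?D = ?N" if "S = ?N \<odot> nc_inv ?D"
  proof -
    have "(?N \<odot> nc_inv ?D) \<odot> ?D = ?N"
      using nc_inv_cancel(1)[OF \<open>nc_invertible ?D\<close>] by (simp add: nc_mult_assoc)
    thus ?thesis using that by simp
  qed
  moreover have "S = ?N \<odot> nc_inv ?D" if "S \<odot> ?D = ?N"
  proof -
    have "(S \<odot> ?D) \<odot> nc_inv ?D = S"
      using nc_inv_cancel(2)[OF \<open>nc_invertible ?D\<close>] by (simp add: nc_mult_assoc)
    thus ?thesis using that by simp
  qed
  ultimately show ?thesis by blast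
qed

lemma parameter_exists:
  "\<exists>\<E>. schur_class \<E> \<and> nc_invertible (blk21 \<AA> \<odot> \<E> + blk22 \<AA>) \<and>
     S = (blk11 \<AA> \<odot> \<E> + blk12 \<AA>) \<odot> nc_inv (blk21 \<AA> \<odot> \<E> + blk22 \<AA>)"
proof -
  have "is_clinear (Q o\<^sub>L G)" by (intro clin Q_clinear op_pos_clinear dbr_op_pos schur)
  then obtain \<E> where "schur_class \<E>" "u \<odot> \<E> = v"
    using leech_factorization[OF u_series v_series _ key_identity] by blast
  thus ?thesis using parameter_iff denominator_invertible by blast
qed

end

section \<open>Parametrization of the solutions\<close>

locale parametrized_interpolant = chain_matrix E T S N P B D
  for E :: "'x::chilbert_space \<Rightarrow>\<^sub>L 'y::chilbert_space" and T :: "'d::finite \<Rightarrow> 'x \<Rightarrow>\<^sub>L 'x"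
    and S :: "'d list \<Rightarrow> 'u::chilbert_space \<Rightarrow>\<^sub>L 'y" and N :: "'x \<Rightarrow>\<^sub>L 'u" and P :: "'x \<Rightarrow>\<^sub>L 'x"
    and B :: "('f::chilbert_space \<times> 'u) \<Rightarrow>\<^sub>L ('x ^ 'd)" and D :: "('f \<times> 'u) \<Rightarrow>\<^sub>L ('y \<times> 'u)" +
  fixes \<E> :: "'d list \<Rightarrow> 'u \<Rightarrow>\<^sub>L 'f"
  assumes \<E>_schur: "schur_class \<E>" and u_\<E>: "u \<odot> \<E> = v"
begin

abbreviation "G\<^sub>\<E> \<equiv> dbr_op \<E>"

text \<open>\<open>\<Gamma>\<close> is the graph of the isometry through which \<open>M\<^sub>u\<close> acts on lifts.  It is defined on
  polynomials only, because \<open>u\<^sup>*\<close> may be unbounded, and then closed.\<close>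

definition "\<Gamma> = closure ((\<lambda>f. (Q (G f), G\<^sub>\<E> (series_adj u f))) ` Collect polynomial)"

lemma \<Gamma>_csubspace: "csubspace \<Gamma>"
  unfolding \<Gamma>_def
proof (intro csubspace_closure csubspace_polynomial_relation)
  have "is_clinear Q" "is_clinear G" "is_clinear G\<^sub>\<E>"
    by (intro Q_clinear op_pos_clinear dbr_op_pos schur \<E>_schur)+
  thus "(Q (G (c *\<^sub>C f)), G\<^sub>\<E> (series_adj u (c *\<^sub>C f))) = c *\<^sub>C (Q (G f), G\<^sub>\<E> (series_adj u f))"
    if "polynomial f" for c f
    using that by (simp add: is_clinearD series_adj_scaleC u_series scaleC_prod_def)
qed (simp add: series_adj_add blinfun.add_right)

lemma \<Gamma>_closed: "closed \<Gamma>"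
  by (simp add: \<Gamma>_def)

lemma \<Gamma>_subspace: "subspace \<Gamma>"
  by (rule csubspace_imp_subspace[OF \<Gamma>_csubspace])

lemma \<Gamma>_poly: "polynomial f \<Longrightarrow> (Q (G f), G\<^sub>\<E> (series_adj u f)) \<in> \<Gamma>"
  unfolding \<Gamma>_def by (rule subsetD[OF closure_subset]) simp

text \<open>Since \<open>v\<^sup>* = \<E>\<^sup>* u\<^sup>*\<close>, the left side of \<open>key_identity\<close> is \<open>\<parallel>G\<^sub>\<E> u\<^sup>* f\<parallel>\<^sup>2\<close>.\<close>

lemma \<Gamma>_isometric:
  assumes "p \<in> \<Gamma>"
  shows "norm (fst p) = norm (snd p)"
proof (rule isometric_closure[OF _ assms[unfolded \<Gamma>_def]], elim imageE, simp)
  fix f :: "('d, 'y) fock" assume f: "polynomial f"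
  have "series_adj \<E> (series_adj u f) = series_adj v f"
    by (simp add: u_\<E> f u_series schur_class_nc_series \<E>_schur flip: series_adj_mult)
  hence "(norm (G\<^sub>\<E> (series_adj u f)))\<^sup>2 = (norm (series_adj u f))\<^sup>2 - (norm (series_adj v f))\<^sup>2"
    by (simp add: norm_dbr_op \<E>_schur op_adj_mult_op polynomial_series_adj f)
  also have "\<dots> = (norm (Q (G f)))\<^sup>2" using key_identity[OF f] by simp
  finally show "norm (Q (G f)) = norm (G\<^sub>\<E> (series_adj u f))" by simp
qed

text \<open>Components of \<open>\<Gamma>\<close> are lifts: \<open>Q G f = G (f - \<O> P\<^sup>-\<^sup>1 V\<^sup>* G f)\<close> lies in the range of \<open>G\<close>, so it
  is orthogonal to the kernel of \<open>G\<close>, and likewise for \<open>G\<^sub>\<E>\<close>.\<close>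

lemma \<Gamma>_ranges:
  assumes "p \<in> \<Gamma>"
  shows "Q (fst p) = fst p" and "G m = 0 \<Longrightarrow> inner (fst p) m = 0" and "G\<^sub>\<E> k = 0 \<Longrightarrow> inner (snd p) k = 0"
proof -
  have *: "p \<in> Z" if "closed Z" "\<And>f. polynomial f \<Longrightarrow> (Q (G f), G\<^sub>\<E> (series_adj u f)) \<in> Z" for Z
  proof -
    have "\<Gamma> \<subseteq> Z" unfolding \<Gamma>_def using that by (intro closure_minimal) auto
    thus ?thesis using assms by blast
  qed
  have "p \<in> {p. Q (fst p) = fst p}"
    by (rule *) (auto simp: Q_Q intro!: closed_Collect_eq continuous_intros)
  thus "Q (fst p) = fst p" by simp
  show "inner (fst p) m = 0" if m: "G m = 0"
  proof -
    have "inner (Q (G f)) m = 0" for f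
      by (simp add: Q_apply V_def inner_simps inner_dbr_op schur m)
    hence "p \<in> {p. inner (fst p) m = 0}"
      by (intro *) (auto intro!: closed_Collect_eq continuous_intros)
    thus ?thesis by simp
  qed
  show "inner (snd p) k = 0" if k: "G\<^sub>\<E> k = 0"
  proof -
    have "inner (G\<^sub>\<E> g) k = 0" for g by (simp add: inner_dbr_op \<E>_schur k)
    hence "p \<in> {p. inner (snd p) k = 0}"
      by (intro *) (auto intro!: closed_Collect_eq continuous_intros)
    thus ?thesis by simp
  qed
qed

lemmas \<Gamma>_relation = isometric_relation_projection[OF \<Gamma>_subspace \<Gamma>_closed]

lemma \<Gamma>_fst_projection: "\<exists>p\<in>\<Gamma>. \<forall>q\<in>\<Gamma>. inner (h - fst p) (fst q) = 0"
  by (rule \<Gamma>_relation(1)) (rule \<Gamma>_isometric)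

lemma \<Gamma>_snd_projection: "\<exists>p\<in>\<Gamma>. \<forall>q\<in>\<Gamma>. inner (g - snd p) (snd q) = 0"
  by (rule \<Gamma>_relation(2)) (rule \<Gamma>_isometric)

lemma \<Gamma>_polarized: "p \<in> \<Gamma> \<Longrightarrow> q \<in> \<Gamma> \<Longrightarrow> inner (fst p) (fst q) = inner (snd p) (snd q)"
  by (rule \<Gamma>_relation(3)) (rule \<Gamma>_isometric)

text \<open>Duality against a polynomial \<open>f\<close>: the isometry moves
  \<open>inner g (G\<^sub>\<E> u\<^sup>* f)\<close> to \<open>inner (fst p) (Q G f) = inner (G (fst p)) f\<close>.\<close>

lemma u_apply:
  assumes p: "p \<in> \<Gamma>" "\<And>q. q \<in> \<Gamma> \<Longrightarrow> inner (g - snd p) (snd q) = 0"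
  shows "u \<odot>\<^sub>v fock_coeff (G\<^sub>\<E> g) = fock_coeff (G (fst p))"
proof (rule fpair_ext)
  fix f :: "('d, 'y) fock" assume f: "polynomial f"
  note q = \<Gamma>_poly[OF f]
  have "fpair (u \<odot>\<^sub>v fock_coeff (G\<^sub>\<E> g)) f = inner g (G\<^sub>\<E> (series_adj u f))"
    by (simp add: fpair_nc_apply fpair_fock f u_series polynomial_series_adj inner_dbr_op \<E>_schur)
  also have "\<dots> = inner (snd p) (G\<^sub>\<E> (series_adj u f))"
    using p(2)[OF q] by (simp add: inner_diff_left)
  also have "\<dots> = inner (fst p) (Q (G f))" using \<Gamma>_polarized[OF p(1) q] by simp
  also have "\<dots> = inner (G (fst p)) f"
    by (simp add: inner_Q[symmetric] \<Gamma>_ranges(1)[OF p(1)] inner_dbr_op schur)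
  finally show "fpair (u \<odot>\<^sub>v fock_coeff (G\<^sub>\<E> g)) f = fpair (fock_coeff (G (fst p))) f"
    by (simp add: fpair_fock f)
qed

lemma u_apply_\<Gamma>: "p \<in> \<Gamma> \<Longrightarrow> u \<odot>\<^sub>v fock_coeff (G\<^sub>\<E> (snd p)) = fock_coeff (G (fst p))"
  by (rule u_apply) simp_all

lemma u_maps_dbr:
  assumes "\<sigma> \<in> dbr \<E>"
  shows "u \<odot>\<^sub>v \<sigma> \<in> dbr S"
proof -
  obtain g where g: "\<sigma> = fock_coeff (G\<^sub>\<E> g)" using assms by (auto simp: dbr_def)
  obtain p where "p \<in> \<Gamma>" "\<And>q. q \<in> \<Gamma> \<Longrightarrow> inner (g - snd p) (snd q) = 0"
    using \<Gamma>_snd_projection[of g] by blast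
  from u_apply[OF this] show ?thesis by (simp add: g dbr_def)
qed

lemma lift_fst: "p \<in> \<Gamma> \<Longrightarrow> dbr_lift S (fock_coeff (G (V y + fst p))) = V y + fst p"
  by (rule dbr_lift_eq[OF schur])
    (simp add: inner_add_left \<Gamma>_ranges(2) V_def inner_dbr_op schur)

lemma lift_snd: "p \<in> \<Gamma> \<Longrightarrow> dbr_lift \<E> (fock_coeff (G\<^sub>\<E> (snd p))) = snd p"
  by (rule dbr_lift_eq[OF \<E>_schur]) (rule \<Gamma>_ranges(3))

text \<open>By \<open>u_apply\<close> the kernel of \<open>M\<^sub>u\<close> consists of the \<open>G\<^sub>\<E> k\<close> with \<open>k\<close> orthogonal to the second
  components of \<open>\<Gamma>\<close>: the pair over such a \<open>k\<close> is zero, and conversely \<open>G (fst p) = 0\<close> forces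
  \<open>fst p = 0\<close>, as \<open>fst p\<close> is orthogonal to the kernel of \<open>G\<close>.  So the lifts of elements of
  \<open>\<M>\<close> are those second components.\<close>

lemma parameter_space: "dbr_ominus_ker \<E> u = (\<lambda>p. fock_coeff (G\<^sub>\<E> (snd p))) ` \<Gamma>"
proof (intro equalityI subsetI)
  fix \<sigma> assume \<sigma>: "\<sigma> \<in> dbr_ominus_ker \<E> u"
  hence "\<sigma> \<in> dbr \<E>" by (simp add: dbr_ominus_ker_def)
  then obtain g where g: "\<sigma> = fock_coeff (G\<^sub>\<E> g)" "\<And>m. G\<^sub>\<E> m = 0 \<Longrightarrow> inner g m = 0"
    by (rule dbr_cases) blast
  obtain p where p: "p \<in> \<Gamma>" "\<And>q. q \<in> \<Gamma> \<Longrightarrow> inner (g - snd p) (snd q) = 0"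
    using \<Gamma>_snd_projection[of g] by blast
  define k where "k = g - snd p"
  have lift_k: "dbr_lift \<E> (fock_coeff (G\<^sub>\<E> k)) = k"
    by (rule dbr_lift_eq[OF \<E>_schur]) (simp add: k_def inner_diff_left g(2) \<Gamma>_ranges(3)[OF p(1)])
  have "(0, 0) \<in> \<Gamma>" using subspace_0[OF \<Gamma>_subspace] by (simp add: zero_prod_def)
  hence "u \<odot>\<^sub>v fock_coeff (G\<^sub>\<E> k) = fock_coeff (G 0)"
    using u_apply[of "(0, 0)" k] p(2) by (simp add: k_def)
  hence "fock_coeff (G\<^sub>\<E> k) \<in> dbr_ker \<E> u"
    unfolding dbr_ker_def dbr_def by (auto simp: blinfun.zero_right zero_fock.rep_eq fun_eq_iff)
  hence "dbr_cinner \<E> \<sigma> (fock_coeff (G\<^sub>\<E> k)) = 0" using \<sigma> by (simp add: dbr_ominus_ker_def)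
  hence "cinner g k = 0" by (simp add: dbr_cinner_def g(1) lift_k dbr_lift_eq[OF \<E>_schur g(2)])
  hence "inner g k = 0" by (metis Re_cinner zero_complex.simps(1))
  moreover have "inner k (snd p) = 0" using p k_def by simp
  ultimately have "inner k k = 0" by (simp add: k_def inner_diff_left inner_diff_right inner_commute)
  hence "g = snd p" by (simp add: k_def)
  thus "\<sigma> \<in> (\<lambda>p. fock_coeff (G\<^sub>\<E> (snd p))) ` \<Gamma>" using p(1) g(1) by blast
next
  fix \<sigma> assume "\<sigma> \<in> (\<lambda>p. fock_coeff (G\<^sub>\<E> (snd p))) ` \<Gamma>"
  then obtain p where p: "p \<in> \<Gamma>" "\<sigma> = fock_coeff (G\<^sub>\<E> (snd p))" by blast
  have "dbr_cinner \<E> \<sigma> \<kappa> = 0" if \<kappa>: "\<kappa> \<in> dbr_ker \<E> u" for \<kappa>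
  proof -
    have "\<kappa> \<in> dbr \<E>" using \<kappa> by (simp add: dbr_ker_def)
    then obtain k where k: "\<kappa> = fock_coeff (G\<^sub>\<E> k)" "\<And>m. G\<^sub>\<E> m = 0 \<Longrightarrow> inner k m = 0"
      by (rule dbr_cases) blast
    obtain p' where p': "p' \<in> \<Gamma>" "\<And>q. q \<in> \<Gamma> \<Longrightarrow> inner (k - snd p') (snd q) = 0"
      using \<Gamma>_snd_projection[of k] by blast
    have "fock_coeff (G (fst p')) = (\<lambda>_. 0)"
      using u_apply[OF p'] \<kappa> by (simp add: dbr_ker_def k(1))
    hence "G (fst p') = 0" by (simp add: fock_eq_iff zero_fock.rep_eq)
    hence "inner (fst p') (fst p') = 0" by (rule \<Gamma>_ranges(2)[OF p'(1)])
    hence "snd p' = 0" using \<Gamma>_isometric[OF p'(1)] by simp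
    hence orth: "inner (0, k) q = 0" if "q \<in> \<Gamma>" for q
      using p'(2)[OF that] by (simp add: inner_prod_def)
    have "cinner 0 (fst p) = 0" using norm_cinner_le[of 0 "fst p"] by simp
    moreover have "cinner (0, k) p = 0" by (rule orthogonal_cinner_eq_0[OF \<Gamma>_csubspace orth p(1)])
    ultimately have "cinner k (snd p) = 0" by (simp add: cinner_prod_def)
    hence "cinner (snd p) k = 0" by (metis cinner_commute complex_cnj_zero)
    thus ?thesis
      by (simp add: dbr_cinner_def p k(1) lift_snd dbr_lift_eq[OF \<E>_schur k(2)])
  qed
  thus "\<sigma> \<in> dbr_ominus_ker \<E> u" by (simp add: dbr_ominus_ker_def p dbr_def)
qed

definition "f0 x = ((nc_const E - S \<odot> nc_const N) \<odot> nc_resolvent T) \<odot>\<^sub>v nc_const (op_inv P x)"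

lemma f0_eq: "f0 x = fock_coeff (G (V (op_inv P x)))"
proof -
  have "nc_resolvent T \<odot>\<^sub>v nc_const y = (\<lambda>\<alpha>. word_op T \<alpha> y)" for y
    by (simp add: nc_resolvent_eq T_clinear nc_apply_const_right)
  thus ?thesis
    by (simp add: f0_def G_V minus_fock.rep_eq[abs_def] fock_coeff_mult_op schur fock_coeff_obs_op stable N_stable
        nc_apply_diff_left nc_apply_assoc nc_apply_const_left obs_series_def fun_eq_iff)
qed

lemma f0_plus: "p \<in> \<Gamma> \<Longrightarrow> f0 x + u \<odot>\<^sub>v fock_coeff (G\<^sub>\<E> (snd p)) = fock_coeff (G (V (op_inv P x) + fst p))"
  by (simp add: f0_eq u_apply_\<Gamma> blinfun.add_right plus_fock.rep_eq fun_eq_iff)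

text \<open>The first components of \<open>\<Gamma>\<close> are the homogeneous lifts.  The part \<open>y\<close> of \<open>h\<close> orthogonal to
  all of them satisfies \<open>inner (G Q y) f = 0\<close> for every polynomial \<open>f\<close>; so \<open>Q y\<close> lies in the
  kernel of \<open>G\<close> and is orthogonal to \<open>h = Q h\<close>.\<close>

lemma fst_\<Gamma>:
  assumes h: "Q h = h" "\<And>m. G m = 0 \<Longrightarrow> inner h m = 0"
  obtains p where "p \<in> \<Gamma>" "fst p = h"
proof -
  obtain p where p: "p \<in> \<Gamma>" "\<And>q. q \<in> \<Gamma> \<Longrightarrow> inner (h - fst p) (fst q) = 0"
    using \<Gamma>_fst_projection[of h] by blast
  define y where "y = h - fst p"
  have "G (Q y) = 0"
  proof (rule fock_eqI_polynomial)
    fix f :: "('d, 'y) fock" assume f: "polynomial f"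
    show "inner (G (Q y)) f = inner 0 f"
      using p(2)[OF \<Gamma>_poly[OF f]] by (simp add: y_def inner_dbr_op schur inner_Q)
  qed
  hence "inner h (Q y) = 0" by (rule h(2))
  hence "inner h y = 0" by (metis h(1) inner_Q)
  moreover have "inner (fst p) y = 0" using p(2)[OF p(1)] by (simp add: y_def inner_commute)
  ultimately have "inner y y = 0" by (simp add: y_def inner_diff_left)
  thus ?thesis using that p(1) by (simp add: y_def)
qed

text \<open>For the lift \<open>h\<close> of \<open>f\<close> the condition is \<open>V\<^sup>* h = x\<close>, which means
  \<open>h = V P\<^sup>-\<^sup>1 x + Q h\<close>.\<close>

lemma solutions:
  "f \<in> dbr S \<and> op_adj \<O> (Abs_fock f) = x \<longleftrightarrow> (\<exists>\<sigma>\<in>dbr_ominus_ker \<E> u. f = f0 x + u \<odot>\<^sub>v \<sigma>)"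
proof
  assume f: "f \<in> dbr S \<and> op_adj \<O> (Abs_fock f) = x"
  then obtain h where h: "f = fock_coeff (G h)" "\<And>m. G m = 0 \<Longrightarrow> inner h m = 0"
    using dbr_cases by blast
  have Vh: "op_adj V h = x" using f by (simp add: op_adj_V h(1) fock_coeff_inverse)
  have "inner (Q h) m = 0" if "G m = 0" for m
    using that by (simp add: Q_apply inner_diff_left h(2) V_def inner_dbr_op schur)
  then obtain p where p: "p \<in> \<Gamma>" "fst p = Q h" using fst_\<Gamma>[of "Q h"] Q_Q by metis
  have "V (op_inv P x) + fst p = h" by (simp add: p Q_apply Vh)
  hence "f = f0 x + u \<odot>\<^sub>v fock_coeff (G\<^sub>\<E> (snd p))" by (simp add: f0_plus p(1) h(1))
  thus "\<exists>\<sigma>\<in>dbr_ominus_ker \<E> u. f = f0 x + u \<odot>\<^sub>v \<sigma>" using p(1) by (auto simp: parameter_space)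
next
  assume "\<exists>\<sigma>\<in>dbr_ominus_ker \<E> u. f = f0 x + u \<odot>\<^sub>v \<sigma>"
  then obtain p where p: "p \<in> \<Gamma>" "f = fock_coeff (G (V (op_inv P x) + fst p))"
    by (auto simp: parameter_space f0_plus)
  have "op_adj V (fst p) = 0" using V_adj_Q[of "fst p"] by (simp add: \<Gamma>_ranges(1)[OF p(1)])
  hence "op_adj \<O> (G (V (op_inv P x) + fst p)) = x"
    by (simp add: op_adj_V[symmetric] blinfun.add_right V_adj_V P_inv)
  thus "f \<in> dbr S \<and> op_adj \<O> (Abs_fock f) = x"
    by (simp add: p(2) fock_coeff_inverse dbr_def)
qed

text \<open>The lifts of \<open>f0\<close> and \<open>u \<sigma>\<close> are \<open>V P\<^sup>-\<^sup>1 x\<close> and \<open>fst p\<close> for some \<open>p\<close> in \<open>\<Gamma>\<close>, and the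
  range of \<open>V\<close> is orthogonal to that of \<open>Q\<close>.\<close>

lemma solution_norms:
  assumes "\<sigma> \<in> dbr_ominus_ker \<E> u"
  shows "(dbr_norm S (f0 x + u \<odot>\<^sub>v \<sigma>))\<^sup>2 = (dbr_norm S (f0 x))\<^sup>2 + (dbr_norm S (u \<odot>\<^sub>v \<sigma>))\<^sup>2"
    and "(dbr_norm S (f0 x))\<^sup>2 = (norm (op_sqrt (op_inv P) x))\<^sup>2"
    and "dbr_norm S (u \<odot>\<^sub>v \<sigma>) = dbr_norm \<E> \<sigma>"
proof -
  obtain p where p: "p \<in> \<Gamma>" "\<sigma> = fock_coeff (G\<^sub>\<E> (snd p))" using assms by (auto simp: parameter_space)
  have z: "(0, 0) \<in> \<Gamma>" using subspace_0[OF \<Gamma>_subspace] by (simp add: zero_prod_def)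
  have n: "dbr_norm S (f0 x + u \<odot>\<^sub>v \<sigma>) = norm (V (op_inv P x) + fst p)"
    unfolding p(2) f0_plus[OF p(1)] by (simp add: dbr_norm_def lift_fst[OF p(1)])
  have n0: "dbr_norm S (f0 x) = norm (V (op_inv P x))"
    unfolding f0_eq using lift_fst[OF z, of "op_inv P x"] by (simp add: dbr_norm_def)
  have n1: "dbr_norm S (u \<odot>\<^sub>v \<sigma>) = norm (fst p)"
    unfolding p(2) u_apply_\<Gamma>[OF p(1)] using lift_fst[OF p(1), of 0]
    by (simp add: dbr_norm_def blinfun.zero_right)
  have "inner (V (op_inv P x)) (fst p) = 0"
    using inner_V_Q[of "op_inv P x" "fst p"] by (simp add: \<Gamma>_ranges(1)[OF p(1)])
  thus "(dbr_norm S (f0 x + u \<odot>\<^sub>v \<sigma>))\<^sup>2 = (dbr_norm S (f0 x))\<^sup>2 + (dbr_norm S (u \<odot>\<^sub>v \<sigma>))\<^sup>2"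
    unfolding n n0 n1 power2_norm_eq_inner by (simp add: inner_simps inner_commute)
  show "dbr_norm S (u \<odot>\<^sub>v \<sigma>) = dbr_norm \<E> \<sigma>"
    unfolding n1 by (simp add: dbr_norm_def p lift_snd \<Gamma>_isometric)
  have "(norm (V (op_inv P x)))\<^sup>2 = inner (op_inv P x) (op_adj V (V (op_inv P x)))"
    by (simp add: power2_norm_eq_inner inner_op_adj[OF V_clinear])
  thus "(dbr_norm S (f0 x))\<^sup>2 = (norm (op_sqrt (op_inv P) x))\<^sup>2"
    by (simp add: n0 V_adj_V P_inv norm_op_sqrt[OF P_inv(3)])
qed

end

section \<open>The interpolation theorem\<close>

theorem theorem3p17:
  fixes E :: "'x::{chilbert_space,second_countable_topology} \<Rightarrow>\<^sub>L
                'y::{chilbert_space,second_countable_topology}"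
    and T :: "'d::finite \<Rightarrow> 'x \<Rightarrow>\<^sub>L 'x"
    and x :: 'x
    and S0 :: "'d list \<Rightarrow> 'u::{chilbert_space,second_countable_topology} \<Rightarrow>\<^sub>L 'y"
    and N :: "'x \<Rightarrow>\<^sub>L 'u"
    and P :: "'x \<Rightarrow>\<^sub>L 'x"
    and C :: "'x \<Rightarrow>\<^sub>L ('y \<times> 'u)"
    and B :: "('f::{chilbert_space,second_countable_topology} \<times> 'u) \<Rightarrow>\<^sub>L ('x ^ 'd)"
    and D :: "('f \<times> 'u) \<Rightarrow>\<^sub>L ('y \<times> 'u)"
    and \<AA> :: "'d list \<Rightarrow> ('f \<times> 'u) \<Rightarrow>\<^sub>L ('y \<times> 'u)"
  assumes "is_clinear E" and "\<And>i. is_clinear (T i)" and "output_stable E T"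
    and "schur_class S0"
    and "is_clinear N"
    and "op_adj N = op_adj (obs_op E T) o\<^sub>L mult_op S0 o\<^sub>L const_op"
    and "P = (op_adj (obs_op E T) o\<^sub>L obs_op E T) - (op_adj (obs_op N T) o\<^sub>L obs_op N T)"
    and "op_strictly_pos P"
    and "C = col2 E N"
    and "is_clinear B" and "is_clinear D" and "inj (blinfun_apply (col2 B D))"
    and "col2 B D o\<^sub>L J_op o\<^sub>L op_adj (col2 B D) =
           diag2 (tensor_id (op_inv P)) J_op -
           (col2 (col T) C o\<^sub>L op_inv P o\<^sub>L op_adj (col2 (col T) C))"
    and "\<AA> = nc_transfer T C B D"
  shows "(\<exists>\<E>0 :: 'd list \<Rightarrow> 'u \<Rightarrow>\<^sub>L 'f.
             schur_class \<E>0 \<and>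
             nc_invertible (blk21 \<AA> \<odot> \<E>0 + blk22 \<AA>) \<and>
             S0 = (blk11 \<AA> \<odot> \<E>0 + blk12 \<AA>) \<odot> nc_inv (blk21 \<AA> \<odot> \<E>0 + blk22 \<AA>)) \<and>
         (\<forall>\<E>0 :: 'd list \<Rightarrow> 'u \<Rightarrow>\<^sub>L 'f.
             schur_class \<E>0 \<and>
             nc_invertible (blk21 \<AA> \<odot> \<E>0 + blk22 \<AA>) \<and>
             S0 = (blk11 \<AA> \<odot> \<E>0 + blk12 \<AA>) \<odot> nc_inv (blk21 \<AA> \<odot> \<E>0 + blk22 \<AA>) \<longrightarrow>
             (let u = blk11 \<AA> - S0 \<odot> blk21 \<AA>;
                  \<M> = dbr_ominus_ker \<E>0 u;
                  f0 = ((nc_const E - S0 \<odot> nc_const N) \<odot> nc_resolvent T) \<odot>\<^sub>v nc_const (op_inv P x)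
              in (\<forall>\<sigma> \<in> dbr \<E>0. u \<odot>\<^sub>v \<sigma> \<in> dbr S0) \<and>
                 (\<forall>f :: 'd list \<Rightarrow> 'y.
                    f \<in> dbr S0 \<and> op_adj (obs_op E T) (Abs_fock f) = x \<longleftrightarrow>
                    (\<exists>\<sigma> \<in> \<M>. f = f0 + u \<odot>\<^sub>v \<sigma>)) \<and>
                 (\<forall>f. \<forall>\<sigma> \<in> \<M>. f = f0 + u \<odot>\<^sub>v \<sigma> \<longrightarrow>
                    (dbr_norm S0 f)\<^sup>2 = (dbr_norm S0 f0)\<^sup>2 + (dbr_norm S0 (u \<odot>\<^sub>v \<sigma>))\<^sup>2 \<and>
                    (dbr_norm S0 f0)\<^sup>2 + (dbr_norm S0 (u \<odot>\<^sub>v \<sigma>))\<^sup>2 =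
                      (norm (op_sqrt (op_inv P) x))\<^sup>2 + (dbr_norm \<E>0 \<sigma>)\<^sup>2)))"
proof -
  interpret chain_matrix E T S0 N P B D
    using assms by unfold_locales simp_all
  have \<AA>: "nc_transfer T (col2 E N) B D = \<AA>" using assms by simp
  show ?thesis (is "?exists \<and> ?solutions")
  proof (intro conjI)
    show ?exists using parameter_exists unfolding \<AA> .
    show ?solutions
    proof (intro allI impI, elim conjE)
      fix \<E>0 :: "'d list \<Rightarrow> 'u \<Rightarrow>\<^sub>L 'f"
      assume \<E>0: "schur_class \<E>0" "nc_invertible (blk21 \<AA> \<odot> \<E>0 + blk22 \<AA>)"
        "S0 = (blk11 \<AA> \<odot> \<E>0 + blk12 \<AA>) \<odot> nc_inv (blk21 \<AA> \<odot> \<E>0 + blk22 \<AA>)"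
      interpret parametrized_interpolant E T S0 N P B D \<E>0
      proof unfold_locales
        show "schur_class \<E>0" by (rule \<E>0(1))
        show "u \<odot> \<E>0 = v" using parameter_iff[unfolded \<AA>, OF \<E>0(2)] \<E>0(3) by (rule iffD1)
      qed
      show "let u = blk11 \<AA> - S0 \<odot> blk21 \<AA>;
                \<M> = dbr_ominus_ker \<E>0 u;
                f0 = ((nc_const E - S0 \<odot> nc_const N) \<odot> nc_resolvent T) \<odot>\<^sub>v nc_const (op_inv P x)
            in (\<forall>\<sigma> \<in> dbr \<E>0. u \<odot>\<^sub>v \<sigma> \<in> dbr S0) \<and>
               (\<forall>f. f \<in> dbr S0 \<and> op_adj (obs_op E T) (Abs_fock f) = x \<longleftrightarrow>
                  (\<exists>\<sigma> \<in> \<M>. f = f0 + u \<odot>\<^sub>v \<sigma>)) \<and>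
               (\<forall>f. \<forall>\<sigma> \<in> \<M>. f = f0 + u \<odot>\<^sub>v \<sigma> \<longrightarrow>
                  (dbr_norm S0 f)\<^sup>2 = (dbr_norm S0 f0)\<^sup>2 + (dbr_norm S0 (u \<odot>\<^sub>v \<sigma>))\<^sup>2 \<and>
                  (dbr_norm S0 f0)\<^sup>2 + (dbr_norm S0 (u \<odot>\<^sub>v \<sigma>))\<^sup>2 =
                    (norm (op_sqrt (op_inv P) x))\<^sup>2 + (dbr_norm \<E>0 \<sigma>)\<^sup>2)"
        unfolding Let_def \<AA>[symmetric] u_def[symmetric] f0_def[symmetric]
        using u_maps_dbr solutions solution_norms by auto
    qed
  qed
qed

end
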